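(* Let $\Gamma$ be a finite weighted directed graph which satisfies the obvious conditions for the dynamic portrait of a NET map with degree $d$. Let $m$ and $n$ be positive integers such that $n\mid m$ and $mn=d$. Then there exists a NET map with dynamic portrait isomorphic to $\Gamma$ and elementary divisors $m$ and $n$ if and only if $m$ and $n$ are congruent modulo $2$ to the mod $2$ elementary divisors of $\Gamma$ (that is, $(m,n)$ is congruent modulo $2$, coordinatewise, to the pair of mod $2$ elementary divisors of $\Gamma$).
   Context: A Thurston map is an orientation-preserving branched covering $f\colon S^2\to S^2$ of degree at least $2$ whose postcritical set $P_f=\bigcup_{k\ge 1}f^{k}(C_f)$ is finite, where $C_f$ is the set of critical points. A nearly Euclidean Thurston (NET) map is a Thurston map each of whose critical points is simple (local degree $2$) and whose postcritical set has exactly four points. Elementary divisors. For every NET map $f$ the set $P_1$ of noncritical points in $f^{-1}(P_f)$ has exactly four elements, and there exist lattices $\Lambda_1\subseteq\Lambda_2$ in $\mathbb{R}^2$ and orientation-preserving branched coverings $\pi_1,\pi_2\colon\mathbb{R}^2\to S^2$ with $f\circ\pi_1=\pi_2$ such that $\pi_i$ is a normal covering with deck group $\{x\mapsto 2\lambda\pm x:\lambda\in\Lambda_i\}$ for $i=1,2$, $\pi_1(\Lambda_1)=P_1$ and $\pi_2(\Lambda_2)=P_f$. The elementary divisors $(m,n)$ of $f$ are the unique positive integers with $n\mid m$ and $\Lambda_2/\Lambda_1\cong(\mathbb{Z}/m\mathbb{Z})\oplus(\mathbb{Z}/n\mathbb{Z})$; then $\deg f=mn$. Dynamic portraits. The dynamic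 portrait of a Thurston map $f$ is the weighted directed graph with vertex set $C_f\cup P_f$ and, for each vertex $x$, one edge from $x$ to $f(x)$ with weight the local degree $\deg(f,x)$. Obvious conditions. Let $\Gamma$ be a finite directed graph with edges weighted by positive integers and exactly one edge emanating from every vertex. A vertex is critical if its outgoing edge has weight greater than $1$; a critical value is the terminal vertex of the edge leaving a critical vertex; a postcritical vertex is one reached from a critical vertex by a directed path of length at least $1$. The incoming degree of a vertex is the sum of the weights of the edges ending at it. $\Gamma$ satisfies the obvious conditions for the dynamic portrait of a Thurston map if exactly one edge emanates from every vertex, every vertex is critical or postcritical, and there is an integer $d\ge2$ (the degree of $\Gamma$) such that $\sum_{v}(w(v)-1)=2d-2$ (sum over critical vertices $v$, $w(v)$ being the weight of the edge leaving $v$) and every incoming degree is at most $d$. It satisfies the obvious conditions for the dynamic portrait of a NET map if in addition every edge weight is $1$ or $2$ and there are exactly four postcritical vertices. Mod $2$ elementary divisors. For $\Gamma$ satisfying the obvious conditions for the dynamic portrait of a NET map with degree $d$, let $k$ be the number of critical values $x$ of $\Gamma$ whose incoming degree is $d$ and such that no edge of $\Gamma$ ending at $x$ has weight $1$. Then $k\in\{0,2,3\}$, and the mod $2$ elementary divisors of $\Gamma$ are defined to be $(1,1)$, $(0,1)$ or $(0,0)$ according to whether $k=0$, $2$ or $3$. *)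

theory Defs
  imports
    "HOL-Complex_Analysis.Winding_Numbers"
    "HOL-Algebra.Elementary_Groups"
    "HOL-Number_Theory.Cong"
    "Graph_Theory.Digraph_Isomorphism"
begin

section \<open>Oriented surfaces and branched coverings\<close>

text \<open>
  An oriented surface is given by an atlas of charts (domain, map to the complex plane) whose
  transition maps preserve the orientation of the complex plane; its points are the union of
  the chart domains, with the topology induced from the ambient type.
\<close>

type_synonym 'a atlas = "('a set \<times> ('a \<Rightarrow> complex)) set"

definition points :: "'a atlas \<Rightarrow> 'a set" where
  "points A = (\<Union>(D, \<kappa>) \<in> A. D)"

definition plane :: "(real^2) atlas" where
  "plane = {(UNIV, \<lambda>x. Complex (x $ 1) (x $ 2))}"

abbreviation S2 :: "(real^3) set" where
  "S2 \<equiv> sphere 0 1"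

text \<open>
  Stereographic projection from the south pole, and the conjugate of stereographic projection
  from the north pole. The transition map is inversion (see \<open>stereo_transition\<close>), and the
  orientation is the one given by the outward normal.
\<close>

definition stereo_south :: "real^3 \<Rightarrow> complex" where
  "stereo_south x = Complex (x $ 1) (x $ 2) / of_real (1 + x $ 3)"

definition stereo_north :: "real^3 \<Rightarrow> complex" where
  "stereo_north x = Complex (x $ 1) (- (x $ 2)) / of_real (1 - x $ 3)"

definition two_sphere :: "(real^3) atlas" where
  "two_sphere = {(S2 - {- axis 3 1}, stereo_south), (S2 - {axis 3 1}, stereo_north)}"

lemma points_plane: "points plane = UNIV"
  by (simp add: points_def plane_def)

lemma points_two_sphere: "points two_sphere = S2"
proof -
  have "- axis 3 1 \<noteq> (axis 3 1 :: real^3)"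
    by (simp add: vec_eq_iff axis_def)
  then show ?thesis
    by (auto simp: points_def two_sphere_def)
qed

lemma stereo_transition:
  assumes "x \<in> S2 - {axis 3 1, - axis 3 1}"
  shows "stereo_north x = inverse (stereo_south x)"
proof -
  have n: "(x $ 1)\<^sup>2 + (x $ 2)\<^sup>2 + (x $ 3)\<^sup>2 = 1"
    using assms by (simp add: norm_vec_def L2_set_def sum_3)
  have ne: "(x $ 1)\<^sup>2 + (x $ 2)\<^sup>2 \<noteq> 0"
  proof
    assume z: "(x $ 1)\<^sup>2 + (x $ 2)\<^sup>2 = 0"
    then have "(x $ 3)\<^sup>2 = 1" using n by simp
    then have "x $ 3 = 1 \<or> x $ 3 = -1" by (simp add: power2_eq_1_iff)
    moreover have "x $ 1 = 0" "x $ 2 = 0" using z by auto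
    ultimately have "x = axis 3 1 \<or> x = - axis 3 1"
      by (auto simp: vec_eq_iff axis_def forall_3)
    then show False using assms by auto
  qed
  have a: "(1 + x $ 3) * (1 - x $ 3) = (x $ 1)\<^sup>2 + (x $ 2)\<^sup>2"
    using n by (simp add: algebra_simps power2_eq_square)
  have nz: "1 + x $ 3 \<noteq> 0" "1 - x $ 3 \<noteq> 0" using a ne by auto
  have "stereo_north x * stereo_south x =
      of_real ((x $ 1)\<^sup>2 + (x $ 2)\<^sup>2) / of_real ((1 + x $ 3) * (1 - x $ 3))"
    unfolding stereo_north_def stereo_south_def
    by (simp add: complex_eq_iff power2_eq_square mult_ac)
  also have "\<dots> = 1" unfolding a using ne by (metis divide_self of_real_eq_0_iff)
  finally show ?thesis by (metis inverse_unique mult.commute)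
qed

text \<open>
  An oriented coordinate disc: an orientation-preserving homeomorphism of an open set \<open>U\<close> onto the
  unit disc. A homeomorphism preserves orientation iff, read in the charts of the atlas, it maps
  small positively oriented circles about each point to loops of winding number one about the
  image point.
\<close>

definition oriented_disc ::
    "'a::topological_space atlas \<Rightarrow> 'a set \<Rightarrow> ('a \<Rightarrow> complex) \<Rightarrow> bool" where
  "oriented_disc A U \<phi> \<longleftrightarrow>
     openin (top_of_set (points A)) U \<and>
     (\<exists>\<phi>'. homeomorphism U (ball 0 1) \<phi> \<phi>') \<and>
     (\<forall>(D, \<kappa>) \<in> A. \<forall>p \<in> U \<inter> D. \<forall>\<^sub>F r in at_right 0.
        winding_number (\<phi> \<circ> inv_into D \<kappa> \<circ> circlepath (\<kappa> p) r) (\<phi> p) = 1)"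

text \<open>
  Orientation-preserving branched coverings, possibly with infinitely many sheets: every point of
  the target has a disc neighbourhood whose preimage is a disjoint union of discs, on each of which
  the map is a power map in suitable oriented coordinates.
\<close>

definition branched_covering ::
    "'a::topological_space atlas \<Rightarrow> 'b::topological_space atlas \<Rightarrow> ('a \<Rightarrow> 'b) \<Rightarrow> bool" where
  "branched_covering A B f \<longleftrightarrow>
     continuous_on (points A) f \<and> f ` points A = points B \<and>
     (\<forall>y \<in> points B. \<exists>V \<psi> \<U>.
        y \<in> V \<and> oriented_disc B V \<psi> \<and> \<psi> y = 0 \<and>
        pairwise disjnt \<U> \<and> \<Union>\<U> = {x \<in> points A. f x \<in> V} \<and>
        (\<forall>U \<in> \<U>. \<exists>\<phi> d. d \<ge> 1 \<and> oriented_disc A U \<phi> \<and> (\<forall>x \<in> U. \<psi> (f x) = \<phi> x ^ d)))"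

definition local_degree ::
    "'a::topological_space atlas \<Rightarrow> 'b::topological_space atlas \<Rightarrow> ('a \<Rightarrow> 'b) \<Rightarrow> 'a \<Rightarrow> nat" where
  "local_degree A B f x = (THE d. d \<ge> 1 \<and> (\<exists>U \<phi> V \<psi>.
     x \<in> U \<and> oriented_disc A U \<phi> \<and> \<phi> x = 0 \<and>
     f x \<in> V \<and> oriented_disc B V \<psi> \<and> \<psi> (f x) = 0 \<and>
     f ` U \<subseteq> V \<and> (\<forall>u \<in> U. \<psi> (f u) = \<phi> u ^ d)))"

definition covering_degree ::
    "'a::topological_space atlas \<Rightarrow> 'b::topological_space atlas \<Rightarrow> ('a \<Rightarrow> 'b) \<Rightarrow> nat" where
  "covering_degree A B f =
     (THE d. \<forall>y \<in> points B. (\<Sum>x \<in> {x \<in> points A. f x = y}. local_degree A B f x) = d)"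

definition deck_group :: "('a::topological_space \<Rightarrow> 'b) \<Rightarrow> ('a \<Rightarrow> 'a) set" where
  "deck_group \<pi> = {g. (\<exists>g'. homeomorphism UNIV UNIV g g') \<and> \<pi> \<circ> g = \<pi>}"

definition normal_covering :: "('a::topological_space \<Rightarrow> 'b) \<Rightarrow> bool" where
  "normal_covering \<pi> \<longleftrightarrow> (\<forall>x y. \<pi> x = \<pi> y \<longrightarrow> (\<exists>g \<in> deck_group \<pi>. g x = y))"


section \<open>Thurston maps and NET maps\<close>

abbreviation sphere_degree :: "(real^3 \<Rightarrow> real^3) \<Rightarrow> real^3 \<Rightarrow> nat" where
  "sphere_degree \<equiv> local_degree two_sphere two_sphere"

definition critical_set :: "(real^3 \<Rightarrow> real^3) \<Rightarrow> (real^3) set" where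
  "critical_set f = {x \<in> S2. sphere_degree f x > 1}"

definition postcritical_set :: "(real^3 \<Rightarrow> real^3) \<Rightarrow> (real^3) set" where
  "postcritical_set f = (\<Union>k \<in> {1..}. (f ^^ k) ` critical_set f)"

definition thurston_map :: "(real^3 \<Rightarrow> real^3) \<Rightarrow> bool" where
  "thurston_map f \<longleftrightarrow> branched_covering two_sphere two_sphere f \<and>
     covering_degree two_sphere two_sphere f \<ge> 2 \<and> finite (postcritical_set f)"

definition NET_map :: "(real^3 \<Rightarrow> real^3) \<Rightarrow> bool" where
  "NET_map f \<longleftrightarrow> thurston_map f \<and> (\<forall>c \<in> critical_set f. sphere_degree f c = 2) \<and>
     card (postcritical_set f) = 4"


section \<open>Elementary divisors\<close>

definition plane_lattice :: "(real^2) set \<Rightarrow> bool" where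
  "plane_lattice L \<longleftrightarrow> (\<exists>u v. u \<noteq> v \<and> independent {u, v} \<and>
     L = {of_int a *\<^sub>R u + of_int b *\<^sub>R v | a b. True})"

definition lattice_group :: "(real^2) set \<Rightarrow> (real^2) monoid" where
  "lattice_group L = \<lparr>carrier = L, mult = (+), one = 0\<rparr>"

definition lattice_covering :: "(real^2) set \<Rightarrow> (real^2 \<Rightarrow> real^3) \<Rightarrow> bool" where
  "lattice_covering L \<pi> \<longleftrightarrow> branched_covering plane two_sphere \<pi> \<and> normal_covering \<pi> \<and>
     deck_group \<pi> = (\<Union>l \<in> L. {\<lambda>x. 2 *\<^sub>R l + x, \<lambda>x. 2 *\<^sub>R l - x})"

definition noncritical_preimages :: "(real^3 \<Rightarrow> real^3) \<Rightarrow> (real^3) set" where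
  "noncritical_preimages f = {x \<in> S2. f x \<in> postcritical_set f} - critical_set f"

definition elementary_divisors :: "(real^3 \<Rightarrow> real^3) \<Rightarrow> nat \<Rightarrow> nat \<Rightarrow> bool" where
  "elementary_divisors f m n \<longleftrightarrow> m > 0 \<and> n > 0 \<and> n dvd m \<and>
     (\<exists>L1 L2 \<pi>1 \<pi>2. plane_lattice L1 \<and> plane_lattice L2 \<and> L1 \<subseteq> L2 \<and>
        lattice_covering L1 \<pi>1 \<and> lattice_covering L2 \<pi>2 \<and> f \<circ> \<pi>1 = \<pi>2 \<and>
        \<pi>1 ` L1 = noncritical_preimages f \<and> \<pi>2 ` L2 = postcritical_set f \<and>
        (lattice_group L2 Mod L1) \<cong> (integer_mod_group m \<times>\<times> integer_mod_group n))"


section \<open>Weighted directed graphs and dynamic portraits\<close>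

text \<open>A weighted directed graph is a pair of a digraph and a weight function on its arcs.\<close>

definition weighted_digraph :: "('v, 'e) pre_digraph \<Rightarrow> ('e \<Rightarrow> nat) \<Rightarrow> bool" where
  "weighted_digraph G w \<longleftrightarrow> fin_digraph G \<and> (\<forall>e \<in> arcs G. w e > 0)"

definition weighted_iso ::
    "('v, 'e) pre_digraph \<Rightarrow> ('e \<Rightarrow> nat) \<Rightarrow> ('u, 'a) pre_digraph \<Rightarrow> ('a \<Rightarrow> nat) \<Rightarrow> bool" where
  "weighted_iso G w H w' \<longleftrightarrow> (\<exists>h. pre_digraph.digraph_isomorphism G h \<and> H = app_iso h G \<and>
     (\<forall>e \<in> arcs G. w' (iso_arcs h e) = w e))"

text \<open>
  The edge of the dynamic portrait leaving \<open>x\<close> is represented by \<open>x\<close> itself; its weight is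
  \<open>sphere_degree f x\<close>.
\<close>

definition portrait :: "(real^3 \<Rightarrow> real^3) \<Rightarrow> (real^3, real^3) pre_digraph" where
  "portrait f = \<lparr>verts = critical_set f \<union> postcritical_set f,
     arcs = critical_set f \<union> postcritical_set f, tail = (\<lambda>x. x), head = f\<rparr>"

definition vertex_weight :: "('v, 'e) pre_digraph \<Rightarrow> ('e \<Rightarrow> nat) \<Rightarrow> 'v \<Rightarrow> nat" where
  "vertex_weight G w v = w (THE e. e \<in> out_arcs G v)"

definition critical_vertices :: "('v, 'e) pre_digraph \<Rightarrow> ('e \<Rightarrow> nat) \<Rightarrow> 'v set" where
  "critical_vertices G w = {v \<in> verts G. vertex_weight G w v > 1}"

definition critical_values :: "('v, 'e) pre_digraph \<Rightarrow> ('e \<Rightarrow> nat) \<Rightarrow> 'v set" where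
  "critical_values G w = head G ` {e \<in> arcs G. tail G e \<in> critical_vertices G w}"

definition postcritical_vertices :: "('v, 'e) pre_digraph \<Rightarrow> ('e \<Rightarrow> nat) \<Rightarrow> 'v set" where
  "postcritical_vertices G w = {v \<in> verts G. \<exists>u \<in> critical_vertices G w. u \<rightarrow>\<^sup>+\<^bsub>G\<^esub> v}"

definition incoming_degree :: "('v, 'e) pre_digraph \<Rightarrow> ('e \<Rightarrow> nat) \<Rightarrow> 'v \<Rightarrow> nat" where
  "incoming_degree G w v = (\<Sum>e \<in> in_arcs G v. w e)"

definition obvious_thurston :: "('v, 'e) pre_digraph \<Rightarrow> ('e \<Rightarrow> nat) \<Rightarrow> nat \<Rightarrow> bool" where
  "obvious_thurston G w d \<longleftrightarrow>
     (\<forall>v \<in> verts G. \<exists>!e. e \<in> out_arcs G v) \<and>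
     verts G = critical_vertices G w \<union> postcritical_vertices G w \<and>
     d \<ge> 2 \<and>
     (\<Sum>v \<in> critical_vertices G w. vertex_weight G w v - 1) = 2 * d - 2 \<and>
     (\<forall>v \<in> verts G. incoming_degree G w v \<le> d)"

definition obvious_NET :: "('v, 'e) pre_digraph \<Rightarrow> ('e \<Rightarrow> nat) \<Rightarrow> nat \<Rightarrow> bool" where
  "obvious_NET G w d \<longleftrightarrow> obvious_thurston G w d \<and>
     (\<forall>e \<in> arcs G. w e \<in> {1, 2}) \<and> card (postcritical_vertices G w) = 4"

definition full_critical_values :: "('v, 'e) pre_digraph \<Rightarrow> ('e \<Rightarrow> nat) \<Rightarrow> nat \<Rightarrow> 'v set" where
  "full_critical_values G w d = {x \<in> critical_values G w.
     incoming_degree G w x = d \<and> \<not> (\<exists>e \<in> in_arcs G x. w e = 1)}"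

text \<open>For graphs satisfying \<open>obvious_NET G w d\<close> the cardinality below is 0, 2 or 3.\<close>

definition mod2_elementary_divisors ::
    "('v, 'e) pre_digraph \<Rightarrow> ('e \<Rightarrow> nat) \<Rightarrow> nat \<Rightarrow> nat \<times> nat" where
  "mod2_elementary_divisors G w d =
     (let k = card (full_critical_values G w d) in
      if k = 0 then (1, 1) else if k = 2 then (0, 1) else if k = 3 then (0, 0) else undefined)"

end

(*
  Over a postcritical point y lie deg f - 2 c(y) points of P_1, where c(y) is the number of critical
  points over y. In coordinates identifying Lambda_2 / Lambda_1 with Z/m + Z/n, the points of P_f that lie
  outside pi_2(Lambda_1) are exactly those over which every point is critical; since P_f corresponds to
  Lambda_2 / 2 Lambda_2, their number is 0, 2 or 3 according to the parities of m and n. This gives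
  necessity.

  Conversely, let F_{a,b} be the quotient map of the plane by x |-> 2 l +- x for l in aZ x bZ, realized as the
  radial projection of a pillowcase surface, and let f_0 be defined by f_0 o F_{m,n} = F_{1,1}. The
  congruences allow the postcritical vertices to be matched with the four corners j(v) so that the numbers
  of critical preimages agree; then all vertices of the graph lift injectively to points i(v) with
  f_0(i(v)) = j(target of v). A homeomorphism H of the sphere that fixes a nonempty open set pointwise (and so
  preserves orientation) and moves i(v) to j(v) for the postcritical vertices turns f_0 into
  f = f_0 o H^{-1}, which has the prescribed portrait and the lattice coverings H o F_{m,n} and F_{1,1}.
*)

theory Submission
  imports Defs "HOL-Complex_Analysis.Riemann_Mapping"
begin

hide_const (open) Digraph_Component.connected

section \<open>Orientation at a point\<close>

text \<open>The numbers 0, 2, 3 come from a Riemann-Hurwitz count: the four defects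
  \<open>d - 2 c(y)\<close> are nonnegative with sum \<open>4 d - 2 (2 d - 2) = 4\<close>. For odd
  \<open>d\<close> they are 1, 1, 1, 1; for even \<open>d\<close> they are even, hence 2, 2, 0, 0 or
  4, 0, 0, 0. The defect of a corner is a product of two solution counts modulo 2, and these
  products give the same lists. The main obstacle is orientation: it is defined by winding numbers
  of merely continuous maps, so no Jacobian is at hand. For an injective continuous map the winding
  number of small circles is locally constant in the centre. Hence the pillowcase map is tested only
  at the centre of its rectangle, by an inner product estimate, and connectedness of the complement
  of a countable set carries the result to all points off the lattice. In the same way the
  orientation of the map corrected by H reduces to one point over the open set that H fixes. Fibre
  counts are kept apart from topology: they use only the orbit description of the fibres, so they
  apply to the arbitrary coverings of one direction and the explicit ones of the other.\<close>

definition positive_at :: "(complex \<Rightarrow> complex) \<Rightarrow> complex \<Rightarrow> bool" where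
  "positive_at g p \<longleftrightarrow> (\<forall>\<^sub>F r in at_right 0. winding_number (g \<circ> circlepath p r) (g p) = 1)"

text \<open>Two moves. The base point goes from \<open>g p\<close> to \<open>g q\<close> inside the
  image of the open disc, a connected set that misses the image of the circle by injectivity. Then
  the circle about \<open>p\<close> is deformed into the one about \<open>q\<close> along segments
  avoiding \<open>q\<close>, and injectivity keeps the image of this homotopy away from
  \<open>g q\<close>.\<close>

lemma winding_number_image_circle:
  assumes cont: "continuous_on (cball p r) g" and inj: "inj_on g (cball p r)"
    and sub: "cball q s \<subseteq> ball p r" and s: "0 < s"
  shows "winding_number (g \<circ> circlepath p r) (g p) = winding_number (g \<circ> circlepath q s) (g q)"
proof -
  have qs: "dist p q + s < r"
    using sub s by (simp add: cball_subset_ball_iff dist_commute)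
  then have r: "0 < r" using s zero_le_dist[of p q] by linarith
  have q: "q \<in> ball p r" using qs s by simp
  have Cp: "path_image (circlepath p r) = sphere p r" using r by simp
  have path: "path (g \<circ> circlepath p r)"
    by (rule path_continuous_image) (use cont in \<open>auto simp: r less_imp_le intro: continuous_on_subset\<close>)
  have loop: "pathfinish (g \<circ> circlepath p r) = pathstart (g \<circ> circlepath p r)"
    by (simp add: pathfinish_compose pathstart_compose)
  have "winding_number (g \<circ> circlepath p r) (g p) = winding_number (g \<circ> circlepath p r) (g q)"
  proof (rule winding_number_eq[OF path loop, of _ "g ` ball p r"])
    show "connected (g ` ball p r)"
      by (rule connected_continuous_image[OF continuous_on_subset[OF cont]]) auto
    show "g ` ball p r \<inter> path_image (g \<circ> circlepath p r) = {}"
      unfolding path_image_compose Cp using r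
      by (subst inj_on_image_Int[OF inj, symmetric]) auto
  qed (use q r in auto)
  moreover have "homotopic_loops (cball p r - {q}) (circlepath p r) (circlepath q s)"
  proof (rule homotopic_loops_linear)
    fix t :: real
    define e where "e = exp (2 * of_real pi * \<i> * of_real t)"
    have e: "norm e = 1" unfolding e_def by (simp add: mult.commute)
    have cp: "circlepath p r t = p + of_real r * e" and cq: "circlepath q s t = q + of_real s * e"
      by (auto simp: circlepath e_def)
    show "closed_segment (circlepath p r t) (circlepath q s t) \<subseteq> cball p r - {q}"
    proof
      fix x assume x: "x \<in> closed_segment (circlepath p r t) (circlepath q s t)"
      then obtain u where u: "0 \<le> u" "u \<le> 1"
        and xu: "x = (1 - u) *\<^sub>R (p + of_real r * e) + u *\<^sub>R (q + of_real s * e)"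
        unfolding cp cq closed_segment_def by auto
      have "circlepath p r t \<in> cball p r"
        using r by (simp add: cp dist_norm norm_mult e)
      moreover have "circlepath q s t \<in> cball p r"
        using sub s by (auto simp: cq dist_norm norm_mult e subset_iff intro!: less_imp_le)
      ultimately have "x \<in> cball p r"
        using x closed_segment_subset[of _ "cball p r"] by blast
      moreover have "x \<noteq> q"
      proof
        assume "x = q"
        \<comment> \<open>If the segment met \<open>q\<close>, comparing lengths in the common
          direction \<open>e\<close> would give
          \<open>(1 - u) * r + u * s = (1 - u) * dist p q\<close>. Since
          \<open>dist p q < r - s\<close>, this forces \<open>s <= 0\<close>.\<close>
        then have "of_real ((1 - u) * r + u * s) * e = of_real (1 - u) * (q - p)"
          by (simp add: xu algebra_simps scaleR_conv_of_real)
        then have "norm (of_real ((1 - u) * r + u * s) * e) = norm (of_real (1 - u) * (q - p))"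
          by simp
        then have "(1 - u) * r + u * s = (1 - u) * dist p q"
          using u r s by (simp only: norm_mult norm_of_real e) (simp add: dist_norm norm_minus_commute)
        moreover have "(1 - u) * dist p q \<le> (1 - u) * (r - s)"
          using u qs by (intro mult_left_mono) auto
        ultimately have "(1 - u) * r + u * s \<le> (1 - u) * (r - s)" by simp
        then show False using s by (simp add: algebra_simps)
      qed
      ultimately show "x \<in> cball p r - {q}" by simp
    qed
  qed auto
  then have "homotopic_loops (- {g q}) (g \<circ> circlepath p r) (g \<circ> circlepath q s)"
  proof (rule homotopic_loops_continuous_image)
    show "continuous_on (cball p r - {q}) g" using cont by (rule continuous_on_subset) auto
    show "g \<in> cball p r - {q} \<rightarrow> - {g q}"
      using q by (auto dest: inj_onD[OF inj])
  qed
  ultimately show ?thesis using winding_number_homotopic_loops by metis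
qed

text \<open>The winding number is the same for all concentric circles inside a disc of injectivity,
  so the germ condition can be tested on one circle.\<close>

lemma positive_at_iff:
  assumes "continuous_on (cball p r) g" "inj_on g (cball p r)" "0 < r"
  shows "positive_at g p \<longleftrightarrow> winding_number (g \<circ> circlepath p r) (g p) = 1"
proof -
  have "\<forall>\<^sub>F s in at_right 0.
      winding_number (g \<circ> circlepath p s) (g p) = winding_number (g \<circ> circlepath p r) (g p)"
    unfolding eventually_at_right_field
  proof (intro exI[of _ r] conjI allI impI)
    fix s assume "0 < s" "s < r"
    then show "winding_number (g \<circ> circlepath p s) (g p) = winding_number (g \<circ> circlepath p r) (g p)"
      by (intro winding_number_image_circle[OF assms(1,2), symmetric]) auto
  qed (rule assms)
  then have "positive_at g p \<longleftrightarrow>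
      (\<forall>\<^sub>F s in at_right (0::real). winding_number (g \<circ> circlepath p r) (g p) = 1)"
    unfolding positive_at_def by (rule eventually_subst[OF eventually_mono]) auto
  then show ?thesis by simp
qed

text \<open>Orientation is locally constant: small circles about \<open>x\<close> and about
  \<open>y\<close> are both compared with one circle about \<open>p\<close> that encloses both
  points.\<close>

lemma positive_at_ball:
  assumes "continuous_on (ball p r) g" "inj_on g (ball p r)" "x \<in> ball p r" "y \<in> ball p r"
  shows "positive_at g x \<longleftrightarrow> positive_at g y"
proof -
  define R where "R = (max (dist p x) (dist p y) + r) / 2"
  have R: "dist p x < R" "dist p y < R" "R < r" using assms by (auto simp: R_def)
  have *: "positive_at g z \<longleftrightarrow> winding_number (g \<circ> circlepath p R) (g p) = 1" if z: "dist p z < R" for z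
  proof -
    define s where "s = (R - dist p z) / 2"
    have s: "0 < s" "cball z s \<subseteq> ball p R"
      using z by (auto simp: s_def cball_subset_ball_iff dist_commute field_simps)
    have sub: "cball p R \<subseteq> ball p r" using R by auto
    have c: "continuous_on (cball p R) g" "inj_on g (cball p R)"
      using assms(1,2) sub by (auto intro: continuous_on_subset inj_on_subset)
    have sub': "cball z s \<subseteq> cball p R" using s(2) ball_subset_cball by blast
    have "positive_at g z \<longleftrightarrow> winding_number (g \<circ> circlepath z s) (g z) = 1"
      using c sub' s by (intro positive_at_iff) (auto intro: continuous_on_subset inj_on_subset)
    then show ?thesis using winding_number_image_circle[OF c s(2,1)] by simp
  qed
  show ?thesis using *[OF R(1)] *[OF R(2)] by simp
qed

lemma positive_at_cong:
  assumes "open U" "p \<in> U" "\<And>x. x \<in> U \<Longrightarrow> g x = h x"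
  shows "positive_at g p \<longleftrightarrow> positive_at h p"
proof -
  obtain e where e: "0 < e" "ball p e \<subseteq> U" using assms open_contains_ball by blast
  have "g \<circ> circlepath p r = h \<circ> circlepath p r" if "0 < r" "r < e" for r
    using that e by (intro ext) (auto intro!: assms(3) simp: circlepath dist_norm norm_mult subset_iff)
  then have "\<forall>\<^sub>F r in at_right 0. (winding_number (g \<circ> circlepath p r) (g p) = 1) =
      (winding_number (h \<circ> circlepath p r) (h p) = 1)"
    unfolding eventually_at_right_field using e assms by (intro exI[of _ e]) auto
  then show ?thesis unfolding positive_at_def by (rule eventually_subst)
qed

text \<open>Winding number 1 makes the image of a small circle under \<open>g\<close> homotopic to a
  round circle in the plane punctured at \<open>g p\<close>. Applying \<open>h\<close> to the
  homotopy compares \<open>h o g\<close> on the small circle with \<open>h\<close> on the round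
  one.\<close>

lemma positive_at_comp:
  assumes U: "open U" "p \<in> U" "continuous_on U g" "inj_on g U"
    and V: "open V" "g p \<in> V" "continuous_on V h" "inj_on h V"
    and pos: "positive_at g p"
  shows "positive_at (h \<circ> g) p \<longleftrightarrow> positive_at h (g p)"
proof -
  define c where "c = g p"
  obtain \<rho> where \<rho>: "0 < \<rho>" "cball c \<rho> \<subseteq> V" using V open_contains_cball c_def by blast
  have "open (U \<inter> g -` ball c \<rho>)"
    using U(1,3) by (simp add: continuous_open_preimage open_Int)
  then obtain r where r: "0 < r" "cball p r \<subseteq> U \<inter> g -` ball c \<rho>"
    using \<rho> U(2) open_contains_cball c_def by (metis IntI centre_in_ball vimageI)
  have rU: "cball p r \<subseteq> U" and rb: "\<And>x. x \<in> cball p r \<Longrightarrow> g x \<in> ball c \<rho>" using r by auto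
  have g: "continuous_on (cball p r) g" "inj_on g (cball p r)"
    using U rU by (auto intro: continuous_on_subset inj_on_subset)
  have h: "continuous_on (cball c \<rho>) h" "inj_on h (cball c \<rho>)"
    using V \<rho> by (auto intro: continuous_on_subset inj_on_subset)
  have "g ` cball p r \<subseteq> cball c \<rho>" using rb ball_subset_cball by blast
  then have hg: "continuous_on (cball p r) (h \<circ> g)" "inj_on (h \<circ> g) (cball p r)"
    using g h by (meson continuous_on_compose comp_inj_on continuous_on_subset inj_on_subset)+
  define R where "R z = c + of_real (\<rho> / max \<rho> (norm (z - c))) * (z - c)" for z
  have R_id: "R z = z" if "z \<in> cball c \<rho>" for z
    using that \<rho> by (simp add: R_def max_def dist_norm norm_minus_commute)
  have circ: "circlepath p r t \<in> sphere p r" for t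
    using r by (simp add: circlepath dist_norm norm_mult)
  have circ': "circlepath c \<rho> t \<in> sphere c \<rho>" for t
    using \<rho> by (simp add: circlepath dist_norm norm_mult)
  have w1: "winding_number (g \<circ> circlepath p r) c = 1"
    using pos positive_at_iff[OF g r(1)] by (simp add: c_def)
  have "homotopic_loops (- {c}) (g \<circ> circlepath p r) (circlepath c \<rho>)"
  proof (subst winding_number_homotopic_loops_eq[symmetric])
    show "path (g \<circ> circlepath p r)"
      by (rule path_continuous_image) (use g r in \<open>auto intro: continuous_on_subset\<close>)
    show "c \<notin> path_image (g \<circ> circlepath p r)"
      using r circ by (auto simp: path_image_compose c_def dest!: inj_onD[OF g(2)])
    show "winding_number (g \<circ> circlepath p r) c = winding_number (circlepath c \<rho>) c"
      using w1 \<rho> by (simp add: winding_number_circlepath_centre)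
  qed (use \<rho> in \<open>auto simp: pathfinish_compose pathstart_compose\<close>)
  then have "homotopic_loops (- {h c}) ((h \<circ> R) \<circ> (g \<circ> circlepath p r)) ((h \<circ> R) \<circ> circlepath c \<rho>)"
  proof (rule homotopic_loops_continuous_image)
    have RC: "R z \<in> cball c \<rho>" for z
    proof -
      have M: "0 < max \<rho> (norm (z - c))" using \<rho> by simp
      have "norm (R z - c) = \<rho> * (norm (z - c) / max \<rho> (norm (z - c)))"
        using \<rho> M by (simp add: R_def norm_mult norm_divide)
      also have "\<dots> \<le> \<rho> * 1"
        using \<rho> M by (intro mult_left_mono) (auto simp: divide_le_eq_1)
      finally show ?thesis by (simp add: dist_norm norm_minus_commute)
    qed
    have nz: "max \<rho> (norm (z - c)) \<noteq> 0" for z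
      using \<rho> less_le_trans[OF _ max.cobounded1] by (metis less_irrefl)
    from nz have "continuous_on (- {c}) R"
      unfolding R_def by (intro continuous_intros) blast
    then show "continuous_on (- {c}) (h \<circ> R)"
      by (rule continuous_on_compose) (use RC h in \<open>auto intro: continuous_on_subset\<close>)
    have "h (R z) \<noteq> h c" if "z \<noteq> c" for z
    proof
      assume "h (R z) = h c"
      then have "R z = c" by (rule inj_onD[OF h(2)]) (use RC \<rho> in auto)
      then show False using that \<rho> nz[of z] by (simp add: R_def)
    qed
    then show "h \<circ> R \<in> - {c} \<rightarrow> - {h c}" by auto
  qed
  from winding_number_homotopic_loops[OF this]
  have "winding_number ((h \<circ> R) \<circ> (g \<circ> circlepath p r)) (h c) =
      winding_number ((h \<circ> R) \<circ> circlepath c \<rho>) (h c)" .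
  moreover have "(h \<circ> R) \<circ> (g \<circ> circlepath p r) = (h \<circ> g) \<circ> circlepath p r"
  proof
    fix t
    have "g (circlepath p r t) \<in> cball c \<rho>"
      using rb[of "circlepath p r t"] circ[of t] by (auto simp: less_imp_le)
    then show "((h \<circ> R) \<circ> (g \<circ> circlepath p r)) t = ((h \<circ> g) \<circ> circlepath p r) t"
      by (simp add: R_id)
  qed
  moreover have "(h \<circ> R) \<circ> circlepath c \<rho> = h \<circ> circlepath c \<rho>"
  proof
    fix t
    show "((h \<circ> R) \<circ> circlepath c \<rho>) t = (h \<circ> circlepath c \<rho>) t"
      using circ'[of t] by (simp add: R_id)
  qed
  ultimately have "winding_number ((h \<circ> g) \<circ> circlepath p r) (h c) =
      winding_number (h \<circ> circlepath c \<rho>) (h c)"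
    by simp
  then show ?thesis
    unfolding positive_at_iff[OF hg r(1)] c_def[symmetric] positive_at_iff[OF h \<rho>(1)]
    by (simp add: c_def)
qed

text \<open>The straight homotopy between a loop and its multiple by \<open>b\<close> misses 0
  unless \<open>b\<close> is a nonpositive real. The principal square root of \<open>a\<close> is
  never of that kind, so \<open>a\<close> is reached by multiplying by its square root
  twice.\<close>

lemma winding_number_cmult_circlepath:
  assumes "a \<noteq> 0" "0 < r"
  shows "winding_number (\<lambda>t. a * circlepath 0 r t) 0 = 1"
proof -
  have ne: "circlepath 0 r t \<noteq> 0" for t using assms by (simp add: circlepath)
  have step: "winding_number (\<lambda>t. b * c * circlepath 0 r t) 0 = winding_number (\<lambda>t. c * circlepath 0 r t) 0"
    if b: "b \<notin> \<real>\<^sub>\<le>\<^sub>0" and c: "c \<noteq> 0" for b c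
  proof (rule winding_number_loops_linear_eq)
    fix t :: real
    show "0 \<notin> closed_segment (c * circlepath 0 r t) (b * c * circlepath 0 r t)"
    proof
      assume "0 \<in> closed_segment (c * circlepath 0 r t) (b * c * circlepath 0 r t)"
      then obtain u where u: "0 \<le> u" "u \<le> 1"
        and "0 = (1 - u) *\<^sub>R (c * circlepath 0 r t) + u *\<^sub>R (b * c * circlepath 0 r t)"
        unfolding closed_segment_def by auto
      then have "(of_real (1 - u) + of_real u * b) * (c * circlepath 0 r t) = 0"
        by (simp add: scaleR_conv_of_real algebra_simps)
      then have eq: "of_real (1 - u) + of_real u * b = 0" using ne c by simp
      then have "u \<noteq> 0" by auto
      then have "b = of_real (- ((1 - u) / u))" using eq by (simp add: field_simps add_eq_0_iff)
      moreover have "- ((1 - u) / u) \<le> 0" using u by simp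
      ultimately show False using b by (metis nonpos_Reals_of_real_iff)
    qed
  qed (use b c in \<open>auto intro!: continuous_intros simp: path_def pathstart_def pathfinish_def circlepath\<close>)
  define b where "b = csqrt a"
  have bb: "b * b = a" unfolding b_def by (metis power2_csqrt power2_eq_square)
  have "0 < Re b \<or> Re b = 0 \<and> 0 \<le> Im b" unfolding b_def by (rule csqrt_principal)
  moreover have "b \<noteq> 0" using assms bb by auto
  ultimately have b: "b \<notin> \<real>\<^sub>\<le>\<^sub>0" "b \<noteq> 0"
    by (auto simp: complex_nonpos_Reals_iff complex_eq_iff)
  have "winding_number (\<lambda>t. a * circlepath 0 r t) 0 = winding_number (\<lambda>t. b * b * circlepath 0 r t) 0"
    by (simp add: bb)
  also have "\<dots> = winding_number (\<lambda>t. b * 1 * circlepath 0 r t) 0"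
    using step[OF b] by simp
  also have "\<dots> = winding_number (circlepath 0 r) 0"
    using step[OF b(1), of 1] by simp
  finally show ?thesis using assms by (simp add: winding_number_circlepath_centre)
qed

text \<open>\<open>Re (z * cnj v)\<close> is the inner product of \<open>z\<close> and
  \<open>v\<close>. If the increment of \<open>g\<close> has positive inner product with
  \<open>a * w\<close>, the segment joining the two misses 0, so the image of the circle winds like
  the circle multiplied by \<open>a\<close>. This treats the pillowcase without a
  derivative.\<close>

lemma positive_at_inner:
  assumes "0 < \<delta>" and cont: "continuous_on (ball p \<delta>) g" and a: "a \<noteq> 0"
    and pos: "\<And>w. 0 < norm w \<Longrightarrow> norm w < \<delta> \<Longrightarrow> 0 < Re ((g (p + w) - g p) * cnj (a * w))"
  shows "positive_at g p"
  unfolding positive_at_def eventually_at_right_field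
proof (intro exI[of _ \<delta>] conjI allI impI)
  fix r :: real assume r: "0 < r" "r < \<delta>"
  let ?\<gamma> = "\<lambda>t. g (circlepath p r t) - g p"
  have "continuous_on {0..1} (\<lambda>t. g (circlepath p r t))"
    by (rule continuous_on_compose2[OF cont])
       (use r in \<open>auto intro!: continuous_intros simp: circlepath dist_norm norm_mult\<close>)
  then have "winding_number (\<lambda>t. a * circlepath 0 r t) 0 = winding_number ?\<gamma> 0"
  proof (intro winding_number_loops_linear_eq)
    fix t :: real
    let ?w = "circlepath 0 r t"
    have w: "norm ?w = r" using r by (simp add: circlepath norm_mult)
    have cp: "circlepath p r t = p + ?w" by (simp add: circlepath)
    have pos': "0 < Re (?\<gamma> t * cnj (a * ?w))" unfolding cp using pos[of ?w] r w by simp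
    have pos'': "0 < Re ((a * ?w) * cnj (a * ?w))"
      using r a w unfolding complex_norm_square[symmetric] by (auto simp: norm_mult)
    show "0 \<notin> closed_segment (?\<gamma> t) (a * ?w)"
    proof
      assume "0 \<in> closed_segment (?\<gamma> t) (a * ?w)"
      then obtain u where u: "0 \<le> u" "u \<le> 1"
        and "0 = (1 - u) *\<^sub>R (?\<gamma> t) + u *\<^sub>R (a * ?w)"
        unfolding closed_segment_def by auto
      then have "0 = Re (((1 - u) *\<^sub>R (?\<gamma> t) + u *\<^sub>R (a * ?w)) * cnj (a * ?w))" by simp
      also have "\<dots> = (1 - u) * Re (?\<gamma> t * cnj (a * ?w)) + u * Re ((a * ?w) * cnj (a * ?w))"
        by (simp only: distrib_right mult_scaleR_left plus_complex.sel(1) scaleR_complex.sel(1))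
      also have "\<dots> > 0"
      proof (cases "u = 0")
        case False
        then show ?thesis using u pos' pos'' by (intro add_nonneg_pos mult_pos_pos) auto
      qed (use pos' in simp)
      finally show False by simp
    qed
  qed (auto intro!: continuous_intros simp: path_def pathstart_def pathfinish_def circlepath)
  then show "winding_number (g \<circ> circlepath p r) (g p) = 1"
    using winding_number_cmult_circlepath[OF a r(1)] winding_number_offset[of "g \<circ> circlepath p r" "g p"]
    by (simp add: o_def)
qed (use assms in auto)

text \<open>The remainder of the linear approximation is at most half of
  \<open>norm a * norm w\<close>, so the inner product of the increment with \<open>a * w\<close> is
  at least half of \<open>(norm a * norm w)^2\<close>.\<close>

lemma positive_at_holomorphic:
  assumes "f holomorphic_on U" "open U" "p \<in> U" "deriv f p \<noteq> 0"
  shows "positive_at f p"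
proof -
  define a where "a = deriv f p"
  have a: "a \<noteq> 0" using assms by (simp add: a_def)
  have "(f has_field_derivative a) (at p)"
    using assms holomorphic_derivI a_def by metis
  then have "(f has_derivative (*) a) (at p)" by (simp add: has_field_derivative_def)
  moreover have "0 < norm a / 2" using a by simp
  ultimately obtain d where d: "0 < d" "\<And>y. norm (y - p) < d \<Longrightarrow>
      norm (f y - f p - a * (y - p)) \<le> norm a / 2 * norm (y - p)"
    unfolding has_derivative_at_alt by meson
  obtain e where e: "0 < e" "ball p e \<subseteq> U" using assms open_contains_ball by blast
  show ?thesis
  proof (rule positive_at_inner[of "min d e" p f a])
    show "continuous_on (ball p (min d e)) f"
      using assms(1) e holomorphic_on_imp_continuous_on continuous_on_subset
      by (metis ball_min_Int inf.cobounded2 subset_trans)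
    fix w :: complex assume w: "0 < norm w" "norm w < min d e"
    define r where "r = f (p + w) - f p - a * w"
    have r: "norm r \<le> norm a / 2 * norm w" using d(2)[of "p + w"] w by (simp add: r_def)
    have "(f (p + w) - f p) * cnj (a * w) = a * w * cnj (a * w) + r * cnj (a * w)"
      by (simp add: r_def algebra_simps)
    moreover have "Re (a * w * cnj (a * w)) = (norm a * norm w)\<^sup>2"
      unfolding complex_norm_square[symmetric] by (simp add: norm_mult)
    moreover have "\<bar>Re (r * cnj (a * w))\<bar> \<le> norm r * (norm a * norm w)"
      using abs_Re_le_cmod[of "r * cnj (a * w)"] by (simp add: norm_mult)
    moreover have "norm r * (norm a * norm w) \<le> norm a / 2 * norm w * (norm a * norm w)"
      by (rule mult_right_mono[OF r]) simp
    moreover have "0 < (norm a * norm w)\<^sup>2" using a w by simp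
    ultimately show "0 < Re ((f (p + w) - f p) * cnj (a * w))"
      by (simp add: power2_eq_square)
  qed (use d e a in auto)
qed

section \<open>Charts of the sphere\<close>

definition cx :: "real^2 \<Rightarrow> complex" where "cx x = Complex (x $ 1) (x $ 2)"
definition vx :: "complex \<Rightarrow> real^2" where "vx z = vector [Re z, Im z]"

lemma cx_vx [simp]: "cx (vx z) = z"
  by (simp add: cx_def vx_def)

lemma vx_cx [simp]: "vx (cx x) = x"
  by (simp add: cx_def vx_def vec_eq_iff forall_2)

lemma cx_diff: "cx (x - y) = cx x - cx y"
  and cx_minus: "cx (- x) = - cx x"
  by (simp_all add: cx_def complex_eq_iff)

lemma cx_inject [simp]: "cx x = cx y \<longleftrightarrow> x = y"
  by (metis vx_cx)

lemma norm_cx [simp]: "norm (cx x) = norm x"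
  by (simp add: cx_def cmod_def norm_vec_def L2_set_def sum_2)

lemma cx_zero [simp]: "cx x = 0 \<longleftrightarrow> x = 0"
  by (metis norm_cx norm_eq_zero)

lemma dist_cx [simp]: "dist (cx x) (cx y) = dist x y"
  by (metis cx_diff dist_norm norm_cx)

lemma dist_vx [simp]: "dist (vx x) (vx y) = dist x y"
  by (metis cx_vx dist_cx)

lemma continuous_on_cx [continuous_intros]: "continuous_on S f \<Longrightarrow> continuous_on S (\<lambda>x. cx (f x))"
  unfolding cx_def by (intro continuous_intros)

lemma continuous_on_vx [continuous_intros]:
  assumes "continuous_on S f" shows "continuous_on S (\<lambda>x. vx (f x))"
proof -
  have "continuous_on UNIV vx"
    unfolding continuous_on_iff by (metis dist_vx)
  then show ?thesis using assms by (metis continuous_on_compose2 subset_UNIV)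
qed

lemma cx_image_ball: "cx ` ball p r = ball (cx p) r"
proof
  show "ball (cx p) r \<subseteq> cx ` ball p r"
  proof
    fix z assume "z \<in> ball (cx p) r"
    then have "vx z \<in> ball p r" by (metis cx_vx dist_cx mem_ball)
    then show "z \<in> cx ` ball p r" by (metis cx_vx imageI)
  qed
qed auto

lemma vx_image_ball: "vx ` ball p r = ball (vx p) r"
proof -
  have "vx ` cx ` ball (vx p) r = ball (vx p) r" by (simp add: image_image)
  then show ?thesis by (simp add: cx_image_ball)
qed

lemma continuous_on_vec3:
  fixes f :: "'a::topological_space \<Rightarrow> real^3"
  assumes "continuous_on S (\<lambda>x. f x $ 1)" "continuous_on S (\<lambda>x. f x $ 2)" "continuous_on S (\<lambda>x. f x $ 3)"
  shows "continuous_on S f"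
proof -
  have "continuous_on S (\<lambda>x. f x $ i)" for i
    using assms exhaust_3[of i] by auto
  then have "continuous_on S (\<lambda>x. \<chi> i. f x $ i)" by (rule continuous_on_vec_lambda)
  then show ?thesis by simp
qed

lemma homeomorphism_stereo_south:
  "homeomorphism (S2 - {- axis 3 1}) UNIV stereo_south
    (\<lambda>w. (1 / (1 + (norm w)\<^sup>2)) *\<^sub>R vector [2 * Re w, 2 * Im w, 1 - (norm w)\<^sup>2])"
  (is "homeomorphism _ _ _ ?g")
proof (rule homeomorphismI)
  have S: "(x $ 1)\<^sup>2 + (x $ 2)\<^sup>2 + (x $ 3)\<^sup>2 = 1 \<and> 1 + x $ 3 \<noteq> 0"
    if "x \<in> S2 - {- axis 3 1}" for x :: "real^3"
  proof
    show n: "(x $ 1)\<^sup>2 + (x $ 2)\<^sup>2 + (x $ 3)\<^sup>2 = 1"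
      using that by (simp add: norm_vec_def L2_set_def sum_3)
    show "1 + x $ 3 \<noteq> 0"
    proof
      assume "1 + x $ 3 = 0"
      then have "x $ 3 = - 1" by simp
      then have "(x $ 1)\<^sup>2 + (x $ 2)\<^sup>2 = 0" using n by simp
      then have "x $ 1 = 0" "x $ 2 = 0" by (auto simp: sum_power2_eq_zero_iff)
      then show False using that \<open>x $ 3 = -1\<close> by (auto simp: vec_eq_iff axis_def forall_3)
    qed
  qed
  show "continuous_on (S2 - {- axis 3 1}) stereo_south"
    unfolding stereo_south_def
    by (intro continuous_intros) (use S in \<open>auto simp: of_real_add[symmetric] simp del: of_real_add\<close>)
  have pos: "1 + (norm w)\<^sup>2 \<noteq> 0" "0 < 1 + (norm w)\<^sup>2" for w :: complex
    by (simp_all add: add_pos_nonneg) (metis add_pos_nonneg less_irrefl zero_le_power2 zero_less_one)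
  show "continuous_on UNIV ?g"
    by (rule continuous_on_vec3; simp; intro continuous_intros) (use pos in auto)
  show "stereo_south ` (S2 - {- axis 3 1}) \<subseteq> UNIV" by simp
  have comp: "?g w $ 1 = 2 * Re w / (1 + (norm w)\<^sup>2)" "?g w $ 2 = 2 * Im w / (1 + (norm w)\<^sup>2)"
    "?g w $ 3 = (1 - (norm w)\<^sup>2) / (1 + (norm w)\<^sup>2)" for w by simp_all
  have third: "1 + ?g w $ 3 = 2 / (1 + (norm w)\<^sup>2)" for w
    unfolding comp using pos[of w] by (simp add: field_simps)
  show "?g ` UNIV \<subseteq> S2 - {- axis 3 1}"
  proof safe
    fix w :: complex
    define N where "N = (norm w)\<^sup>2"
    have N: "N = (Re w)\<^sup>2 + (Im w)\<^sup>2" "1 + N \<noteq> 0" using pos by (simp_all add: N_def cmod_power2)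
    have "(2 * Re w / (1 + N))\<^sup>2 + (2 * Im w / (1 + N))\<^sup>2 + ((1 - N) / (1 + N))\<^sup>2
        = (4 * ((Re w)\<^sup>2 + (Im w)\<^sup>2) + (1 - N)\<^sup>2) / (1 + N)\<^sup>2"
      by (simp add: power_divide add_divide_distrib power_mult_distrib algebra_simps)
    also have "4 * ((Re w)\<^sup>2 + (Im w)\<^sup>2) + (1 - N)\<^sup>2 = (1 + N)\<^sup>2"
      unfolding N(1)[symmetric] by (simp add: power2_eq_square algebra_simps)
    finally have "(norm (?g w))\<^sup>2 = 1"
      using N(2) unfolding norm_vec_def L2_set_def sum_3 comp N_def[symmetric] real_norm_def power2_abs
      by (simp del: power_divide)
    then have "norm (?g w) = 1" by (metis abs_norm_cancel power2_eq_1_iff abs_1 abs_minus_cancel)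
    then show "?g w \<in> S2" by (simp only: mem_sphere dist_0_norm)
    assume "?g w = - axis 3 1"
    then have "?g w $ 3 = - 1" by (simp add: axis_def)
    then show False using third[of w] pos[of w] by simp
  qed
  show "?g (stereo_south x) = x" if x: "x \<in> S2 - {- axis 3 1}" for x
  proof -
    have n: "(x $ 1)\<^sup>2 + (x $ 2)\<^sup>2 + (x $ 3)\<^sup>2 = 1" and nz: "1 + x $ 3 \<noteq> 0" using S[OF x] by auto
    have R: "Re (stereo_south x) = x $ 1 / (1 + x $ 3)" "Im (stereo_south x) = x $ 2 / (1 + x $ 3)"
      unfolding stereo_south_def by (simp_all add: Re_divide_of_real Im_divide_of_real)
    have "(norm (stereo_south x))\<^sup>2 = ((x $ 1)\<^sup>2 + (x $ 2)\<^sup>2) / (1 + x $ 3)\<^sup>2"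
      by (simp add: cmod_power2 R power_divide add_divide_distrib)
    also have "(x $ 1)\<^sup>2 + (x $ 2)\<^sup>2 = (1 + x $ 3) * (1 - x $ 3)"
      using n by (simp add: algebra_simps power2_eq_square)
    finally have N: "(norm (stereo_south x))\<^sup>2 = (1 - x $ 3) / (1 + x $ 3)"
      using nz by (simp add: power2_eq_square)
    have "1 + (norm (stereo_south x))\<^sup>2 = 2 / (1 + x $ 3)" unfolding N using nz by (simp add: field_simps)
    moreover have "1 - (norm (stereo_south x))\<^sup>2 = 2 * x $ 3 / (1 + x $ 3)"
      unfolding N using nz by (simp add: field_simps)
    ultimately show ?thesis unfolding vec_eq_iff forall_3 comp using nz by (simp add: R)
  qed
  show "stereo_south (?g w) = w" if "w \<in> UNIV" for w
  proof -
    have nz: "1 + (norm w)\<^sup>2 \<noteq> 0" by (rule pos)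
    have "stereo_south (?g w) =
        Complex (2 * Re w / (1 + (norm w)\<^sup>2)) (2 * Im w / (1 + (norm w)\<^sup>2)) / of_real (2 / (1 + (norm w)\<^sup>2))"
      unfolding stereo_south_def third by simp
    then show ?thesis
      using nz unfolding complex_eq_iff by (simp only: Re_divide_of_real Im_divide_of_real complex.sel) simp
  qed
qed

text \<open>The half turn about the first axis swaps the poles and turns one projection into the
  other. It preserves orientation, which is why the northern chart carries a conjugate.\<close>

lemma homeomorphism_stereo_north:
  "\<exists>\<kappa>'. homeomorphism (S2 - {axis 3 1}) UNIV stereo_north \<kappa>'"
proof -
  let ?\<rho> = "\<lambda>x :: real^3. vector [x $ 1, - (x $ 2), - (x $ 3)] :: real^3"
  have inv: "?\<rho> (?\<rho> x) = x" for x by (simp add: vec_eq_iff forall_3)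
  have axis: "?\<rho> (axis 3 1) = - axis 3 1" by (simp add: vec_eq_iff forall_3 axis_def)
  have S2: "?\<rho> x \<in> S2 \<longleftrightarrow> x \<in> S2" for x by (simp add: norm_vec_def L2_set_def sum_3)
  have cont: "continuous_on S ?\<rho>" for S
    by (rule continuous_on_vec3; simp; intro continuous_intros)
  have "homeomorphism (S2 - {axis 3 1}) (S2 - {- axis 3 1}) ?\<rho> ?\<rho>"
  proof (rule homeomorphismI)
    show "?\<rho> ` (S2 - {axis 3 1}) \<subseteq> S2 - {- axis 3 1}" using S2 axis inv by (metis (no_types, lifting) Diff_iff image_subsetI singletonD singletonI)
    show "?\<rho> ` (S2 - {- axis 3 1}) \<subseteq> S2 - {axis 3 1}" using S2 axis inv by (metis (no_types, lifting) Diff_iff image_subsetI singletonD singletonI)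
  qed (use cont inv in auto)
  from homeomorphism_compose[OF this homeomorphism_stereo_south]
  have "\<exists>\<kappa>'. homeomorphism (S2 - {axis 3 1}) UNIV (stereo_south \<circ> ?\<rho>) \<kappa>'" by blast
  moreover have "stereo_south \<circ> ?\<rho> = stereo_north"
    by (simp add: fun_eq_iff stereo_south_def stereo_north_def)
  ultimately show ?thesis by simp
qed

lemma chart_homeomorphism:
  assumes "(D, \<kappa>) \<in> two_sphere"
  obtains \<kappa>' where "homeomorphism D UNIV \<kappa> \<kappa>'"
  using assms homeomorphism_stereo_south homeomorphism_stereo_north
  unfolding two_sphere_def by blast

lemma chart_open:
  assumes "(D, \<kappa>) \<in> two_sphere"
  shows "openin (top_of_set S2) D" "D \<subseteq> S2"
  using assms unfolding two_sphere_def by (auto intro!: openin_delete)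

lemma chart_cover:
  assumes "x \<in> S2"
  obtains D \<kappa> where "(D, \<kappa>) \<in> two_sphere" "x \<in> D"
  using assms points_two_sphere unfolding points_def by blast

lemma chart_transition:
  assumes "(D, \<kappa>) \<in> two_sphere" "(D', \<kappa>') \<in> two_sphere" "(D, \<kappa>) \<noteq> (D', \<kappa>')" "x \<in> D" "x \<in> D'"
  shows "\<kappa> x \<noteq> 0 \<and> \<kappa>' x = inverse (\<kappa> x)"
proof -
  have x: "x \<in> S2 - {axis 3 1, - axis 3 1}" using assms by (auto simp: two_sphere_def)
  have "stereo_south (axis 3 1) = 0" by (simp add: stereo_south_def axis_def complex_eq_iff)
  moreover have "(axis 3 1 :: real^3) \<noteq> - axis 3 1" by (simp add: vec_eq_iff axis_def)
  ultimately have "stereo_south x \<noteq> 0"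
    using x homeomorphism_stereo_south unfolding homeomorphism_def
    by (metis (no_types, lifting) Diff_iff dist_0_norm insert_iff mem_sphere norm_axis_1 singletonD)
  then show ?thesis
    using assms stereo_transition[OF x] by (auto simp: two_sphere_def)
qed

text \<open>Positivity is required in every chart around \<open>G z\<close>, so that it can be used
  in whichever chart is at hand; \<open>positive_sphereI\<close> shows that checking one chart is
  enough.\<close>

definition positive_sphere :: "(complex \<Rightarrow> real^3) \<Rightarrow> complex \<Rightarrow> bool" where
  "positive_sphere G z \<longleftrightarrow> (\<forall>(D, \<kappa>) \<in> two_sphere. G z \<in> D \<longrightarrow> positive_at (\<kappa> \<circ> G) z)"

lemma chart_read:
  assumes "open U" "continuous_on U G" "inj_on G U" "G ` U \<subseteq> S2" "(D, \<kappa>) \<in> two_sphere"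
  shows "open (U \<inter> G -` D)" "continuous_on (U \<inter> G -` D) (\<kappa> \<circ> G)" "inj_on (\<kappa> \<circ> G) (U \<inter> G -` D)"
proof -
  obtain T where T: "open T" "D = S2 \<inter> T" using chart_open[OF assms(5)] by (auto simp: openin_open)
  have "U \<inter> G -` D = U \<inter> G -` T" using assms(4) T by auto
  then show "open (U \<inter> G -` D)"
    using continuous_open_preimage[OF assms(2,1) T(1)] by simp
  obtain \<kappa>' where \<kappa>': "homeomorphism D UNIV \<kappa> \<kappa>'" using chart_homeomorphism[OF assms(5)] .
  have \<kappa>: "continuous_on D \<kappa>" "inj_on \<kappa> D"
    using \<kappa>' unfolding homeomorphism_def by (auto intro: inj_on_inverseI)
  have "G ` (U \<inter> G -` D) \<subseteq> D" by auto
  then show "continuous_on (U \<inter> G -` D) (\<kappa> \<circ> G)" "inj_on (\<kappa> \<circ> G) (U \<inter> G -` D)"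
    using \<kappa> assms(2,3) by (meson Int_lower1 continuous_on_compose continuous_on_subset comp_inj_on inj_on_subset)+
qed

text \<open>The transition between the two charts is inversion, holomorphic with nonzero derivative
  off 0, so positivity passes from one chart to the other by the composition rule.\<close>

lemma positive_sphereI:
  assumes U: "open U" "z \<in> U" "continuous_on U G" "inj_on G U" "G ` U \<subseteq> S2"
    and D: "(D, \<kappa>) \<in> two_sphere" "G z \<in> D" "positive_at (\<kappa> \<circ> G) z"
  shows "positive_sphere G z"
  unfolding positive_sphere_def
proof safe
  fix D' \<kappa>' assume D': "(D', \<kappa>') \<in> two_sphere" "G z \<in> D'"
  show "positive_at (\<kappa>' \<circ> G) z"
  proof (cases "(D, \<kappa>) = (D', \<kappa>')")
    case False
    note R = chart_read[OF U(1,3,4,5) D(1)] and R' = chart_read[OF U(1,3,4,5) D'(1)]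
    have nz: "(\<kappa> \<circ> G) z \<noteq> 0" using chart_transition[OF D(1) D'(1) False] D D' by simp
    have "positive_at (inverse \<circ> (\<kappa> \<circ> G)) z \<longleftrightarrow> positive_at inverse ((\<kappa> \<circ> G) z)"
    proof (rule positive_at_comp[OF R(1) _ R(2,3)])
      show "inj_on inverse (- {0 :: complex})" by (auto intro: inj_onI)
      show "continuous_on (- {0 :: complex}) inverse" by (intro continuous_intros) auto
    qed (use U D nz in auto)
    moreover have "positive_at inverse ((\<kappa> \<circ> G) z)"
    proof (rule positive_at_holomorphic)
      show "inverse holomorphic_on (- {0 :: complex})" by (intro holomorphic_intros) auto
      have "(inverse has_field_derivative - (inverse ((\<kappa> \<circ> G) z) ^ Suc (Suc 0))) (at ((\<kappa> \<circ> G) z))"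
        by (rule DERIV_inverse[OF nz])
      then show "deriv inverse ((\<kappa> \<circ> G) z) \<noteq> 0" using nz by (simp add: DERIV_imp_deriv)
    qed (use nz in auto)
    moreover have "positive_at (\<kappa>' \<circ> G) z \<longleftrightarrow> positive_at (inverse \<circ> (\<kappa> \<circ> G)) z"
    proof (rule positive_at_cong)
      show "open ((U \<inter> G -` D) \<inter> (U \<inter> G -` D'))" using R(1) R'(1) by (rule open_Int)
    qed (use U D D' chart_transition[OF D(1) D'(1) False] in auto)
    ultimately show ?thesis by simp
  qed (use D in auto)
qed

lemma positive_sphere_ball:
  assumes "continuous_on (ball p r) G" "inj_on G (ball p r)" "G ` ball p r \<subseteq> S2"
    and "x \<in> ball p r" "y \<in> ball p r" "positive_sphere G x"
    and D: "(D, \<kappa>) \<in> two_sphere" "G ` ball p r \<subseteq> D"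
  shows "positive_sphere G y"
proof (rule positive_sphereI[OF _ assms(5,1,2,3) D(1)])
  have eq: "ball p r \<inter> G -` D = ball p r" using D(2) by auto
  have "G x \<in> D" using D(2) assms(4) by blast
  then have "positive_at (\<kappa> \<circ> G) x" using assms(6) D(1) unfolding positive_sphere_def by blast
  moreover note R = chart_read(2,3)[OF open_ball assms(1,2,3) D(1), unfolded eq]
  ultimately show "positive_at (\<kappa> \<circ> G) y"
    using positive_at_ball[OF R assms(4,5)] by simp
qed (use D assms in auto)

text \<open>Positivity is locally constant wherever \<open>G\<close> is locally injective, so it
  spreads over a connected domain. Local injectivity is what a quotient map of the plane offers off
  the lattice.\<close>

lemma positive_sphere_connected:
  assumes W: "open W" "connected W" and G: "continuous_on W G" "G ` W \<subseteq> S2"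
    and inj: "\<And>x. x \<in> W \<Longrightarrow> \<exists>e>0. inj_on G (ball x e)"
    and xy: "x \<in> W" "y \<in> W" "positive_sphere G x"
  shows "positive_sphere G y"
proof (rule connected_induction_simple[where P = "positive_sphere G", OF W(2) xy])
  fix a assume a: "a \<in> W"
  obtain e where e: "e > 0" "inj_on G (ball a e)" using inj[OF a] by blast
  have "G a \<in> S2" using a G by auto
  then obtain D \<kappa> where D: "(D, \<kappa>) \<in> two_sphere" "G a \<in> D" using chart_cover by metis
  obtain e' where e': "e' > 0" "ball a e' \<subseteq> W" using W a open_contains_ball by blast
  define U where "U = ball a (min e e')"
  have sub: "U \<subseteq> W" "U \<subseteq> ball a e" using e' by (auto simp: U_def)
  have U: "open U" "continuous_on U G" "inj_on G U" "G ` U \<subseteq> S2"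
    using sub G(2) by (auto simp: U_def intro: continuous_on_subset[OF G(1)] inj_on_subset[OF e(2)])
  note U = U sub(1)
  have "open (U \<inter> G -` D)" by (rule chart_read(1)[OF U(1-4) D(1)])
  moreover have "a \<in> U \<inter> G -` D" using D e e' by (simp add: U_def)
  ultimately obtain r where r: "r > 0" "ball a r \<subseteq> U \<inter> G -` D" using open_contains_ball by blast
  have r': "ball a r \<subseteq> U" "G ` ball a r \<subseteq> D" using r by auto
  show "\<exists>T. openin (top_of_set W) T \<and> a \<in> T \<and>
      (\<forall>x\<in>T. \<forall>y\<in>T. positive_sphere G x \<longrightarrow> positive_sphere G y)"
  proof (intro exI[of _ "ball a r"] conjI ballI impI)
    show "openin (top_of_set W) (ball a r)" using r' U by (simp add: open_subset)
    fix x y assume "x \<in> ball a r" "y \<in> ball a r" "positive_sphere G x"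
    then show "positive_sphere G y"
    proof (rule positive_sphere_ball[rotated 3, OF _ _ _ D(1)])
      show "continuous_on (ball a r) G" "inj_on G (ball a r)"
        by (rule continuous_on_subset[OF U(2) r'(1)], rule inj_on_subset[OF U(3) r'(1)])
      show "G ` ball a r \<subseteq> S2" using r'(1) U(4) by blast
    qed (use r' in auto)
  qed (use r in auto)
qed

text \<open>The orientation at one point \<open>p\<close> of a disc is forced by the orientation at the other points.\<close>

lemma oriented_disc_sphereI:
  assumes V: "openin (top_of_set S2) V" and hom: "homeomorphism V (ball 0 1) \<psi> \<psi>'"
    and par: "\<And>y. y \<in> V - {p} \<Longrightarrow> \<exists>B G z. open B \<and> z \<in> B \<and> continuous_on B G \<and> inj_on G B \<and>
      G z = y \<and> G ` B \<subseteq> V \<and> positive_sphere G z \<and> positive_at (\<psi> \<circ> G) z"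
  shows "oriented_disc two_sphere V \<psi>"
  unfolding oriented_disc_def points_two_sphere
proof (intro conjI)
  show "\<forall>(D, \<kappa>)\<in>two_sphere. \<forall>q\<in>V \<inter> D. \<forall>\<^sub>F r in at_right 0.
      winding_number (\<psi> \<circ> inv_into D \<kappa> \<circ> circlepath (\<kappa> q) r) (\<psi> q) = 1"
  proof (safe)
    fix D \<kappa> q assume D: "(D, \<kappa>) \<in> two_sphere" and q: "q \<in> V" "q \<in> D"
    obtain \<kappa>' where \<kappa>': "homeomorphism D UNIV \<kappa> \<kappa>'" using chart_homeomorphism[OF D] .
    have inj: "inj_on \<kappa> D" and "\<kappa> ` D = UNIV"
      using \<kappa>' unfolding homeomorphism_def by (auto intro: inj_on_inverseI)
    have inv: "inv_into D \<kappa> = \<kappa>'"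
    proof
      fix z
      have "\<kappa>' z \<in> D" "\<kappa> (\<kappa>' z) = z" using \<kappa>' unfolding homeomorphism_def by auto
      then show "inv_into D \<kappa> z = \<kappa>' z" using inv_into_f_f[OF inj, of "\<kappa>' z"] by simp
    qed
    define h where "h = \<psi> \<circ> \<kappa>'"
    define W where "W = \<kappa> ` (V \<inter> D)"
    have "openin (top_of_set D) (V \<inter> D)"
    proof -
      obtain T where "open T" "V = S2 \<inter> T" using V by (auto simp: openin_open)
      then have "open T \<and> V \<inter> D = D \<inter> T" using chart_open(2)[OF D] by blast
      then show ?thesis unfolding openin_open by blast
    qed
    then have "openin (top_of_set UNIV) W"
      unfolding W_def using homeomorphism_imp_open_map[OF \<kappa>'] by blast
    then have W: "open W" by simp
    have \<kappa>'\<kappa>: "\<kappa>' (\<kappa> y) = y" if "y \<in> D" for y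
      using \<kappa>' that unfolding homeomorphism_def by auto
    then have \<kappa>'W: "\<kappa>' ` W = V \<inter> D"
      unfolding W_def image_image by (simp cong: image_cong_simp)
    have hW: "continuous_on W h" "inj_on h W"
    proof -
      have \<psi>: "continuous_on V \<psi>" "inj_on \<psi> V"
        using hom unfolding homeomorphism_def by (auto intro: inj_on_inverseI)
      have "continuous_on UNIV \<kappa>'" "inj \<kappa>'"
        using \<kappa>' unfolding homeomorphism_def by (auto intro: inj_on_inverseI)
      then have "continuous_on W \<kappa>'" "inj_on \<kappa>' W" "continuous_on (\<kappa>' ` W) \<psi>" "inj_on \<psi> (\<kappa>' ` W)"
        using \<psi> unfolding \<kappa>'W by (meson Int_lower1 subset_UNIV continuous_on_subset inj_on_subset)+
      then show "continuous_on W h" "inj_on h W"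
        unfolding h_def by (metis continuous_on_compose, metis comp_inj_on)
    qed
    \<comment> \<open>Both coordinates are read through the parametrization \<open>G\<close>: near
      \<open>z\<close>, \<open>h o (\<kappa> o G)\<close> is \<open>\<psi> o G\<close>. This and
      \<open>\<kappa> o G\<close> are positive, hence so is \<open>h\<close>.\<close>
    have off: "positive_at h (\<kappa> y)" if y: "y \<in> V" "y \<in> D" "y \<noteq> p" for y
    proof -
      obtain B G z where B: "open B" "z \<in> B" "continuous_on B G" "inj_on G B"
        "G z = y" "G ` B \<subseteq> V" "positive_sphere G z" "positive_at (\<psi> \<circ> G) z" using par y by blast
      have BS: "G ` B \<subseteq> S2" using B(6) V openin_imp_subset by blast
      note R = chart_read[OF B(1,3,4) BS D]
      have "positive_at (h \<circ> (\<kappa> \<circ> G)) z \<longleftrightarrow> positive_at h ((\<kappa> \<circ> G) z)"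
      proof (rule positive_at_comp[OF R(1) _ R(2,3) W _ hW])
        show "positive_at (\<kappa> \<circ> G) z" using B(5,7) y D unfolding positive_sphere_def by auto
      qed (use B y in \<open>auto simp: W_def\<close>)
      moreover have "positive_at (h \<circ> (\<kappa> \<circ> G)) z \<longleftrightarrow> positive_at (\<psi> \<circ> G) z"
        by (rule positive_at_cong[OF R(1)]) (use B y \<kappa>'\<kappa> in \<open>auto simp: h_def\<close>)
      ultimately show ?thesis using B by simp
    qed
    have "positive_at h (\<kappa> q)"
    proof (cases "q = p")
      case True
      have "\<kappa> q \<in> W" using q by (simp add: W_def)
      then obtain e where e: "e > 0" "ball (\<kappa> q) e \<subseteq> W" using W open_contains_ball by blast
      \<comment> \<open>At the exceptional point, positivity is borrowed from a nearby point of the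
        same coordinate ball.\<close>
      define w where "w = \<kappa> q + of_real (e / 2)"
      have w: "w \<in> ball (\<kappa> q) e" "w \<noteq> \<kappa> q" using e by (auto simp: w_def dist_norm)
      then obtain y where y: "y \<in> V \<inter> D" "w = \<kappa> y" using e by (auto simp: W_def)
      then have "positive_at h w" using off[of y] w True by auto
      then show ?thesis
        using positive_at_ball[OF continuous_on_subset[OF hW(1) e(2)] inj_on_subset[OF hW(2) e(2)] w(1), of "\<kappa> q"] e
        by simp
    qed (use off q in auto)
    then show "\<forall>\<^sub>F r in at_right 0.
        winding_number (\<psi> \<circ> inv_into D \<kappa> \<circ> circlepath (\<kappa> q) r) (\<psi> q) = 1"
      unfolding positive_at_def inv using \<kappa>'\<kappa>[OF q(2)] by (simp add: h_def)
  qed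
qed (use V hom in auto)

text \<open>The sign \<open>s\<close> is there because a half turn \<open>x |-> 2 l - x\<close>
  carries the coordinate centred at \<open>p\<close> to minus the coordinate centred at
  \<open>2 l - p\<close>. Multiplication by a nonzero real is holomorphic with nonzero derivative,
  so both signs preserve orientation.\<close>

lemma oriented_disc_plane:
  assumes "\<bar>s\<bar> = 1" "0 < \<epsilon>"
  shows "oriented_disc plane (ball q \<epsilon>) (\<lambda>x. of_real (s / \<epsilon>) * cx (x - q))"
proof -
  let ?\<phi> = "\<lambda>x. of_real (s / \<epsilon>) * cx (x - q)"
  let ?\<phi>' = "\<lambda>z. q + vx (of_real (\<epsilon> / s) * z)"
  have s0: "s \<noteq> 0" "\<epsilon> \<noteq> 0" using assms by auto
  have "(\<lambda>x::real^2. Complex (x $ 1) (x $ 2)) = cx" by (simp add: fun_eq_iff cx_def)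
  then have plane: "plane = {(UNIV, cx)}" by (simp add: plane_def)
  have inv: "inv_into UNIV cx = vx"
    by (rule inv_equality) simp_all
  have "homeomorphism (ball q \<epsilon>) (ball 0 1) ?\<phi> ?\<phi>'"
  proof (rule homeomorphismI)
    show "continuous_on (ball q \<epsilon>) ?\<phi>" "continuous_on (ball 0 1) ?\<phi>'"
      by (intro continuous_intros)+
    show "?\<phi> ` ball q \<epsilon> \<subseteq> ball 0 1"
      using assms by (auto simp: norm_mult norm_divide dist_norm norm_minus_commute)
    show "?\<phi>' ` ball 0 1 \<subseteq> ball q \<epsilon>"
    proof safe
      fix z :: complex assume "z \<in> ball 0 1"
      moreover have "norm (vx w) = norm w" for w by (metis cx_vx norm_cx)
      ultimately show "?\<phi>' z \<in> ball q \<epsilon>" using assms by (simp add: dist_norm norm_mult norm_divide)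
    qed
    show "?\<phi>' (?\<phi> x) = x" for x
      using assms s0 by simp
    show "?\<phi> (?\<phi>' z) = z" for z
      using assms s0 by simp
  qed
  moreover have "\<forall>\<^sub>F r in at_right 0. winding_number (?\<phi> \<circ> vx \<circ> circlepath (cx x) r) (?\<phi> x) = 1" for x
  proof -
    have eq: "?\<phi> \<circ> vx = (\<lambda>z. of_real (s / \<epsilon>) * (z - cx q))" by (simp add: fun_eq_iff cx_diff)
    have "positive_at (?\<phi> \<circ> vx) (cx x)"
    proof (rule positive_at_holomorphic[of _ UNIV])
      show "(?\<phi> \<circ> vx) holomorphic_on UNIV" unfolding eq by (intro holomorphic_intros)
      have "((\<lambda>z. c * (z - cx q)) has_field_derivative c) (at (cx x))" for c
        by (rule derivative_eq_intros refl | simp)+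
      then have "deriv (?\<phi> \<circ> vx) (cx x) = of_real (s / \<epsilon>)" unfolding eq by (rule DERIV_imp_deriv)
      then show "deriv (?\<phi> \<circ> vx) (cx x) \<noteq> 0" using s0 by simp
    qed auto
    then show ?thesis unfolding positive_at_def by simp
  qed
  ultimately show ?thesis
    unfolding oriented_disc_def points_plane unfolding plane using inv by auto
qed

section \<open>Quotients of the plane by half turns\<close>

text \<open>The local degree at \<open>p\<close> of the quotient map: a lattice point is fixed by
  the half turn \<open>x |-> 2 p - x\<close>.\<close>

definition ramification :: "(real^2) set \<Rightarrow> real^2 \<Rightarrow> nat" where
  "ramification L p = (if p \<in> L then 2 else 1)"

text \<open>A deck transformation moves \<open>p\<close> by \<open>2 l\<close> or by
  \<open>2 (l - p)\<close>. The two conditions make this at least \<open>2 \<epsilon>\<close> unless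
  \<open>p\<close> is fixed, so the open ball about \<open>p\<close> is disjoint from the balls
  about the other points of its orbit.\<close>

definition isolating :: "(real^2) set \<Rightarrow> real^2 \<Rightarrow> real \<Rightarrow> bool" where
  "isolating L p \<epsilon> \<longleftrightarrow> 0 < \<epsilon> \<and> (\<forall>l \<in> L. norm l < \<epsilon> \<longrightarrow> l = 0) \<and> (\<forall>l \<in> L. dist p l < \<epsilon> \<longrightarrow> l = p)"

text \<open>A coordinate on the image of the ball. At a lattice point the chosen preimage is
  determined only up to the sign of its difference to \<open>p\<close>, and the square removes that
  sign.\<close>

definition disc_chart :: "(real^2) set \<Rightarrow> (real^2 \<Rightarrow> real^3) \<Rightarrow> real^2 \<Rightarrow> real \<Rightarrow> real^3 \<Rightarrow> complex" where
  "disc_chart L F p \<epsilon> y =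
     (of_real (1 / \<epsilon>) * cx (inv_into (ball p \<epsilon>) F y - p)) ^ ramification L p"

lemma isolating_smaller: "isolating L p \<epsilon> \<Longrightarrow> 0 < \<epsilon>' \<Longrightarrow> \<epsilon>' \<le> \<epsilon> \<Longrightarrow> isolating L p \<epsilon>'"
  unfolding isolating_def by auto

lemma isolating_subset: "isolating L p \<epsilon> \<Longrightarrow> L' \<subseteq> L \<Longrightarrow> isolating L' p \<epsilon>"
  unfolding isolating_def by blast

text \<open>The algebraic core, free of topology: \<open>L\<close> is a group and the fibres of
  \<open>F\<close> are the orbits of the maps \<open>x |-> 2 l +- x\<close>. Arbitrary lattice
  coverings and the explicit pillowcase maps are both instances.\<close>

locale lattice_fibres =
  fixes L :: "(real^2) set" and F :: "real^2 \<Rightarrow> real^3"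
  assumes zero_mem: "0 \<in> L" and diff_mem: "\<And>x y. x \<in> L \<Longrightarrow> y \<in> L \<Longrightarrow> x - y \<in> L"
    and fibre: "\<And>x y. F x = F y \<longleftrightarrow> (\<exists>l \<in> L. y = 2 *\<^sub>R l + x \<or> y = 2 *\<^sub>R l - x)"
begin

lemma minus_mem: "x \<in> L \<Longrightarrow> - x \<in> L"
  using diff_mem[OF zero_mem, of x] by simp

lemma add_mem: "x \<in> L \<Longrightarrow> y \<in> L \<Longrightarrow> x + y \<in> L"
  using diff_mem[of x "- y"] minus_mem[of y] by simp

lemma translate_mem_iff: "l \<in> L \<Longrightarrow> l + x \<in> L \<longleftrightarrow> x \<in> L"
  using add_mem[of l x] diff_mem[of "l + x" l] by auto

lemma double_mem: "l \<in> L \<Longrightarrow> 2 *\<^sub>R l \<in> L"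
  unfolding scaleR_2 by (rule add_mem)

lemma fibre_plus: assumes "l \<in> L" shows "F (2 *\<^sub>R l + x) = F x"
proof -
  have "F x = F (2 *\<^sub>R l + x)" unfolding fibre using assms by blast
  then show ?thesis by (rule sym)
qed

lemma fibre_minus: assumes "l \<in> L" shows "F (2 *\<^sub>R l - x) = F x"
proof -
  have "F x = F (2 *\<^sub>R l - x)" unfolding fibre using assms by blast
  then show ?thesis by (rule sym)
qed

lemma fibreE:
  assumes "F x = F y"
  obtains l where "l \<in> L" "y = 2 *\<^sub>R l + x" | l where "l \<in> L" "y = 2 *\<^sub>R l - x"
  using iffD1[OF fibre assms] by blast

text \<open>The maps \<open>x |-> 2 l +- x\<close> preserve \<open>L\<close>, so membership in the
  lattice depends only on the image point. Thus ramification descends to the sphere.\<close>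

lemma fibre_mem_iff:
  assumes "F x = F y" shows "x \<in> L \<longleftrightarrow> y \<in> L"
proof -
  have "- x \<in> L \<longleftrightarrow> x \<in> L" using minus_mem[of x] minus_mem[of "- x"] by auto
  with assms show ?thesis
  proof (cases rule: fibreE)
    fix l assume l: "l \<in> L" "y = 2 *\<^sub>R l - x"
    then show ?thesis
      using translate_mem_iff[OF double_mem[OF l(1)], of "- x"] \<open>- x \<in> L \<longleftrightarrow> x \<in> L\<close> by simp
  next
    fix l assume l: "l \<in> L" "y = 2 *\<^sub>R l + x"
    then show ?thesis using translate_mem_iff[OF double_mem[OF l(1)], of x] by simp
  qed
qed

lemma ramification_cong: "F x = F y \<Longrightarrow> ramification L x = ramification L y"
  using fibre_mem_iff[of x y] by (simp add: ramification_def)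

text \<open>Deck transformations are isometries preserving \<open>L\<close>, so one radius serves a
  whole orbit.\<close>

lemma isolating_orbit:
  assumes p: "isolating L p \<epsilon>" and q: "F q = F p"
  shows "isolating L q \<epsilon>"
proof -
  obtain l where l: "l \<in> L" "q = 2 *\<^sub>R l + p \<or> q = 2 *\<^sub>R l - p" using fibreE[OF q[symmetric]] by blast
  have "l' = q" if l': "l' \<in> L" "dist q l' < \<epsilon>" for l'
    using l(2)
  proof
    assume eq: "q = 2 *\<^sub>R l + p"
    have "l' - 2 *\<^sub>R l \<in> L" by (intro diff_mem double_mem l' l)
    moreover have "dist p (l' - 2 *\<^sub>R l) < \<epsilon>" using l'(2) unfolding eq by (simp add: dist_norm algebra_simps)
    ultimately have "l' - 2 *\<^sub>R l = p" using p unfolding isolating_def by blast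
    then show ?thesis using eq by (simp add: algebra_simps)
  next
    assume eq: "q = 2 *\<^sub>R l - p"
    have "2 *\<^sub>R l - l' \<in> L" by (intro diff_mem double_mem l' l)
    moreover have "dist p (2 *\<^sub>R l - l') < \<epsilon>"
    proof -
      have "p - (2 *\<^sub>R l - l') = - (q - l')" unfolding eq by simp
      then show ?thesis using l'(2) unfolding dist_norm by (simp only: norm_minus_cancel)
    qed
    ultimately have "2 *\<^sub>R l - l' = p" using p unfolding isolating_def by blast
    then show ?thesis using eq by (simp add: algebra_simps)
  qed
  then show ?thesis using p unfolding isolating_def by blast
qed

text \<open>If the two balls met, \<open>q - p\<close>, which is \<open>2 l\<close> or
  \<open>2 (l - p)\<close>, would have norm below \<open>2 \<epsilon>\<close>; isolation then makes
  it 0.\<close>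

lemma isolating_overlap:
  assumes p: "isolating L p \<epsilon>" and q: "F q = F p" and x: "x \<in> ball p \<epsilon>" "x \<in> ball q \<epsilon>"
  shows "q = p"
proof -
  obtain l where l: "l \<in> L" "q = 2 *\<^sub>R l + p \<or> q = 2 *\<^sub>R l - p" using fibreE[OF q[symmetric]] by blast
  have pq: "norm (q - p) < 2 * \<epsilon>"
    using x dist_triangle_less_add[of p x \<epsilon> q \<epsilon>] by (simp add: dist_commute dist_norm norm_minus_commute)
  show ?thesis
    using l(2)
  proof
    assume eq: "q = 2 *\<^sub>R l + p"
    then have "norm l < \<epsilon>" using pq by simp
    then have "l = 0" using p l unfolding isolating_def by blast
    then show ?thesis using eq by simp
  next
    assume eq: "q = 2 *\<^sub>R l - p"
    have "q - p = 2 *\<^sub>R (l - p)" unfolding eq by (simp add: vec_eq_iff algebra_simps)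
    then have "dist p l < \<epsilon>" using pq by (simp add: dist_norm norm_minus_commute)
    then have "l = p" using p l unfolding isolating_def by blast
    then show ?thesis using eq by (simp add: vec_eq_iff)
  qed
qed

lemma isolating_fibre:
  assumes p: "isolating L p \<epsilon>" and xy: "x \<in> ball p \<epsilon>" "y \<in> ball p \<epsilon>" and eq: "F x = F y"
  shows "y = x \<or> p \<in> L \<and> y - p = - (x - p)"
proof -
  obtain l where l: "l \<in> L" "y = 2 *\<^sub>R l + x \<or> y = 2 *\<^sub>R l - x" using fibreE[OF eq] by blast
  show ?thesis
    using l(2)
  proof
    assume y: "y = 2 *\<^sub>R l + x"
    have "norm (y - x) < 2 * \<epsilon>"
      using xy dist_triangle_less_add[of x p \<epsilon> y \<epsilon>] by (simp add: dist_commute dist_norm norm_minus_commute)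
    then have "norm l < \<epsilon>" using y by simp
    then have "l = 0" using p l unfolding isolating_def by blast
    then show ?thesis using y by simp
  next
    assume y: "y = 2 *\<^sub>R l - x"
    have "2 *\<^sub>R (p - l) = (p - x) + (p - y)" unfolding y by (simp add: vec_eq_iff algebra_simps)
    then have "norm (2 *\<^sub>R (p - l)) < 2 * \<epsilon>"
      using xy norm_triangle_ineq[of "p - x" "p - y"] by (simp add: dist_norm)
    then have "dist p l < \<epsilon>" by (simp add: dist_norm)
    then have "l = p" using p l unfolding isolating_def by blast
    then have "y - p = - (x - p)" using y by (simp add: vec_eq_iff algebra_simps)
    then show ?thesis using \<open>l = p\<close> l(1) by simp
  qed
qed

lemma isolating_inj_on: "isolating L p \<epsilon> \<Longrightarrow> p \<notin> L \<Longrightarrow> inj_on F (ball p \<epsilon>)"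
  using isolating_fibre by (metis inj_onI)

lemma disc_chart_eq:
  assumes p: "isolating L p \<epsilon>" and x: "x \<in> ball p \<epsilon>"
  shows "disc_chart L F p \<epsilon> (F x) = (of_real (1 / \<epsilon>) * cx (x - p)) ^ ramification L p"
proof -
  define y where "y = inv_into (ball p \<epsilon>) F (F x)"
  have "F x \<in> F ` ball p \<epsilon>" using x by blast
  then have "y \<in> ball p \<epsilon>" "F x = F y"
    unfolding y_def by (rule inv_into_into, simp add: f_inv_into_f)
  then have "y = x \<or> p \<in> L \<and> y - p = - (x - p)" using isolating_fibre[OF p x] by blast
  then show ?thesis
  proof
    assume "p \<in> L \<and> y - p = - (x - p)"
    then show ?thesis
      unfolding disc_chart_def y_def[symmetric] ramification_def by (simp only: cx_minus if_True power2_minus mult_minus_right)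
  qed (simp add: disc_chart_def y_def[symmetric])
qed

lemma isolating_off:
  assumes "isolating L p \<epsilon>" "x \<in> ball p \<epsilon>" "x \<noteq> p \<or> p \<notin> L" shows "x \<notin> L"
  using assms unfolding isolating_def by auto

lemma fibre_ball: "{x. F x \<in> F ` ball p \<epsilon>} = (\<Union>q \<in> {q. F q = F p}. ball q \<epsilon>)"
proof safe
  fix x y assume y: "y \<in> ball p \<epsilon>" "F x = F y"
  obtain l where l: "l \<in> L" "x = 2 *\<^sub>R l + y \<or> x = 2 *\<^sub>R l - y" using fibreE[OF y(2)[symmetric]] by blast
  show "x \<in> (\<Union>q \<in> {q. F q = F p}. ball q \<epsilon>)"
    using l(2)
  proof
    assume "x = 2 *\<^sub>R l + y"
    then show ?thesis using l y fibre_plus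
      by (intro UN_I[of "2 *\<^sub>R l + p"]) auto
  next
    assume x: "x = 2 *\<^sub>R l - y"
    have "2 *\<^sub>R l - p - (2 *\<^sub>R l - y) = y - p" by simp
    then show ?thesis using l y fibre_minus x
      by (intro UN_I[of "2 *\<^sub>R l - p"]) (auto simp: dist_norm norm_minus_commute)
  qed
next
  fix x q assume q: "F q = F p" "x \<in> ball q \<epsilon>"
  obtain l where l: "l \<in> L" "p = 2 *\<^sub>R l + q \<or> p = 2 *\<^sub>R l - q" using fibreE[OF q(1)] by blast
  show "F x \<in> F ` ball p \<epsilon>"
    using l(2)
  proof
    assume "p = 2 *\<^sub>R l + q"
    then show ?thesis using l q fibre_plus
      by (intro image_eqI[of _ _ "2 *\<^sub>R l + x"]) auto
  next
    assume p: "p = 2 *\<^sub>R l - q"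
    have "2 *\<^sub>R l - q - (2 *\<^sub>R l - x) = x - q" by simp
    then show ?thesis using l q fibre_minus p
      by (intro image_eqI[of _ _ "2 *\<^sub>R l - x"]) (auto simp: dist_norm norm_minus_commute)
  qed
qed

end

text \<open>Positivity is asked at a single point because it spreads. The compact set with full
  image makes \<open>F\<close> an open map onto the sphere.\<close>

locale lattice_quotient = lattice_fibres +
  assumes discrete: "\<exists>\<delta>>0. \<forall>l \<in> L. l \<noteq> 0 \<longrightarrow> \<delta> \<le> norm l"
    and countable: "countable L"
    and cont: "continuous_on UNIV F"
    and compact_fundamental: "\<exists>K. compact K \<and> F ` K = S2"
    and range: "range F = S2"
    and positive: "\<exists>p. p \<notin> L \<and> positive_sphere (F \<circ> vx) (cx p)"
begin

lemma closed_lattice: "closed L"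
proof -
  obtain \<delta> where \<delta>: "0 < \<delta>" "\<And>l. l \<in> L \<Longrightarrow> l \<noteq> 0 \<Longrightarrow> \<delta> \<le> norm l" using discrete by blast
  show ?thesis
  proof (rule discrete_imp_closed[OF \<delta>(1)], intro ballI impI)
    fix x y assume xy: "x \<in> L" "y \<in> L" "dist y x < \<delta>"
    then have "y - x \<noteq> 0 \<Longrightarrow> \<delta> \<le> norm (y - x)" using \<delta>(2)[OF diff_mem] by blast
    then show "y = x" using xy(3) by (cases "y = x") (auto simp: dist_norm)
  qed
qed

lemma isolating_exists: "\<exists>\<epsilon>. isolating L p \<epsilon>"
proof -
  obtain \<delta> where \<delta>: "0 < \<delta>" "\<And>l. l \<in> L \<Longrightarrow> l \<noteq> 0 \<Longrightarrow> \<delta> \<le> norm l" using discrete by blast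
  have "\<exists>e>0. \<forall>l \<in> L. dist p l < e \<longrightarrow> l = p"
  proof (cases "p \<in> L")
    case True
    have "l = p" if "l \<in> L" "dist p l < \<delta>" for l
      using \<delta>(2)[OF diff_mem[OF that(1) True]] that(2) by (cases "l = p") (auto simp: dist_norm norm_minus_commute)
    then show ?thesis using \<delta> by blast
  next
    case False
    then obtain e where "e > 0" "ball p e \<subseteq> - L"
      using closed_lattice open_contains_ball[of "- L"] by (auto simp: open_Compl)
    then show ?thesis by (intro exI[of _ e]) auto
  qed
  then obtain e where e: "e > 0" "\<forall>l \<in> L. dist p l < e \<longrightarrow> l = p" by blast
  have "isolating L p (min \<delta> e)"
    unfolding isolating_def
  proof (intro conjI ballI impI)
    fix l assume "l \<in> L" "norm l < min \<delta> e"
    then show "l = 0" using \<delta>(2)[of l] by (cases "l = 0") auto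
  qed (use \<delta> e in auto)
  then show ?thesis by blast
qed

text \<open>The saturation of \<open>W\<close> is a union of isometric images of \<open>W\<close>,
  hence open. Its complement meets the compact fundamental set \<open>K\<close> in a compact set,
  and the image of \<open>W\<close> is the complement of the image of that set.\<close>

lemma open_map:
  assumes "open W" shows "openin (top_of_set S2) (F ` W)"
proof -
  obtain K where K: "compact K" "F ` K = S2" using compact_fundamental by blast
  define C where "C = - F -` F ` W"
  have "F -` F ` W = (\<Union>l \<in> L. (\<lambda>x. 2 *\<^sub>R l + x) ` W \<union> (\<lambda>x. 2 *\<^sub>R l - x) ` W)"
  proof (intro subset_antisym subsetI)
    fix x assume "x \<in> F -` F ` W"
    then obtain w where w: "w \<in> W" "F w = F x" by auto
    from w(2) show "x \<in> (\<Union>l \<in> L. (\<lambda>x. 2 *\<^sub>R l + x) ` W \<union> (\<lambda>x. 2 *\<^sub>R l - x) ` W)"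
      by (cases rule: fibreE) (use w(1) in blast)+
  next
    fix x assume "x \<in> (\<Union>l \<in> L. (\<lambda>x. 2 *\<^sub>R l + x) ` W \<union> (\<lambda>x. 2 *\<^sub>R l - x) ` W)"
    then obtain l w where "l \<in> L" "w \<in> W" "x = 2 *\<^sub>R l + w \<or> x = 2 *\<^sub>R l - w" by blast
    then have "F x = F w" using fibre_plus[of l w] fibre_minus[of l w] by auto
    then show "x \<in> F -` F ` W" using \<open>w \<in> W\<close> by simp
  qed
  moreover have "open ((\<lambda>x. 2 *\<^sub>R l - x) ` W)" for l
  proof -
    have "(\<lambda>x. 2 *\<^sub>R l - x) ` W = (\<lambda>x. 2 *\<^sub>R l + x) ` uminus ` W"
      unfolding image_image diff_conv_add_uminus ..
    then show ?thesis using open_translation[OF open_negations[OF assms]] by simp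
  qed
  ultimately have "closed C"
    unfolding C_def using open_translation[OF assms] by (simp add: closed_def open_UN open_Un)
  then have "compact (C \<inter> K)" using K(1) by (rule closed_Int_compact)
  then have "closed (F ` (C \<inter> K))"
    by (intro compact_imp_closed compact_continuous_image continuous_on_subset[OF cont]) auto
  moreover have "F ` W = S2 - F ` (C \<inter> K)"
  proof
    show "F ` W \<subseteq> S2 - F ` (C \<inter> K)"
    proof
      fix y assume y: "y \<in> F ` W"
      have "y \<notin> F ` (C \<inter> K)"
      proof
        assume "y \<in> F ` (C \<inter> K)"
        then obtain c where "c \<in> C" "y = F c" by (elim imageE IntE)
        then show False using y by (simp add: C_def)
      qed
      moreover have "y \<in> range F" using y by (elim imageE) simp
      ultimately show "y \<in> S2 - F ` (C \<inter> K)" unfolding range by simp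
    qed
    show "S2 - F ` (C \<inter> K) \<subseteq> F ` W"
    proof
      fix y assume y: "y \<in> S2 - F ` (C \<inter> K)"
      then obtain x where "x \<in> K" "y = F x" using K(2) by blast
      then show "y \<in> F ` W" using y by (auto simp: C_def)
    qed
  qed
  ultimately show ?thesis unfolding openin_open
    by (intro exI[of _ "- F ` (C \<inter> K)"]) (auto simp: open_Compl)
qed

lemma connected_off_lattice: "connected (- L)"
  using path_connected_complement_countable[OF _ countable] path_connected_imp_connected by auto

lemma cx_ball_read:
  "continuous_on S (F \<circ> vx)" "(F \<circ> vx) ` ball (cx p) e = F ` ball p e"
proof -
  show "continuous_on S (F \<circ> vx)"
    using continuous_on_compose[of S vx F] continuous_on_vx[OF continuous_on_id] continuous_on_subset[OF cont]
    by auto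
  show "(F \<circ> vx) ` ball (cx p) e = F ` ball p e"
    unfolding image_comp[symmetric] by (simp add: vx_image_ball)
qed

lemma inj_on_vx:
  assumes "inj_on F (ball p e)" shows "inj_on (F \<circ> vx) (ball (cx p) e)"
proof (rule comp_inj_on)
  show "inj_on vx (ball (cx p) e)" by (metis cx_vx inj_onI)
qed (use assms in \<open>simp add: vx_image_ball\<close>)

text \<open>The complement of the countable lattice is connected, and \<open>F\<close> is injective
  on isolating balls centred there, so positivity spreads from the one point where it is
  assumed.\<close>

lemma positive_off_lattice:
  assumes "p \<notin> L" shows "positive_sphere (F \<circ> vx) (cx p)"
proof -
  obtain q where q: "q \<notin> L" "positive_sphere (F \<circ> vx) (cx q)" using positive by blast
  have im: "cx ` (- L) = vx -` (- L)"
  proof (intro subset_antisym subsetI)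
    fix z assume "z \<in> vx -` (- L)"
    then show "z \<in> cx ` (- L)" by (intro image_eqI[of _ _ "vx z"]) auto
  qed auto
  have "continuous_on UNIV vx" using continuous_on_vx[OF continuous_on_id] by simp
  then have "open (cx ` (- L))"
    unfolding im using closed_lattice by (intro open_vimage open_Compl)
  moreover have "connected (cx ` (- L))"
    by (intro connected_continuous_image connected_off_lattice continuous_intros)
  ultimately show ?thesis
  proof (rule positive_sphere_connected[OF _ _ cx_ball_read(1), where x = "cx q"])
    fix x assume "x \<in> cx ` (- L)"
    then obtain y where y: "y \<notin> L" "x = cx y" by auto
    obtain e where e: "isolating L y e" using isolating_exists by blast
    then show "\<exists>e>0. inj_on (F \<circ> vx) (ball x e)"
      using inj_on_vx[OF isolating_inj_on[OF e y(1)]] y unfolding isolating_def by blast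
  qed (use q assms range in auto)
qed

text \<open>On the ball, \<open>F\<close> and the power map of the scaled coordinate make the same
  identifications: none off the lattice, and \<open>x - p\<close> with its negative at a lattice
  point. So the chart is injective, and openness of the two maps makes it a homeomorphism.\<close>

lemma disc_chart_homeomorphism:
  assumes p: "isolating L p \<epsilon>"
  shows "\<exists>\<psi>'. homeomorphism (F ` ball p \<epsilon>) (ball 0 1) (disc_chart L F p \<epsilon>) \<psi>'"
proof -
  define e where "e = ramification L p"
  have e: "e = 1 \<or> e = 2" "0 < e" by (auto simp: e_def ramification_def)
  have \<epsilon>: "0 < \<epsilon>" using p by (simp add: isolating_def)
  let ?\<psi> = "disc_chart L F p \<epsilon>"
  let ?s = "\<lambda>x. of_real (1 / \<epsilon>) * cx (x - p)"
  have \<psi>: "?\<psi> (F x) = ?s x ^ e" if "x \<in> ball p \<epsilon>" for x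
    using disc_chart_eq[OF p that] by (simp add: e_def)
  have "\<bar>1 :: real\<bar> = 1" by simp
  then have "oriented_disc plane (ball p \<epsilon>) ?s" using \<epsilon> by (rule oriented_disc_plane)
  then obtain s' where hom_s: "homeomorphism (ball p \<epsilon>) (ball 0 1) ?s s'"
    unfolding oriented_disc_def by blast
  then have s: "?s ` ball p \<epsilon> = ball 0 1" by (rule homeomorphism_image1)
  have power: "(\<lambda>z. z ^ e) ` ball (0::complex) 1 = ball 0 1"
  proof
    show "(\<lambda>z. z ^ e) ` ball (0::complex) 1 \<subseteq> ball 0 1"
      using e by (auto simp: norm_power power_less_one_iff)
    show "ball (0::complex) 1 \<subseteq> (\<lambda>z. z ^ e) ` ball 0 1"
    proof
      fix z :: complex assume z: "z \<in> ball 0 1"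
      from e(1) show "z \<in> (\<lambda>z. z ^ e) ` ball 0 1"
      proof
        assume "e = 2"
        moreover have "norm (csqrt z) < 1" using z by (simp add: norm_csqrt)
        ultimately show ?thesis by (intro image_eqI[of _ _ "csqrt z"]) auto
      qed (use z in auto)
    qed
  qed
  show ?thesis
  proof (rule homeomorphism_injective_open_map[where f = ?\<psi>])
    show \<psi>_im: "?\<psi> ` (F ` ball p \<epsilon>) = ball 0 1"
    proof -
      have "?\<psi> ` (F ` ball p \<epsilon>) = (\<lambda>z. z ^ e) ` ?s ` ball p \<epsilon>"
        unfolding image_image by (rule image_cong[OF refl]) (rule \<psi>)
      then show ?thesis unfolding s power .
    qed
    show "inj_on ?\<psi> (F ` ball p \<epsilon>)"
    proof (rule inj_onI, safe)
      fix x y assume xy: "x \<in> ball p \<epsilon>" "y \<in> ball p \<epsilon>" "?\<psi> (F x) = ?\<psi> (F y)"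
      then have eq: "?s x ^ e = ?s y ^ e" using \<psi> by simp
      show "F x = F y"
      proof (cases "p \<in> L")
        case True
        then have "?s x = ?s y \<or> ?s x = - ?s y"
          using eq by (simp only: e_def ramification_def if_True power2_eq_iff)
        then have "of_real (1 / \<epsilon>) * cx (x - p) = of_real (1 / \<epsilon>) * cx (y - p) \<or>
            of_real (1 / \<epsilon>) * cx (x - p) = of_real (1 / \<epsilon>) * cx (- (y - p))"
          by (simp only: cx_minus mult_minus_right)
        then have "x - p = y - p \<or> x - p = - (y - p)"
          using \<epsilon> by (simp only: mult_cancel_left of_real_eq_0_iff cx_inject) auto
        then show ?thesis
        proof
          assume "x - p = - (y - p)"
          then have "y = 2 *\<^sub>R p - x" by (simp add: vec_eq_iff algebra_simps)
          then show ?thesis using fibre_minus[OF True, of x] by simp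
        qed simp
      next
        case False
        then have "?s x = ?s y" using eq by (simp add: e_def ramification_def)
        then show ?thesis using \<epsilon> by simp
      qed
    qed
    \<comment> \<open>A preimage under the chart is the image under \<open>F\<close> of an open
      subset of the ball, so continuity follows from openness of \<open>F\<close>.\<close>
    show "continuous_on (F ` ball p \<epsilon>) ?\<psi>"
      unfolding continuous_openin_preimage_eq
    proof (intro allI impI)
      fix T :: "complex set" assume T: "open T"
      have "continuous_on (ball p \<epsilon>) (\<lambda>x. ?s x ^ e)" by (intro continuous_intros)
      then have "open (ball p \<epsilon> \<inter> (\<lambda>x. ?s x ^ e) -` T)"
        by (intro continuous_open_preimage) (use T in auto)
      then have "openin (top_of_set S2) (F ` (ball p \<epsilon> \<inter> (\<lambda>x. ?s x ^ e) -` T))" by (rule open_map)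
      moreover have "F ` ball p \<epsilon> \<inter> ?\<psi> -` T = F ` (ball p \<epsilon> \<inter> (\<lambda>x. ?s x ^ e) -` T)"
      proof (intro subset_antisym subsetI)
        fix y assume "y \<in> F ` ball p \<epsilon> \<inter> ?\<psi> -` T"
        then obtain x where "x \<in> ball p \<epsilon>" "y = F x" "?\<psi> (F x) \<in> T" by (elim IntE imageE) simp
        then show "y \<in> F ` (ball p \<epsilon> \<inter> (\<lambda>x. ?s x ^ e) -` T)"
          unfolding \<psi>[OF \<open>x \<in> ball p \<epsilon>\<close>] by (intro image_eqI[of _ _ x] IntI vimageI2)
      next
        fix y assume "y \<in> F ` (ball p \<epsilon> \<inter> (\<lambda>x. ?s x ^ e) -` T)"
        then obtain x where x: "x \<in> ball p \<epsilon>" "y = F x" "?s x ^ e \<in> T" by (elim IntE imageE vimageE) simp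
        then show "y \<in> F ` ball p \<epsilon> \<inter> ?\<psi> -` T"
          unfolding \<psi>[OF x(1), symmetric] by simp
      qed
      ultimately have "openin (top_of_set S2) (F ` ball p \<epsilon> \<inter> ?\<psi> -` T)" by simp
      moreover have "F ` ball p \<epsilon> \<subseteq> S2" unfolding range[symmetric] by (rule image_mono) simp
      ultimately show "openin (top_of_set (F ` ball p \<epsilon>)) (F ` ball p \<epsilon> \<inter> ?\<psi> -` T)"
        by (intro openin_subset_trans[OF _ Int_lower1])
    qed
    fix U assume "openin (top_of_set (F ` ball p \<epsilon>)) U"
    then obtain T where T: "open T" "U = F ` ball p \<epsilon> \<inter> T" by (auto simp: openin_open)
    \<comment> \<open>\<open>B\<close> is the part of the ball over \<open>U\<close>. Its image
      under the scaled coordinate is open, and the power map keeps it open by the open mapping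
      theorem.\<close>
    define B where "B = ball p \<epsilon> \<inter> F -` T"
    have "open B"
      unfolding B_def by (rule continuous_open_preimage[OF continuous_on_subset[OF cont]]) (use T in auto)
    moreover have "B \<subseteq> ball p \<epsilon>" by (auto simp: B_def)
    ultimately have "openin (top_of_set (ball p \<epsilon>)) B" by (rule open_subset[rotated])
    with hom_s have "openin (top_of_set (ball 0 1)) (?s ` B)" by (rule homeomorphism_imp_open_map)
    then have "open (?s ` B)" by (simp add: openin_open_eq)
    moreover have "\<not> (\<lambda>z::complex. z ^ e) constant_on UNIV"
    proof
      assume "(\<lambda>z::complex. z ^ e) constant_on UNIV"
      then obtain c where "\<And>z::complex. z ^ e = c" by (auto simp: constant_on_def)
      then have "(0::complex) ^ e = 1 ^ e" by simp
      then show False using e(1) by auto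
    qed
    ultimately have "open ((\<lambda>z. z ^ e) ` ?s ` B)"
      by (intro open_mapping_thm[of _ UNIV]) (auto intro!: holomorphic_intros)
    moreover have "?\<psi> ` U = (\<lambda>z. z ^ e) ` ?s ` B"
    proof -
      have UB: "U = F ` B" unfolding T(2) B_def by auto
      show ?thesis
        unfolding UB image_image by (rule image_cong[OF refl], rule \<psi>) (simp add: B_def)
    qed
    moreover have "?\<psi> ` U \<subseteq> ball 0 1" unfolding T(2) \<psi>_im[symmetric] by (rule image_mono) simp
    ultimately show "openin (top_of_set (ball 0 1)) (?\<psi> ` U)" by (simp only: open_subset)
  qed blast
qed

text \<open>
  The chart is \<open>x \<mapsto> ((x - p) / \<epsilon>)\<^sup>e\<close> read through \<open>F\<close>; away from \<open>p\<close> the map \<open>F\<close> is injective and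
  orientation preserving, and so is the chart.
\<close>

lemma disc_chart_oriented:
  assumes p: "isolating L p \<epsilon>"
  shows "oriented_disc two_sphere (F ` ball p \<epsilon>) (disc_chart L F p \<epsilon>)"
proof -
  define e where "e = ramification L p"
  have \<epsilon>: "0 < \<epsilon>" using p by (simp add: isolating_def)
  obtain \<psi>' where hom: "homeomorphism (F ` ball p \<epsilon>) (ball 0 1) (disc_chart L F p \<epsilon>) \<psi>'"
    using disc_chart_homeomorphism[OF p] by blast
  show ?thesis
  proof (rule oriented_disc_sphereI[OF open_map[OF open_ball] hom])
    fix y assume "y \<in> F ` ball p \<epsilon> - {F p}"
    then obtain x where "x \<in> ball p \<epsilon>" "y = F x" "F x \<noteq> F p" by (elim DiffE imageE) simp
    then have x: "x \<in> ball p \<epsilon>" "x \<noteq> p" "y = F x" by (simp, metis, simp)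
    then have xL: "x \<notin> L" using isolating_off[OF p] by blast
    obtain r where r: "isolating L x r" using isolating_exists by blast
    define s where "s = min r (\<epsilon> - dist p x)"
    have s: "0 < s" using r x(1) by (simp add: s_def isolating_def)
    have "isolating L x s" using isolating_smaller[OF r s] by (simp add: s_def)
    then have inj: "inj_on F (ball x s)" using isolating_inj_on xL by blast
    have sub: "ball x s \<subseteq> ball p \<epsilon>"
    proof
      fix z assume "z \<in> ball x s"
      then show "z \<in> ball p \<epsilon>" using dist_triangle[of p z x] by (simp add: s_def)
    qed
    have "positive_at (disc_chart L F p \<epsilon> \<circ> (F \<circ> vx)) (cx x)"
    proof (subst positive_at_cong)
      show "(disc_chart L F p \<epsilon> \<circ> (F \<circ> vx)) z = (of_real (1 / \<epsilon>) * (z - cx p)) ^ e"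
        if "z \<in> ball (cx x) s" for z
      proof -
        have "vx z \<in> ball x s" using that dist_cx[of x "vx z"] by simp
        then have "vx z \<in> ball p \<epsilon>" using sub by (rule rev_subsetD)
        then show ?thesis using disc_chart_eq[OF p, of "vx z"] by (simp add: e_def cx_diff)
      qed
      show "positive_at (\<lambda>z. (of_real (1 / \<epsilon>) * (z - cx p)) ^ e) (cx x)"
      proof (rule positive_at_holomorphic[of _ UNIV])
        have "((\<lambda>z. (c * (z - cx p)) ^ e) has_field_derivative
            of_nat e * (c * (cx x - cx p)) ^ (e - 1) * c) (at (cx x))" for c
          by (auto intro!: derivative_eq_intros simp: mult_ac)
        then have "deriv (\<lambda>z. (of_real (1 / \<epsilon>) * (z - cx p)) ^ e) (cx x) =
            of_nat e * (of_real (1 / \<epsilon>) * (cx x - cx p)) ^ (e - 1) * of_real (1 / \<epsilon>)"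
          by (rule DERIV_imp_deriv)
        moreover have "e \<noteq> 0" by (simp add: e_def ramification_def)
        ultimately show "deriv (\<lambda>z. (of_real (1 / \<epsilon>) * (z - cx p)) ^ e) (cx x) \<noteq> 0"
          using \<epsilon> x(2) by simp
      qed (auto intro!: holomorphic_intros)
    qed (use s in auto)
    moreover have "positive_sphere (F \<circ> vx) (cx x)" by (rule positive_off_lattice[OF xL])
    ultimately show "\<exists>B G z. open B \<and> z \<in> B \<and> continuous_on B G \<and> inj_on G B \<and> G z = y \<and>
        G ` B \<subseteq> F ` ball p \<epsilon> \<and> positive_sphere G z \<and> positive_at (disc_chart L F p \<epsilon> \<circ> G) z"
      using s sub x(3) cx_ball_read inj_on_vx[OF inj]
      by (intro exI[of _ "ball (cx x) s"] exI[of _ "F \<circ> vx"] exI[of _ "cx x"]) (auto simp: image_mono)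
  qed
qed

end

lemma homeomorphism_translation: "homeomorphism UNIV UNIV (\<lambda>x::'a::real_normed_vector. c + x) (\<lambda>x. x - c)"
  and homeomorphism_reflection: "homeomorphism UNIV UNIV (\<lambda>x::'a::real_normed_vector. c - x) (\<lambda>x. c - x)"
  by (rule homeomorphismI; (intro continuous_intros)?; simp)+

lemma (in lattice_fibres) disc_chart_translate:
  assumes p: "isolating L p \<epsilon>" and l: "l \<in> L" and x: "x \<in> ball (2 *\<^sub>R l + p) \<epsilon>"
  shows "disc_chart L F p \<epsilon> (F x) = (of_real (1 / \<epsilon>) * cx (x - (2 *\<^sub>R l + p))) ^ ramification L p"
proof -
  have x': "2 *\<^sub>R (- l) + x \<in> ball p \<epsilon>" using x by (simp add: dist_norm algebra_simps)
  have eq: "2 *\<^sub>R (- l) + x - p = x - (2 *\<^sub>R l + p)" by simp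
  show ?thesis using disc_chart_eq[OF p x'] unfolding eq fibre_plus[OF minus_mem[OF l]] .
qed

text \<open>Over a translated centre the chart is the same power of the translated coordinate; over
  a reflected centre \<open>2 l - p\<close> the coordinate changes sign. The sign \<open>s\<close>
  covers both cases.\<close>

lemma (in lattice_fibres) disc_chart_orbit:
  assumes p: "isolating L p \<epsilon>" and q: "F q = F p"
  obtains s :: real where "\<bar>s\<bar> = 1"
    "\<And>x. x \<in> ball q \<epsilon> \<Longrightarrow> disc_chart L F p \<epsilon> (F x) = (of_real (s / \<epsilon>) * cx (x - q)) ^ ramification L p"
proof -
  from q[symmetric] show thesis
  proof (cases rule: fibreE)
    fix l assume "l \<in> L" "q = 2 *\<^sub>R l + p"
    then show thesis using disc_chart_translate[OF p] by (intro that[of 1]) auto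
  next
    fix l assume l: "l \<in> L" "q = 2 *\<^sub>R l - p"
    show thesis
    proof (rule that[of "- 1"])
      fix x assume x: "x \<in> ball q \<epsilon>"
      have eq: "2 *\<^sub>R l - x - p = - (x - q)" unfolding l(2) by simp
      have pq: "p - (2 *\<^sub>R l - x) = x - q" unfolding l(2) by simp
      have x': "2 *\<^sub>R l - x \<in> ball p \<epsilon>"
        using x unfolding mem_ball dist_norm norm_minus_commute[of q] pq .
      show "disc_chart L F p \<epsilon> (F x) = (of_real (- 1 / \<epsilon>) * cx (x - q)) ^ ramification L p"
        using disc_chart_eq[OF p x'] unfolding eq cx_minus fibre_minus[OF l(1)] by simp
    qed simp
  qed
qed

lemma (in lattice_fibres) disc_chart_center:
  assumes "isolating L p \<epsilon>" shows "disc_chart L F p \<epsilon> (F p) = 0"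
proof -
  have "p \<in> ball p \<epsilon>" using assms by (simp add: isolating_def)
  then show ?thesis using disc_chart_eq[OF assms] by (simp add: ramification_def)
qed

text \<open>The image of the complement of \<open>L\<close> is connected and countable, so it is one
  point. That complement meets every nonempty open set, so continuity extends the value to
  \<open>L\<close>.\<close>

lemma constant_off_countable:
  fixes h :: "'a::euclidean_space \<Rightarrow> 'b::euclidean_space"
  assumes L: "countable L" "2 \<le> DIM('a)" and M: "countable M" and cont: "continuous_on UNIV h"
    and into: "h ` (- L) \<subseteq> M"
  obtains c where "\<And>x. h x = c" "c \<in> M"
proof -
  have "connected (- L)"
    using path_connected_complement_countable[OF L(2,1)] path_connected_imp_connected by blast
  then have "connected (h ` (- L))"
    by (rule connected_continuous_image[OF continuous_on_subset[OF cont], rotated]) simp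
  then have const: "h x = h y" if "x \<notin> L" "y \<notin> L" for x y
    using connected_uncountable[of "h ` (- L)" "h x" "h y"] countable_subset[OF into M] that by blast
  have off: "\<exists>x \<in> U. x \<notin> L" if U: "open U" "U \<noteq> {}" for U
  proof (rule ccontr)
    assume no: "\<not> (\<exists>x \<in> U. x \<notin> L)"
    obtain x where "x \<in> U" using U(2) by blast
    then obtain e where "e > 0" "ball x e \<subseteq> U" using U(1) open_contains_ball by blast
    then have "ball x e \<subseteq> L" using no by blast
    then show False using \<open>e > 0\<close> uncountable_ball[of e x] countable_subset[OF _ L(1)] by blast
  qed
  obtain a where a: "a \<notin> L" using off[of UNIV] by auto
  have "h x = h a" for x
  proof (rule ccontr)
    assume ne: "h x \<noteq> h a"
    have "open (h -` (- {h a}))" using cont by (intro open_vimage) auto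
    moreover have "x \<in> h -` (- {h a})" using ne by simp
    ultimately obtain y where "y \<in> h -` (- {h a})" "y \<notin> L" using off by blast
    then show False using const[OF \<open>y \<notin> L\<close> a] by simp
  qed
  then show thesis using that into a by blast
qed

section \<open>Covering structure and deck group of the quotient map\<close>

context lattice_quotient begin

lemma branched_covering: "branched_covering plane two_sphere F"
  unfolding branched_covering_def points_plane points_two_sphere
proof (intro conjI ballI)
  fix y assume "y \<in> S2"
  then obtain p where p: "y = F p" unfolding range[symmetric] by (elim rangeE)
  obtain \<epsilon> where \<epsilon>: "isolating L p \<epsilon>" using isolating_exists by blast
  then have \<epsilon>0: "0 < \<epsilon>" by (simp add: isolating_def)
  define \<U> where "\<U> = (\<lambda>q. ball q \<epsilon>) ` {q. F q = F p}"
  show "\<exists>V \<psi> \<U>. y \<in> V \<and> oriented_disc two_sphere V \<psi> \<and> \<psi> y = 0 \<and> pairwise disjnt \<U> \<and>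
      \<Union> \<U> = {x \<in> UNIV. F x \<in> V} \<and>
      (\<forall>U\<in>\<U>. \<exists>\<phi> d. 1 \<le> d \<and> oriented_disc plane U \<phi> \<and> (\<forall>x\<in>U. \<psi> (F x) = \<phi> x ^ d))"
  proof (rule exI[of _ "F ` ball p \<epsilon>"], rule exI[of _ "disc_chart L F p \<epsilon>"], rule exI[of _ \<U>], intro conjI ballI)
    show "y \<in> F ` ball p \<epsilon>" using p \<epsilon>0 by simp
    show "oriented_disc two_sphere (F ` ball p \<epsilon>) (disc_chart L F p \<epsilon>)"
      by (rule disc_chart_oriented[OF \<epsilon>])
    show "disc_chart L F p \<epsilon> y = 0" unfolding p by (rule disc_chart_center[OF \<epsilon>])
    show "\<Union> \<U> = {x \<in> UNIV. F x \<in> F ` ball p \<epsilon>}"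
      using fibre_ball by (simp add: \<U>_def)
    show "pairwise disjnt \<U>"
    proof (rule pairwiseI)
      fix U U' assume U: "U \<in> \<U>" "U' \<in> \<U>" "U \<noteq> U'"
      then obtain q q' where q: "U = ball q \<epsilon>" "F q = F p" "U' = ball q' \<epsilon>" "F q' = F p" by (auto simp: \<U>_def)
      have iso: "isolating L q \<epsilon>" using isolating_orbit[OF \<epsilon> q(2)] .
      have "F q' = F q" using q by simp
      from isolating_overlap[OF iso this] show "disjnt U U'"
        using U(3) q unfolding disjnt_iff by metis
    qed
    fix U assume "U \<in> \<U>"
    then obtain q where q: "U = ball q \<epsilon>" "F q = F p" by (auto simp: \<U>_def)
    obtain s :: real where s: "\<bar>s\<bar> = 1"
      "\<And>x. x \<in> ball q \<epsilon> \<Longrightarrow> disc_chart L F p \<epsilon> (F x) = (of_real (s / \<epsilon>) * cx (x - q)) ^ ramification L p"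
      using disc_chart_orbit[OF \<epsilon> q(2)] by metis
    show "\<exists>\<phi> d. 1 \<le> d \<and> oriented_disc plane U \<phi> \<and> (\<forall>x\<in>U. disc_chart L F p \<epsilon> (F x) = \<phi> x ^ d)"
      unfolding q(1) using oriented_disc_plane[OF s(1) \<epsilon>0] s(2)
      by (intro exI[of _ "\<lambda>x. of_real (s / \<epsilon>) * cx (x - q)"] exI[of _ "ramification L p"])
         (simp add: ramification_def)
  qed
qed (use cont range in auto)

lemma translation_deck: "l \<in> L \<Longrightarrow> (\<lambda>x. 2 *\<^sub>R l + x) \<in> deck_group F"
  and reflection_deck: "l \<in> L \<Longrightarrow> (\<lambda>x. 2 *\<^sub>R l - x) \<in> deck_group F"
  unfolding deck_group_def comp_def
  using homeomorphism_translation homeomorphism_reflection fibre_plus fibre_minus by auto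

text \<open>A homeomorphism over \<open>F\<close> is pointwise of the form \<open>2 l + x\<close> or
  \<open>2 l - x\<close>. Connectedness of the complement of \<open>L\<close> fixes the sign
  globally, and then \<open>l\<close> depends continuously on \<open>x\<close> with values in a
  countable set, so it is constant.\<close>

lemma deck_group: "deck_group F = (\<Union>l \<in> L. {\<lambda>x. 2 *\<^sub>R l + x, \<lambda>x. 2 *\<^sub>R l - x})"
proof (intro subset_antisym subsetI)
  fix g assume "g \<in> deck_group F"
  then obtain g' where g': "homeomorphism UNIV UNIV g g'" and "F \<circ> g = F"
    unfolding deck_group_def by blast
  then have Fg: "F x = F (g x)" for x by (metis comp_apply)
  have g: "continuous_on UNIV g" using g' by (rule homeomorphism_cont1)
  \<comment> \<open>\<open>h (- 1) x\<close> recovers \<open>l\<close> from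
    \<open>g x = 2 l + x\<close>, and \<open>h 1 x\<close> recovers it from
    \<open>g x = 2 l - x\<close>. Their difference is \<open>x\<close>, so off the lattice exactly
    one of them is a lattice point.\<close>
  define h where "h s x = (1 / 2) *\<^sub>R (g x + s *\<^sub>R x)" for s :: real and x
  have h: "continuous_on UNIV (h s)" for s unfolding h_def by (intro continuous_intros g)
  have alt: "h (- 1) x \<in> L \<or> h 1 x \<in> L" for x
    using Fg[of x]
  proof (cases rule: fibreE)
    fix l assume "l \<in> L" "g x = 2 *\<^sub>R l + x"
    then show ?thesis by (simp add: h_def)
  next
    fix l assume "l \<in> L" "g x = 2 *\<^sub>R l - x"
    then show ?thesis by (simp add: h_def)
  qed
  have both: "x \<in> L" if "h (- 1) x \<in> L" "h 1 x \<in> L" for x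
  proof -
    have "x = h 1 x - h (- 1) x" by (simp add: h_def vec_eq_iff field_simps)
    then show ?thesis using diff_mem[OF that(2,1)] by simp
  qed
  have cl: "closed (h s -` L)" for s by (rule closed_vimage[OF closed_lattice h])
  have con: "connected (- L)" by (rule connected_off_lattice)
  have cover: "- L \<subseteq> h (- 1) -` L \<union> h 1 -` L" using alt by blast
  have disj: "h (- 1) -` L \<inter> h 1 -` L \<inter> - L = {}" using both by blast
  have "h (- 1) -` L \<inter> - L = {} \<or> h 1 -` L \<inter> - L = {}"
    using con cl[of "- 1"] cl[of 1] cover disj unfolding connected_closed by blast
  then obtain s where s: "s = -1 \<or> s = 1" "h s ` (- L) \<subseteq> L"
    using alt by blast
  obtain c where c: "\<And>x. h s x = c" "c \<in> L"
    by (rule constant_off_countable[OF countable _ countable h s(2)]) auto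
  have "g x = 2 *\<^sub>R c - s *\<^sub>R x" for x
    using c(1)[of x] by (auto simp: h_def vec_eq_iff field_simps)
  then have "g = (\<lambda>x. 2 *\<^sub>R c + x) \<or> g = (\<lambda>x. 2 *\<^sub>R c - x)" using s(1) by auto
  then show "g \<in> (\<Union>l \<in> L. {\<lambda>x. 2 *\<^sub>R l + x, \<lambda>x. 2 *\<^sub>R l - x})" using c(2) by blast
qed (use translation_deck reflection_deck in blast)

lemma lattice_covering: "lattice_covering L F"
  unfolding lattice_covering_def normal_covering_def
proof (intro conjI allI impI branched_covering deck_group)
  fix x y assume "F x = F y"
  then show "\<exists>g \<in> deck_group F. g x = y"
    by (cases rule: fibreE) (metis translation_deck, metis reflection_deck)
qed

end

section \<open>Maps between two quotients\<close>

lemma homeomorphism_inj_on: "homeomorphism S T f g \<Longrightarrow> inj_on f S"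
  by (rule inj_on_inverseI[where g = g]) (rule homeomorphism_apply1)

text \<open>Points near \<open>x\<close> with a common value of \<open>f\<close> are counted: the
  form with exponent \<open>d\<close> gives \<open>d\<close> of them on a small coordinate circle,
  while the form with exponent \<open>d'\<close> allows at most \<open>d'\<close>. By symmetry the
  exponent in \<open>local_degree\<close> is unique.\<close>

lemma root_count_le:
  fixes \<phi> \<phi>' :: "'a::topological_space \<Rightarrow> complex" and \<psi> \<psi>' :: "'b::topological_space \<Rightarrow> complex"
  assumes U: "x \<in> U" "oriented_disc A U \<phi>" "\<phi> x = 0" "oriented_disc B V \<psi>" "f ` U \<subseteq> V"
      "\<And>u. u \<in> U \<Longrightarrow> \<psi> (f u) = \<phi> u ^ d" "d \<ge> 1"
    and U': "x \<in> U'" "oriented_disc A U' \<phi>'" "\<And>u. u \<in> U' \<Longrightarrow> \<psi>' (f u) = \<phi>' u ^ d'" "d' \<ge> 1"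
  shows "d \<le> d'"
proof -
  obtain \<theta> where \<theta>: "homeomorphism U (ball 0 1) \<phi> \<theta>" "openin (top_of_set (points A)) U"
    using U(2) unfolding oriented_disc_def by blast
  obtain \<theta>' where \<theta>': "homeomorphism U' (ball 0 1) \<phi>' \<theta>'" "openin (top_of_set (points A)) U'"
    using U'(2) unfolding oriented_disc_def by blast
  obtain \<eta> where \<eta>: "homeomorphism V (ball 0 1) \<psi> \<eta>"
    using U(4) unfolding oriented_disc_def by blast
  have inj': "inj_on \<phi>' U'" using \<theta>'(1) by (rule homeomorphism_inj_on)
  have inj\<psi>: "inj_on \<psi> V" using \<eta> by (rule homeomorphism_inj_on)
  obtain T where T: "open T" "U' = points A \<inter> T" using \<theta>'(2) by (auto simp: openin_open)
  have "U \<inter> U' = U \<inter> T" using openin_imp_subset[OF \<theta>(2)] T(2) by blast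
  then have "openin (top_of_set U) (U \<inter> U')" using T(1) by (auto simp: openin_open)
  then have "openin (top_of_set (ball 0 1)) (\<phi> ` (U \<inter> U'))"
    using \<theta>(1) homeomorphism_imp_open_map by blast
  then have "open (\<phi> ` (U \<inter> U'))" by (simp add: openin_open_eq)
  moreover have "0 \<in> \<phi> ` (U \<inter> U')" using U(1,3) U'(1) by (metis IntI imageI)
  ultimately obtain \<rho> where \<rho>: "\<rho> > 0" "cball 0 \<rho> \<subseteq> \<phi> ` (U \<inter> U')"
    using open_contains_cball by blast
  \<comment> \<open>All \<open>d\<close>-th roots of \<open>w ^ d\<close> have modulus
    \<open>\<rho>\<close>, so they lie in the coordinate image of the overlap of the two
    discs.\<close>
  define w where "w = complex_of_real \<rho>"
  define Z where "Z = {z. z ^ d = w ^ d}"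
  have cZ: "card Z = d" unfolding Z_def by (rule card_nth_roots) (use \<rho> U(7) in \<open>auto simp: w_def\<close>)
  have "Z \<subseteq> \<phi> ` (U \<inter> U')"
  proof
    fix z assume "z \<in> Z"
    then have "norm z ^ d = norm w ^ d" unfolding Z_def mem_Collect_eq norm_power[symmetric] by simp
    then have "norm z = norm w"
      by (rule power_eq_imp_eq_base) (use U(7) in auto)
    then show "z \<in> \<phi> ` (U \<inter> U')" using \<rho> by (auto simp: w_def)
  qed
  then obtain S where S: "S \<subseteq> U \<inter> U'" "inj_on \<phi> S" "\<phi> ` S = Z"
    unfolding subset_image_inj by blast
  have "card S = d" using card_image[OF S(2)] unfolding S(3) cZ by simp
  then have "S \<noteq> {}" using U(7) by auto
  then obtain u0 where u0: "u0 \<in> S" by blast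
  define c where "c = \<phi>' u0 ^ d'"
  have "\<phi>' ` S \<subseteq> {z. z ^ d' = c}"
  proof safe
    fix u assume u: "u \<in> S"
    have "\<phi> u ^ d = w ^ d" if "u \<in> S" for u using S(3) that unfolding Z_def by blast
    then have "\<phi> u ^ d = \<phi> u0 ^ d" using u u0 by simp
    moreover have uU: "u \<in> U" "u0 \<in> U" using u u0 S(1) by auto
    ultimately have "\<psi> (f u) = \<psi> (f u0)" using U(6)[OF uU(1)] U(6)[OF uU(2)] by simp
    then have "f u = f u0" by (rule inj_onD[OF inj\<psi>]) (use U(5) uU in auto)
    moreover have "u \<in> U'" "u0 \<in> U'" using u u0 S(1) by auto
    ultimately show "\<phi>' u ^ d' = c" unfolding c_def using U'(3)[of u] U'(3)[of u0] by simp
  qed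
  moreover have "finite {z. z ^ d' = c} \<and> card {z. z ^ d' = c} \<le> d'"
  proof (cases "c = 0")
    case True
    then have "{z. z ^ d' = c} = {0}" using U'(4) by auto
    then show ?thesis using U'(4) by simp
  next
    case False
    then show ?thesis using card_nth_roots[of c d'] finite_nth_roots[of d' c] U'(4) by auto
  qed
  ultimately have "card (\<phi>' ` S) \<le> d'" using card_mono[of "{z. z ^ d' = c}" "\<phi>' ` S"] by linarith
  moreover have "inj_on \<phi>' S" using S(1) by (intro inj_on_subset[OF inj']) auto
  then have "card (\<phi>' ` S) = d" using \<open>card S = d\<close> by (simp add: card_image)
  ultimately show ?thesis by simp
qed

lemma local_degree_eqI:
  assumes "x \<in> U" "oriented_disc A U \<phi>" "\<phi> x = 0" "oriented_disc B V \<psi>" "f ` U \<subseteq> V"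
      "\<And>u. u \<in> U \<Longrightarrow> \<psi> (f u) = \<phi> u ^ d" "d \<ge> 1"
  shows "local_degree A B f x = d"
  unfolding local_degree_def
proof (rule the_equality)
  have "\<psi> (f x) = 0" using assms by simp
  then show "d \<ge> 1 \<and> (\<exists>U \<phi> V \<psi>. x \<in> U \<and> oriented_disc A U \<phi> \<and> \<phi> x = 0 \<and>
     f x \<in> V \<and> oriented_disc B V \<psi> \<and> \<psi> (f x) = 0 \<and> f ` U \<subseteq> V \<and> (\<forall>u \<in> U. \<psi> (f u) = \<phi> u ^ d))"
    using assms by (intro conjI exI[of _ U] exI[of _ \<phi>] exI[of _ V] exI[of _ \<psi>]) auto
next
  fix d' assume "d' \<ge> 1 \<and> (\<exists>U \<phi> V \<psi>. x \<in> U \<and> oriented_disc A U \<phi> \<and> \<phi> x = 0 \<and>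
     f x \<in> V \<and> oriented_disc B V \<psi> \<and> \<psi> (f x) = 0 \<and> f ` U \<subseteq> V \<and> (\<forall>u \<in> U. \<psi> (f u) = \<phi> u ^ d'))"
  then obtain U' \<phi>' V' \<psi>' where *: "x \<in> U'" "oriented_disc A U' \<phi>'" "\<phi>' x = 0" "oriented_disc B V' \<psi>'"
    "f ` U' \<subseteq> V'" "\<forall>u \<in> U'. \<psi>' (f u) = \<phi>' u ^ d'" "d' \<ge> 1" by blast
  then have *: "x \<in> U'" "oriented_disc A U' \<phi>'" "\<phi>' x = 0" "oriented_disc B V' \<psi>'"
    "f ` U' \<subseteq> V'" "\<And>u. u \<in> U' \<Longrightarrow> \<psi>' (f u) = \<phi>' u ^ d'" "d' \<ge> 1" by auto
  show "d' = d"
    using root_count_le[OF *(1-7) assms(1,2,6,7)] root_count_le[OF assms *(1,2,6,7)] by simp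
qed

text \<open>The transversal \<open>R\<close> stands for the quotient of \<open>L2\<close> by
  \<open>L1\<close>; its cardinality will be the degree of \<open>f\<close>.\<close>

locale fibre_pair = A1: lattice_fibres L1 F1 + A2: lattice_fibres L2 F2
  for L1 F1 L2 F2 +
  fixes f :: "real^3 \<Rightarrow> real^3" and R :: "(real^2) set"
  assumes sub: "L1 \<subseteq> L2" and comp: "f \<circ> F1 = F2"
    and transversal: "finite R" "R \<subseteq> L2" "\<And>l. l \<in> L2 \<Longrightarrow> \<exists>!r. r \<in> R \<and> l - r \<in> L1"
begin

lemma f_F1: "f (F1 x) = F2 x"
  using comp by (metis comp_apply)

lemma F2_cong: "F1 x = F1 y \<Longrightarrow> F2 x = F2 y"
  using f_F1[of x] f_F1[of y] by simp

lemma transversal_eq: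
  assumes "r \<in> R" "r' \<in> R" "r - r' \<in> L1" shows "r = r'"
proof -
  have "r \<in> L2" "r - r \<in> L1" using assms(1) transversal(2) A1.zero_mem by auto
  then show ?thesis using transversal(3)[of r] assms by blast
qed

text \<open>A point over \<open>F2 p\<close> is \<open>F1 q\<close> with \<open>q = 2 l + p\<close>
  or \<open>q = 2 l - p\<close>. Evenness of \<open>F1\<close> turns the second form into the first,
  and translations by doubled vectors of \<open>L1\<close> reduce \<open>l\<close> to the
  transversal.\<close>

lemma fibre_image: "{z \<in> range F1. f z = F2 p} = (\<lambda>r. F1 (2 *\<^sub>R r + p)) ` R"
proof (intro subset_antisym subsetI)
  fix z assume "z \<in> {z \<in> range F1. f z = F2 p}"
  then obtain q where q: "z = F1 q" "F2 p = F2 q" using f_F1 by auto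
  have mem: "F1 (2 *\<^sub>R l + p) \<in> (\<lambda>r. F1 (2 *\<^sub>R r + p)) ` R" if l: "l \<in> L2" for l
  proof -
    obtain r where r: "r \<in> R" "l - r \<in> L1" using transversal(3)[OF l] by blast
    have eq: "2 *\<^sub>R (l - r) + (2 *\<^sub>R r + p) = 2 *\<^sub>R l + p" by (simp add: algebra_simps)
    have "F1 (2 *\<^sub>R l + p) = F1 (2 *\<^sub>R r + p)"
      using A1.fibre_plus[OF r(2), of "2 *\<^sub>R r + p"] unfolding eq .
    then show ?thesis using r(1) by (rule image_eqI)
  qed
  from q(2) show "z \<in> (\<lambda>r. F1 (2 *\<^sub>R r + p)) ` R"
  proof (cases rule: A2.fibreE)
    fix l assume l: "l \<in> L2" "q = 2 *\<^sub>R l - p"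
    have eq: "2 *\<^sub>R 0 - q = 2 *\<^sub>R (- l) + p" unfolding l(2) by simp
    show ?thesis
      using mem[OF A2.minus_mem[OF l(1)]] A1.fibre_minus[OF A1.zero_mem, of q]
      unfolding eq q(1) by (simp only:)
  next
    fix l assume "l \<in> L2" "q = 2 *\<^sub>R l + p"
    then show ?thesis using mem[of l] unfolding q(1) by (simp only:)
  qed
next
  fix z assume "z \<in> (\<lambda>r. F1 (2 *\<^sub>R r + p)) ` R"
  then obtain r where r: "r \<in> R" "z = F1 (2 *\<^sub>R r + p)" by blast
  have "r \<in> L2" using r(1) transversal(2) by blast
  then show "z \<in> {z \<in> range F1. f z = F2 p}" using r(2) f_F1 A2.fibre_plus by auto
qed

lemma finite_fibre: "finite {z \<in> range F1. f z = F2 p}"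
  unfolding fibre_image using transversal(1) by simp

text \<open>Representatives \<open>r\<close> and \<open>r'\<close> give the same point iff
  \<open>r' = r\<close> or \<open>r' + r + p\<close> lies in \<open>L1\<close>. The second condition
  is possible only for \<open>p\<close> in \<open>L2\<close>; then exactly one \<open>r'\<close>
  satisfies it, and this is \<open>r\<close> itself precisely when \<open>2 r + p\<close> lies in
  \<open>L1\<close>.\<close>

lemma card_fibre_transversal:
  assumes r: "r \<in> R"
  shows "card {r' \<in> R. F1 (2 *\<^sub>R r' + p) = F1 (2 *\<^sub>R r + p)} =
    ramification L2 (2 *\<^sub>R r + p) div ramification L1 (2 *\<^sub>R r + p)" (is "card ?S = _")
proof -
  define q where "q = 2 *\<^sub>R r + p"
  have rL: "r \<in> L2" using r transversal(2) by blast
  have qp: "q \<in> L2 \<longleftrightarrow> p \<in> L2"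
    unfolding q_def by (rule A2.translate_mem_iff[OF A2.double_mem[OF rL]])
  have alt: "r' = r \<or> r' + (r + p) \<in> L1" if r': "r' \<in> R" "F1 (2 *\<^sub>R r' + p) = F1 q" for r'
    using r'(2)
  proof (cases rule: A1.fibreE)
    fix l assume l: "l \<in> L1" "q = 2 *\<^sub>R l + (2 *\<^sub>R r' + p)"
    then have "2 *\<^sub>R (r - r') = 2 *\<^sub>R l" by (simp add: q_def algebra_simps)
    then have "r - r' = l" by simp
    then show ?thesis using transversal_eq[OF r r'(1)] l(1) by simp
  next
    fix l assume l: "l \<in> L1" "q = 2 *\<^sub>R l - (2 *\<^sub>R r' + p)"
    then have "2 *\<^sub>R (r' + (r + p)) = 2 *\<^sub>R l" by (simp add: q_def vec_eq_iff algebra_simps)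
    then have "r' + (r + p) = l" by simp
    then show ?thesis using l(1) by simp
  qed
  show ?thesis unfolding q_def[symmetric]
  proof (cases "p \<in> L2 \<and> q \<notin> L1")
    case True
    have "- (r + p) \<in> L2" using True rL A2.add_mem A2.minus_mem by blast
    then obtain s where s: "s \<in> R" "- (r + p) - s \<in> L1" using transversal(3) by blast
    have eq': "- (- (r + p) - s) = s + (r + p)" by simp
    have s': "s + (r + p) \<in> L1" using A1.minus_mem[OF s(2)] unfolding eq' .
    have "s \<noteq> r"
    proof
      assume "s = r"
      then have "q = s + (r + p)" by (simp add: q_def vec_eq_iff)
      then have "q \<in> L1" using s' by simp
      then show False using True by simp
    qed
    have eq: "2 *\<^sub>R (s + (r + p)) - q = 2 *\<^sub>R s + p" by (simp add: q_def vec_eq_iff algebra_simps)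
    have "F1 (2 *\<^sub>R s + p) = F1 q" using A1.fibre_minus[OF s', of q] unfolding eq .
    moreover have "r' = s" if "r' \<in> R" "r' + (r + p) \<in> L1" for r'
    proof -
      have "r' - s = (r' + (r + p)) - (s + (r + p))" by simp
      then have "r' - s \<in> L1" using A1.diff_mem[OF that(2) s'] by simp
      then show ?thesis using transversal_eq[OF that(1) s(1)] by simp
    qed
    ultimately have "{r' \<in> R. F1 (2 *\<^sub>R r' + p) = F1 q} = {r, s}"
      using alt r s(1) by (auto simp: q_def)
    then show "card {r' \<in> R. F1 (2 *\<^sub>R r' + p) = F1 q} = ramification L2 q div ramification L1 q"
      using \<open>s \<noteq> r\<close> True qp by (simp add: ramification_def)
  next
    case False
    have "r' = r" if r': "r' \<in> R" "r' + (r + p) \<in> L1" for r'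
    proof -
      have "r' \<in> L2" using r' transversal(2) by blast
      have "p = (r' + (r + p)) - (r' + r)" by simp
      then have "p \<in> L2"
        using A2.diff_mem[OF subsetD[OF sub r'(2)] A2.add_mem[OF \<open>r' \<in> L2\<close> rL]] by (simp only:)
      then have "q \<in> L1" using False by blast
      have eq: "(r' + (r + p)) - q = r' - r" by (simp add: q_def vec_eq_iff)
      have "r' - r \<in> L1" using A1.diff_mem[OF r'(2) \<open>q \<in> L1\<close>] unfolding eq .
      then show ?thesis using transversal_eq[OF r'(1) r] by simp
    qed
    then have "{r' \<in> R. F1 (2 *\<^sub>R r' + p) = F1 q} = {r}"
      using alt r by (auto simp: q_def)
    moreover have "ramification L2 q div ramification L1 q = 1"
      using False qp sub by (auto simp: ramification_def)
    ultimately show "card {r' \<in> R. F1 (2 *\<^sub>R r' + p) = F1 q} = ramification L2 q div ramification L1 q"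
      by simp
  qed
qed

text \<open>The weight \<open>D\<close> is left abstract: it becomes the topological local degree
  for the constructed map, and a combinatorial function where only the orbits are known.\<close>

lemma weighted_fibre_count:
  assumes D: "\<And>q. D (F1 q) = ramification L2 q div ramification L1 q"
  shows "(\<Sum>z \<in> {z \<in> range F1. f z = F2 p}. D z) = card R"
proof -
  let ?g = "\<lambda>r. F1 (2 *\<^sub>R r + p)"
  have "card R = (\<Sum>z \<in> ?g ` R. \<Sum>r' \<in> {r' \<in> R. ?g r' = z}. 1)"
    unfolding card_eq_sum by (rule sum.image_gen[OF transversal(1)])
  also have "\<dots> = (\<Sum>z \<in> ?g ` R. D z)"
  proof (rule sum.cong[OF refl])
    fix z assume "z \<in> ?g ` R"
    then obtain r where r: "r \<in> R" "z = ?g r" by blast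
    show "(\<Sum>r' \<in> {r' \<in> R. ?g r' = z}. 1) = D z"
      unfolding r(2) D card_fibre_transversal[OF r(1), symmetric] by simp
  qed
  finally show ?thesis unfolding fibre_image by simp
qed

lemma F1_mem_critical: "F1 q \<in> F1 ` (L2 - L1) \<longleftrightarrow> q \<in> L2 - L1"
proof
  assume "F1 q \<in> F1 ` (L2 - L1)"
  then obtain q' where "F1 q = F1 q'" "q' \<in> L2 - L1" by blast
  then show "q \<in> L2 - L1" using A1.fibre_mem_iff[of q q'] A2.fibre_mem_iff[OF F2_cong, of q q'] by simp
qed simp

lemma F1_mem_noncritical: "F1 q \<in> F1 ` L1 \<longleftrightarrow> q \<in> L1"
  using A1.fibre_mem_iff by blast

text \<open>Over a point of the image of \<open>L2\<close> the whole fibre comes from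
  \<open>L2\<close>, where the ramification quotient is 2 off \<open>L1\<close> and 1 on
  \<open>L1\<close>.\<close>

lemma critical_fibre_count:
  assumes p: "p \<in> L2"
  shows "2 * card {z \<in> F1 ` (L2 - L1). f z = F2 p} + card {z \<in> F1 ` L1. f z = F2 p} = card R"
proof -
  let ?C = "{z \<in> F1 ` (L2 - L1). f z = F2 p}" and ?N = "{z \<in> F1 ` L1. f z = F2 p}"
  define D where "D z = (if z \<in> F1 ` (L2 - L1) then 2 else 1 :: nat)" for z
  have D: "D (F1 q) = ramification L2 q div ramification L1 q" for q
    using sub unfolding D_def F1_mem_critical by (auto simp: ramification_def)
  have split: "{z \<in> range F1. f z = F2 p} = ?C \<union> ?N"
  proof (intro subset_antisym subsetI)
    fix z assume "z \<in> {z \<in> range F1. f z = F2 p}"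
    then obtain q where q: "z = F1 q" "F2 q = F2 p" using f_F1 by auto
    then have "q \<in> L2" using A2.fibre_mem_iff p by blast
    then show "z \<in> ?C \<union> ?N" using q f_F1 by auto
  qed auto
  have disj: "?C \<inter> ?N = {}" using F1_mem_critical F1_mem_noncritical by auto
  have fin: "finite ?C" "finite ?N" using finite_fibre[of p] unfolding split by auto
  have "card R = (\<Sum>z \<in> ?C. D z) + (\<Sum>z \<in> ?N. D z)"
    unfolding weighted_fibre_count[OF D, of p, symmetric] split by (rule sum.union_disjoint[OF fin disj])
  moreover have "(\<Sum>z \<in> ?C. D z) = 2 * card ?C" by (simp add: D_def)
  moreover have "(\<Sum>z \<in> ?N. D z) = (\<Sum>z \<in> ?N. 1)"
    by (rule sum.cong[OF refl]) (use F1_mem_critical in \<open>auto simp: D_def\<close>)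
  ultimately show ?thesis by simp
qed

end

section \<open>Local degrees and covering structure of the map between two quotients\<close>

locale lattice_pair = fibre_pair L1 F1 L2 F2 f R + Q1: lattice_quotient L1 F1 + Q2: lattice_quotient L2 F2
  for L1 F1 L2 F2 f R
begin

lemma ramification_div:
  "ramification L1 q * (ramification L2 q div ramification L1 q) = ramification L2 q"
  "1 \<le> ramification L2 q div ramification L1 q"
  using sub by (auto simp: ramification_def)

lemma isolating_L1: "isolating L2 p \<epsilon> \<Longrightarrow> isolating L1 p \<epsilon>"
  using isolating_subset sub by blast

text \<open>On the image of one ball both charts are powers of the same scaled coordinate
  \<open>(x - q) / \<epsilon>\<close>, with the two ramification numbers as exponents. So
  \<open>f\<close> is the power map with their quotient.\<close>

lemma sphere_degree_F1: "sphere_degree f (F1 q) = ramification L2 q div ramification L1 q"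
proof -
  obtain \<epsilon> where \<epsilon>: "isolating L2 q \<epsilon>" using Q2.isolating_exists by blast
  note \<epsilon>1 = isolating_L1[OF \<epsilon>]
  show ?thesis
  proof (rule local_degree_eqI)
    show "F1 q \<in> F1 ` ball q \<epsilon>" using \<epsilon> by (simp add: isolating_def)
    show "oriented_disc two_sphere (F1 ` ball q \<epsilon>) (disc_chart L1 F1 q \<epsilon>)" by (rule Q1.disc_chart_oriented[OF \<epsilon>1])
    show "disc_chart L1 F1 q \<epsilon> (F1 q) = 0" by (rule A1.disc_chart_center[OF \<epsilon>1])
    show "oriented_disc two_sphere (F2 ` ball q \<epsilon>) (disc_chart L2 F2 q \<epsilon>)" by (rule Q2.disc_chart_oriented[OF \<epsilon>])
    show "f ` F1 ` ball q \<epsilon> \<subseteq> F2 ` ball q \<epsilon>" unfolding image_image f_F1 by simp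
    fix u assume "u \<in> F1 ` ball q \<epsilon>"
    then obtain x where x: "x \<in> ball q \<epsilon>" "u = F1 x" by blast
    show "disc_chart L2 F2 q \<epsilon> (f u) = disc_chart L1 F1 q \<epsilon> u ^ (ramification L2 q div ramification L1 q)"
      unfolding x(2) f_F1 A1.disc_chart_eq[OF \<epsilon>1 x(1)] A2.disc_chart_eq[OF \<epsilon> x(1)]
        power_mult[symmetric] ramification_div(1) ..
  qed (rule ramification_div(2))
qed

lemma branched_covering: "branched_covering two_sphere two_sphere f"
  unfolding branched_covering_def points_two_sphere
proof (intro conjI ballI)
  show "continuous_on S2 f"
    unfolding continuous_openin_preimage_eq
  proof (intro allI impI)
    fix T :: "(real^3) set" assume "open T"
    then have "open (F2 -` T)" using Q2.cont by (intro open_vimage)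
    then have "openin (top_of_set S2) (F1 ` (F2 -` T))" by (rule Q1.open_map)
    moreover have "S2 \<inter> f -` T = F1 ` (F2 -` T)"
    proof (intro subset_antisym subsetI)
      fix z assume z: "z \<in> S2 \<inter> f -` T"
      then have "z \<in> range F1" unfolding Q1.range by simp
      then obtain x where "z = F1 x" by blast
      then show "z \<in> F1 ` (F2 -` T)" using z f_F1[of x] by simp
    next
      fix z assume "z \<in> F1 ` (F2 -` T)"
      then obtain x where "z = F1 x" "F2 x \<in> T" by blast
      moreover have "F1 x \<in> S2" unfolding Q1.range[symmetric] by simp
      ultimately show "z \<in> S2 \<inter> f -` T" using f_F1[of x] by simp
    qed
    ultimately show "openin (top_of_set S2) (S2 \<inter> f -` T)" by simp
  qed
  show "f ` S2 = S2"
    unfolding Q1.range[symmetric] image_image f_F1 Q2.range ..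
  fix y assume "y \<in> S2"
  then obtain p where p: "y = F2 p" unfolding Q2.range[symmetric] by (elim rangeE)
  obtain \<epsilon> where \<epsilon>: "isolating L2 p \<epsilon>" using Q2.isolating_exists by blast
  \<comment> \<open>Translates of \<open>p\<close> are enough: \<open>F1\<close> is even, so the
    ball about \<open>2 l - p\<close> has the same image as the ball about
    \<open>2 (- l) + p\<close>.\<close>
  define \<U> where "\<U> = (\<lambda>l. F1 ` ball (2 *\<^sub>R l + p) \<epsilon>) ` L2"
  have iso: "isolating L2 (2 *\<^sub>R l + p) \<epsilon>" if "l \<in> L2" for l
    by (rule A2.isolating_orbit[OF \<epsilon> A2.fibre_plus[OF that]])
  show "\<exists>V \<psi> \<U>. y \<in> V \<and> oriented_disc two_sphere V \<psi> \<and> \<psi> y = 0 \<and> pairwise disjnt \<U> \<and>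
      \<Union> \<U> = {x \<in> S2. f x \<in> V} \<and>
      (\<forall>U\<in>\<U>. \<exists>\<phi> d. 1 \<le> d \<and> oriented_disc two_sphere U \<phi> \<and> (\<forall>x\<in>U. \<psi> (f x) = \<phi> x ^ d))"
  proof (rule exI[of _ "F2 ` ball p \<epsilon>"], rule exI[of _ "disc_chart L2 F2 p \<epsilon>"], rule exI[of _ \<U>], intro conjI ballI)
    show "y \<in> F2 ` ball p \<epsilon>" using p \<epsilon> by (simp add: isolating_def)
    show "oriented_disc two_sphere (F2 ` ball p \<epsilon>) (disc_chart L2 F2 p \<epsilon>)"
      by (rule Q2.disc_chart_oriented[OF \<epsilon>])
    show "disc_chart L2 F2 p \<epsilon> y = 0" unfolding p by (rule A2.disc_chart_center[OF \<epsilon>])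
    show "\<Union> \<U> = {z \<in> S2. f z \<in> F2 ` ball p \<epsilon>}"
    proof (intro subset_antisym subsetI)
      fix z assume "z \<in> \<Union> \<U>"
      then obtain l x where l: "l \<in> L2" "x \<in> ball (2 *\<^sub>R l + p) \<epsilon>" "z = F1 x" by (auto simp: \<U>_def)
      have "x \<in> {x. F2 x \<in> F2 ` ball p \<epsilon>}"
        unfolding A2.fibre_ball using A2.fibre_plus[OF l(1)] l(2) by blast
      moreover have "F1 x \<in> S2" unfolding Q1.range[symmetric] by simp
      ultimately show "z \<in> {z \<in> S2. f z \<in> F2 ` ball p \<epsilon>}" using l(3) f_F1 by simp
    next
      fix z assume z: "z \<in> {z \<in> S2. f z \<in> F2 ` ball p \<epsilon>}"
      then have "z \<in> range F1" unfolding Q1.range by simp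
      then obtain x where x: "z = F1 x" by blast
      then have "x \<in> {x. F2 x \<in> F2 ` ball p \<epsilon>}" using z f_F1 by simp
      then obtain q where q: "F2 q = F2 p" "x \<in> ball q \<epsilon>" unfolding A2.fibre_ball by blast
      have mem: "F1 x' \<in> \<Union> \<U>" if "l \<in> L2" "x' \<in> ball (2 *\<^sub>R l + p) \<epsilon>" for l x'
        unfolding \<U>_def by (rule UN_I[OF that(1)]) (rule imageI[OF that(2)])
      from q(1)[symmetric] show "z \<in> \<Union> \<U>"
      proof (cases rule: A2.fibreE)
        fix l assume "l \<in> L2" "q = 2 *\<^sub>R l + p"
        then show ?thesis using mem q(2) unfolding x by (simp only:)
      next
        fix l assume l: "l \<in> L2" "q = 2 *\<^sub>R l - p"
        have "2 *\<^sub>R (- l) + p - (- x) = x - q" unfolding l(2) by simp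
        then have "- x \<in> ball (2 *\<^sub>R (- l) + p) \<epsilon>"
          using q(2) unfolding mem_ball dist_norm by (simp add: norm_minus_commute)
        moreover have "z = F1 (- x)" using A1.fibre_minus[OF A1.zero_mem, of x] x by simp
        ultimately show ?thesis using mem[OF A2.minus_mem[OF l(1)]] by (simp only:)
      qed
    qed
    \<comment> \<open>If two image discs meet, the isolating radius forces their centres to have the
      same image under \<open>F1\<close>. The discs then have the same preimage, so they are
      equal.\<close>
    show "pairwise disjnt \<U>"
    proof (rule pairwiseI, rule ccontr)
      fix U U' assume U: "U \<in> \<U>" "U' \<in> \<U>" "U \<noteq> U'" "\<not> disjnt U U'"
      then obtain l l' where l: "l \<in> L2" "l' \<in> L2"
        "U = F1 ` ball (2 *\<^sub>R l + p) \<epsilon>" "U' = F1 ` ball (2 *\<^sub>R l' + p) \<epsilon>" by (auto simp: \<U>_def)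
      define q q' where "q = 2 *\<^sub>R l + p" and "q' = 2 *\<^sub>R l' + p"
      note iso1 = isolating_L1[OF iso[OF l(1), folded q_def]] isolating_L1[OF iso[OF l(2), folded q'_def]]
      obtain z where z: "z \<in> F1 ` ball q \<epsilon>" "z \<in> F1 ` ball q' \<epsilon>"
        using U(4) unfolding disjnt_iff l(3,4) q_def[symmetric] q'_def[symmetric] by blast
      from z(2) obtain x' where "z = F1 x'" "x' \<in> ball q' \<epsilon>" by (rule imageE)
      with z(1) have x': "x' \<in> ball q' \<epsilon>" "F1 x' \<in> F1 ` ball q \<epsilon>" by simp_all
      then have "x' \<in> {x. F1 x \<in> F1 ` ball q \<epsilon>}" by simp
      then obtain q'' where q'': "F1 q'' = F1 q" "x' \<in> ball q'' \<epsilon>"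
        unfolding A1.fibre_ball by blast
      have "F2 q'' = F2 q" by (rule F2_cong[OF q''(1)])
      also have "\<dots> = F2 q'" unfolding q_def q'_def using A2.fibre_plus l by simp
      finally have "q'' = q'"
        using A2.isolating_overlap[OF iso[OF l(2), folded q'_def] _ x'(1) q''(2)] by simp
      then have eq: "F1 q' = F1 q" using q''(1) by simp
      have "{x. F1 x \<in> F1 ` ball q \<epsilon>} = {x. F1 x \<in> F1 ` ball q' \<epsilon>}"
        unfolding A1.fibre_ball A1.fibre_ball eq ..
      then have "F1 ` ball q \<epsilon> = F1 ` ball q' \<epsilon>" by (auto simp: set_eq_iff)
      then show False using U(3) l(3,4) unfolding q_def q'_def by simp
    qed
    fix U assume "U \<in> \<U>"
    then obtain l where l: "l \<in> L2" "U = F1 ` ball (2 *\<^sub>R l + p) \<epsilon>" by (auto simp: \<U>_def)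
    define q where "q = 2 *\<^sub>R l + p"
    note iso1 = isolating_L1[OF iso[OF l(1), folded q_def]]
    have ram: "ramification L2 p = ramification L2 q"
      unfolding q_def by (rule A2.ramification_cong) (simp add: A2.fibre_plus[OF l(1)])
    have "disc_chart L2 F2 p \<epsilon> (f u) = disc_chart L1 F1 q \<epsilon> u ^ (ramification L2 q div ramification L1 q)"
      if u: "u \<in> U" for u
    proof -
      obtain x where x: "x \<in> ball q \<epsilon>" "u = F1 x" using u l(2) q_def by blast
      show ?thesis
        unfolding x(2) f_F1 A2.disc_chart_translate[OF \<epsilon> l(1) x(1)[unfolded q_def]] ram
          A1.disc_chart_eq[OF iso1 x(1)] power_mult[symmetric] ramification_div(1) q_def[symmetric] ..
    qed
    moreover have "oriented_disc two_sphere U (disc_chart L1 F1 q \<epsilon>)"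
      unfolding l(2) q_def[symmetric] by (rule Q1.disc_chart_oriented[OF iso1])
    ultimately show "\<exists>\<phi> d. 1 \<le> d \<and> oriented_disc two_sphere U \<phi> \<and>
        (\<forall>x\<in>U. disc_chart L2 F2 p \<epsilon> (f x) = \<phi> x ^ d)"
      using ramification_div(2) by blast
  qed
qed

lemma covering_degree: "covering_degree two_sphere two_sphere f = card R"
proof -
  have *: "(\<Sum>x \<in> {x \<in> S2. f x = y}. sphere_degree f x) = card R" if "y \<in> S2" for y
  proof -
    obtain p where p: "y = F2 p" using \<open>y \<in> S2\<close> unfolding Q2.range[symmetric] by (elim rangeE)
    show ?thesis
      using weighted_fibre_count[OF sphere_degree_F1, of p] unfolding Q1.range p .
  qed
  have "F2 0 \<in> S2" unfolding Q2.range[symmetric] by simp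
  then show ?thesis
    unfolding covering_degree_def points_two_sphere by (intro the_equality) (use * in auto)
qed

end

section \<open>Portraits\<close>

locale NET_portrait =
  fixes G :: "('v, 'e) pre_digraph" and w :: "'e \<Rightarrow> nat" and d :: nat
  assumes weighted: "weighted_digraph G w" and obvious: "obvious_NET G w d"
begin

definition out :: "'v \<Rightarrow> 'e" where "out v = (THE e. e \<in> out_arcs G v)"
definition target :: "'v \<Rightarrow> 'v" where "target v = head G (out v)"

abbreviation C :: "'v set" where "C \<equiv> critical_vertices G w"
abbreviation P :: "'v set" where "P \<equiv> postcritical_vertices G w"

lemma wf: "wf_digraph G" and finite_verts: "finite (verts G)" and finite_arcs: "finite (arcs G)"
  using weighted unfolding weighted_digraph_def
  by (auto intro: fin_digraph.axioms fin_digraph.finite_verts fin_digraph.finite_arcs)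

lemma out: assumes "v \<in> verts G" shows "out v \<in> arcs G" "tail G (out v) = v"
proof -
  have "\<exists>!e. e \<in> out_arcs G v"
    using assms obvious unfolding obvious_NET_def obvious_thurston_def by blast
  then have "out v \<in> out_arcs G v" unfolding out_def by (rule theI')
  then show "out v \<in> arcs G" "tail G (out v) = v" by (auto simp: out_arcs_def)
qed

lemma tail_verts: "e \<in> arcs G \<Longrightarrow> tail G e \<in> verts G"
  using wf by (rule wf_digraph.tail_in_verts)

lemma out_tail: assumes "e \<in> arcs G" shows "out (tail G e) = e"
proof -
  have "\<exists>!e'. e' \<in> out_arcs G (tail G e)"
    using tail_verts[OF assms] obvious unfolding obvious_NET_def obvious_thurston_def by blast
  moreover have "e \<in> out_arcs G (tail G e)" using assms by (simp add: out_arcs_def)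
  ultimately show ?thesis unfolding out_def by (rule the1_equality)
qed

lemma target_verts: "v \<in> verts G \<Longrightarrow> target v \<in> verts G"
  unfolding target_def using wf_digraph.head_in_verts[OF wf out(1)] .

lemma weight_out: "vertex_weight G w v = w (out v)"
  by (simp add: vertex_weight_def out_def)

lemma weight_cases: assumes "v \<in> verts G" shows "w (out v) = 1 \<or> w (out v) = 2"
  using obvious out(1)[OF assms] unfolding obvious_NET_def by blast

lemma critical_iff: "v \<in> C \<longleftrightarrow> v \<in> verts G \<and> w (out v) = 2"
  unfolding critical_vertices_def weight_out using weight_cases[of v] by auto

lemma verts_eq: "verts G = C \<union> P"
  using obvious unfolding obvious_NET_def obvious_thurston_def by blast

lemma card_P: "card P = 4"
  using obvious unfolding obvious_NET_def by blast

lemma finite_C: "finite C" and finite_P: "finite P"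
  using finite_verts unfolding verts_eq by auto

lemma d_ge_2: "d \<ge> 2"
  using obvious unfolding obvious_NET_def obvious_thurston_def by blast

lemma card_C: "card C = 2 * d - 2"
proof -
  have "(\<Sum>v \<in> C. vertex_weight G w v - 1) = (\<Sum>v \<in> C. 1)"
    by (rule sum.cong[OF refl]) (simp add: weight_out critical_iff)
  then show ?thesis
    using obvious unfolding obvious_NET_def obvious_thurston_def by simp
qed

text \<open>With one edge leaving each vertex, directed paths are iterates of \<open>target\<close>;
  \<open>Suc k\<close> encodes length at least 1.\<close>

lemma postcritical_iff: "x \<in> P \<longleftrightarrow> (\<exists>u \<in> C. \<exists>k. x = (target ^^ Suc k) u)"
proof
  assume "x \<in> P"
  then obtain u where u: "u \<in> C" "u \<rightarrow>\<^sup>+\<^bsub>G\<^esub> x" unfolding postcritical_vertices_def by blast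
  have edge: "b = target a" if ab: "(a, b) \<in> arcs_ends G" for a b
  proof -
    obtain e where "e \<in> arcs G" "a = tail G e" "b = head G e"
      using ab by (auto simp: arcs_ends_def arc_to_ends_def)
    then show ?thesis using out_tail unfolding target_def by simp
  qed
  from u(2) have "\<exists>k. x = (target ^^ Suc k) u"
  proof (induction rule: trancl_induct)
    case (base y)
    then show ?case using edge[OF base] by (intro exI[of _ 0]) simp
  next
    case (step y z)
    then obtain k where "y = (target ^^ Suc k) u" by blast
    then show ?case using edge[OF step(2)] by (intro exI[of _ "Suc k"]) simp
  qed
  then show "\<exists>u \<in> C. \<exists>k. x = (target ^^ Suc k) u" using u(1) by blast
next
  assume "\<exists>u \<in> C. \<exists>k. x = (target ^^ Suc k) u"
  then obtain u k where u: "u \<in> C" and x: "x = (target ^^ Suc k) u" by blast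
  have uV: "u \<in> verts G" using u critical_iff by simp
  have edge: "(v, target v) \<in> arcs_ends G" if "v \<in> verts G" for v
    using out[OF that] by (auto simp: target_def arcs_ends_def arc_to_ends_def intro!: image_eqI[of _ _ "out v"])
  have "(target ^^ Suc k) u \<in> verts G \<and> (u, (target ^^ Suc k) u) \<in> (arcs_ends G)\<^sup>+" for k
  proof (induction k)
    case 0
    then show ?case using target_verts[OF uV] edge[OF uV] by auto
  next
    case (Suc k)
    then show ?case using target_verts edge by (auto intro: trancl_into_trancl)
  qed
  then show "x \<in> P" unfolding x postcritical_vertices_def using u by blast
qed

lemma target_P: assumes "v \<in> verts G" shows "target v \<in> P"
proof (cases "v \<in> C")
  case True
  then show ?thesis unfolding postcritical_iff by (intro bexI[of _ v] exI[of _ 0]) auto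
next
  case False
  then obtain u k where "u \<in> C" "v = (target ^^ Suc k) u"
    using assms verts_eq postcritical_iff by blast
  then show ?thesis unfolding postcritical_iff by (intro bexI[of _ u] exI[of _ "Suc k"]) auto
qed

definition crit_count :: "'v \<Rightarrow> nat" where "crit_count x = card {v \<in> C. target v = x}"
definition noncrit_count :: "'v \<Rightarrow> nat" where "noncrit_count x = card {v \<in> P - C. target v = x}"

lemma in_arcs_eq: "in_arcs G x = out ` {v \<in> verts G. target v = x}"
proof (intro subset_antisym subsetI)
  fix e assume "e \<in> in_arcs G x"
  then have "e \<in> arcs G" "head G e = x" by (auto simp: in_arcs_def)
  then show "e \<in> out ` {v \<in> verts G. target v = x}"
    using out_tail tail_verts by (intro image_eqI[of _ _ "tail G e"]) (auto simp: target_def)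
qed (use out in \<open>auto simp: in_arcs_def target_def\<close>)

lemma inj_out: "inj_on out (verts G)"
  by (rule inj_on_inverseI[where g = "tail G"]) (rule out(2))

lemma incoming_degree_eq: "incoming_degree G w x = 2 * crit_count x + noncrit_count x"
proof -
  have split: "{v \<in> verts G. target v = x} = {v \<in> C. target v = x} \<union> {v \<in> P - C. target v = x}"
    unfolding verts_eq by blast
  have "incoming_degree G w x = (\<Sum>v \<in> {v \<in> verts G. target v = x}. w (out v))"
    unfolding incoming_degree_def in_arcs_eq
    by (subst sum.reindex) (auto intro: inj_on_subset[OF inj_out])
  also have "\<dots> = (\<Sum>v \<in> {v \<in> C. target v = x}. w (out v)) + (\<Sum>v \<in> {v \<in> P - C. target v = x}. w (out v))"
    unfolding split by (rule sum.union_disjoint) (use finite_C finite_P in auto)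
  also have "(\<Sum>v \<in> {v \<in> C. target v = x}. w (out v)) = (\<Sum>v \<in> {v \<in> C. target v = x}. 2)"
    by (rule sum.cong[OF refl]) (simp add: critical_iff)
  also have "(\<Sum>v \<in> {v \<in> P - C. target v = x}. w (out v)) = (\<Sum>v \<in> {v \<in> P - C. target v = x}. 1)"
  proof (rule sum.cong[OF refl])
    fix v assume "v \<in> {v \<in> P - C. target v = x}"
    then have "v \<in> verts G" "v \<notin> C" using verts_eq by auto
    then show "w (out v) = 1" using weight_cases[of v] critical_iff[of v] by blast
  qed
  finally show ?thesis by (simp add: crit_count_def noncrit_count_def)
qed

lemma incoming_le: "x \<in> P \<Longrightarrow> 2 * crit_count x + noncrit_count x \<le> d"
  using obvious verts_eq unfolding obvious_NET_def obvious_thurston_def incoming_degree_eq by blast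

text \<open>Since \<open>2 * crit_count x + noncrit_count x\<close> is at most \<open>d\<close>, the
  equation \<open>2 * crit_count x = d\<close> already excludes incoming edges of weight 1. As
  \<open>d >= 2\<close>, it also provides a critical vertex over \<open>x\<close>.\<close>

lemma full_critical_values_eq: "full_critical_values G w d = {x \<in> P. 2 * crit_count x = d}"
proof (intro subset_antisym subsetI)
  fix x assume "x \<in> full_critical_values G w d"
  then have x: "x \<in> critical_values G w" "incoming_degree G w x = d" "\<And>e. e \<in> in_arcs G x \<Longrightarrow> w e \<noteq> 1"
    unfolding full_critical_values_def by auto
  have "x \<in> P"
  proof -
    obtain e where e: "e \<in> arcs G" "x = head G e" using x(1) unfolding critical_values_def by blast
    then show ?thesis using target_P[OF tail_verts[OF e(1)]] by (simp add: target_def out_tail)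
  qed
  moreover have none: "{v \<in> P - C. target v = x} = {}"
  proof (rule equals0I)
    fix v assume v: "v \<in> {v \<in> P - C. target v = x}"
    then have vV: "v \<in> verts G" using verts_eq by blast
    then have "out v \<in> in_arcs G x" using v unfolding in_arcs_eq by blast
    then show False using x(3) weight_cases[OF vV] critical_iff[of v] v vV by auto
  qed
  ultimately show "x \<in> {x \<in> P. 2 * crit_count x = d}"
    using x(2) unfolding incoming_degree_eq noncrit_count_def none by simp
next
  fix x assume "x \<in> {x \<in> P. 2 * crit_count x = d}"
  then have x: "x \<in> P" "2 * crit_count x = d" by auto
  then have no: "noncrit_count x = 0" using incoming_le[OF x(1)] by simp
  have "crit_count x \<noteq> 0" using x(2) d_ge_2 by auto
  then have "{v \<in> C. target v = x} \<noteq> {}" unfolding crit_count_def by (metis card.empty)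
  then obtain v where v: "v \<in> C" "target v = x" by blast
  have vV: "v \<in> verts G" using v(1) verts_eq by blast
  have "x \<in> critical_values G w"
    unfolding critical_values_def using out[OF vV] v by (intro image_eqI[of _ _ "out v"]) (auto simp: target_def)
  moreover have "w e \<noteq> 1" if e: "e \<in> in_arcs G x" for e
  proof
    assume "w e = 1"
    obtain u where u: "u \<in> verts G" "target u = x" "e = out u" using e unfolding in_arcs_eq by blast
    then have "u \<notin> C" using \<open>w e = 1\<close> critical_iff[of u] by simp
    then have "u \<in> {v \<in> P - C. target v = x}" using u(1,2) unfolding verts_eq by simp
    moreover have "finite {v \<in> P - C. target v = x}" using finite_P by simp
    ultimately show False using no unfolding noncrit_count_def by (metis card_0_eq empty_iff)
  qed
  ultimately show "x \<in> full_critical_values G w d"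
    unfolding full_critical_values_def incoming_degree_eq using x(2) no by simp
qed

lemma sum_crit_count: "(\<Sum>x \<in> P. crit_count x) = 2 * d - 2"
proof -
  have "target ` C \<subseteq> P" using target_P verts_eq by auto
  then have "(\<Sum>x \<in> P. card {v \<in> C. target v = x}) = card C"
    unfolding card_eq_sum by (rule sum.group[OF finite_C finite_P])
  then show ?thesis unfolding crit_count_def card_C .
qed

text \<open>There are four postcritical vertices and \<open>2 * d - 2\<close> critical ones, each
  counted twice. The truncated subtraction is exact by \<open>incoming_le\<close>.\<close>

lemma sum_defect: "(\<Sum>x \<in> P. d - 2 * crit_count x) = 4"
proof -
  have "(\<Sum>x \<in> P. d - 2 * crit_count x) + (\<Sum>x \<in> P. 2 * crit_count x) = (\<Sum>x \<in> P. d)"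
    unfolding sum.distrib[symmetric] by (rule sum.cong[OF refl]) (use incoming_le in force)
  moreover have "(\<Sum>x \<in> P. 2 * crit_count x) = 2 * (2 * d - 2)"
    unfolding sum_distrib_left[symmetric] sum_crit_count ..
  ultimately show ?thesis using card_P d_ge_2 by simp
qed

text \<open>Each defect is odd, hence at least 1, and the four of them sum to 4.\<close>

lemma defect_odd:
  assumes "odd d" "x \<in> P" shows "d - 2 * crit_count x = 1"
proof -
  have pos: "1 \<le> d - 2 * crit_count y" if "y \<in> P" for y
    using incoming_le[OF that] assms(1) by (cases "d = 2 * crit_count y") auto
  have "(\<Sum>y \<in> P. (d - 2 * crit_count y) - 1) + (\<Sum>y \<in> P. 1) = (\<Sum>y \<in> P. d - 2 * crit_count y)"
    unfolding sum.distrib[symmetric] by (rule sum.cong[OF refl]) (use pos in force)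
  then have "(\<Sum>y \<in> P. (d - 2 * crit_count y) - 1) = 0" using sum_defect card_P by simp
  then show ?thesis using assms(2) finite_P pos[OF assms(2)] by force
qed

definition full :: "'v set" where "full = {x \<in> P. 2 * crit_count x = d}"

lemma full_odd: "odd d \<Longrightarrow> full = {}"
  unfolding full_def by auto

text \<open>The halved defects \<open>b x\<close> sum to 2, so the nonzero ones are either 1 and 1
  or a single 2; \<open>full\<close> collects the vertices where they vanish.\<close>

lemma defect_even:
  assumes "even d"
  shows "card full = 2 \<and> (\<forall>x \<in> P - full. d - 2 * crit_count x = 2) \<or>
    card full = 3 \<and> (\<forall>x \<in> P - full. d - 2 * crit_count x = 4)"
proof -
  define b where "b x = d div 2 - crit_count x" for x
  have b: "d - 2 * crit_count x = 2 * b x" if "x \<in> P" for x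
    using assms by (auto simp: b_def)
  have "2 * (\<Sum>x \<in> P. b x) = 4"
    unfolding sum_distrib_left sum_defect[symmetric] by (rule sum.cong[OF refl]) (simp add: b)
  then have "(\<Sum>x \<in> P. b x) = 2" by simp
  moreover have fin: "finite full" "finite (P - full)" using finite_P by (auto simp: full_def)
  have "(\<Sum>x \<in> P. b x) = (\<Sum>x \<in> full. b x) + (\<Sum>x \<in> P - full. b x)"
    using sum.subset_diff[of full P b] finite_P by (simp add: full_def add.commute subset_iff)
  moreover have "(\<Sum>x \<in> full. b x) = 0" by (rule sum.neutral) (auto simp: full_def b_def)
  ultimately have S: "(\<Sum>x \<in> P - full. b x) = 2" by simp
  have pos: "1 \<le> b x" if "x \<in> P - full" for x
    using that incoming_le[of x] assms by (auto simp: full_def b_def)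
  have "(\<Sum>x \<in> P - full. b x - 1) + (\<Sum>x \<in> P - full. 1) = (\<Sum>x \<in> P - full. b x)"
    unfolding sum.distrib[symmetric] by (rule sum.cong[OF refl]) (use pos in force)
  then have S1: "(\<Sum>x \<in> P - full. b x - 1) + card (P - full) = 2" using S by simp
  have cd: "card (P - full) = 4 - card full" "card full \<le> 4"
    using card_P card_Diff_subset[of full P] card_mono[OF finite_P, of full] fin by (auto simp: full_def)
  have "card (P - full) \<noteq> 0" using S fin(2) by (metis card_0_eq sum.empty zero_neq_numeral)
  then consider "card (P - full) = 2" | "card (P - full) = 1" using S1 by linarith
  then show ?thesis
  proof cases
    case 1
    then have "(\<Sum>x \<in> P - full. b x - 1) = 0" using S1 by simp
    then have "b x = 1" if "x \<in> P - full" for x using pos[OF that] that fin(2) by force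
    then show ?thesis using cd 1 b by auto
  next
    case 2
    then obtain x where "P - full = {x}" by (rule card_1_singletonE)
    then show ?thesis using cd 2 S b[of x] by auto
  qed
qed

end

section \<open>Parity of the elementary divisors\<close>

text \<open>Stand-in for an isomorphism from the quotient of \<open>L2\<close> by \<open>L1\<close>
  to \<open>Z/m + Z/n\<close>. Its components are lifted to integers, so the laws hold up to
  congruence, and parity can be discussed directly.\<close>

locale lattice_coordinates =
  fixes L1 L2 :: "(real^2) set" and \<theta>1 \<theta>2 :: "real^2 \<Rightarrow> int" and m n :: nat
  assumes m: "m > 0" and n: "n > 0"
    and add1: "\<And>x y. x \<in> L2 \<Longrightarrow> y \<in> L2 \<Longrightarrow> [\<theta>1 (x + y) = \<theta>1 x + \<theta>1 y] (mod int m)"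
    and add2: "\<And>x y. x \<in> L2 \<Longrightarrow> y \<in> L2 \<Longrightarrow> [\<theta>2 (x + y) = \<theta>2 x + \<theta>2 y] (mod int n)"
    and onto: "\<And>a b. \<exists>l \<in> L2. [\<theta>1 l = a] (mod int m) \<and> [\<theta>2 l = b] (mod int n)"
    and kernel: "\<And>l. l \<in> L2 \<Longrightarrow> l \<in> L1 \<longleftrightarrow> [\<theta>1 l = 0] (mod int m) \<and> [\<theta>2 l = 0] (mod int n)"
    and diff: "\<And>x y. x \<in> L2 \<Longrightarrow> y \<in> L2 \<Longrightarrow> x - y \<in> L2"
begin

lemma diff1: assumes "x \<in> L2" "y \<in> L2" shows "[\<theta>1 (x - y) = \<theta>1 x - \<theta>1 y] (mod int m)"
proof -
  have "[\<theta>1 (x - y + y) = \<theta>1 (x - y) + \<theta>1 y] (mod int m)" by (rule add1[OF diff[OF assms] assms(2)])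
  then have "[\<theta>1 x - \<theta>1 y = \<theta>1 (x - y) + \<theta>1 y - \<theta>1 y] (mod int m)" by (intro cong_diff) auto
  then show ?thesis by (simp add: cong_sym)
qed

lemma diff2: assumes "x \<in> L2" "y \<in> L2" shows "[\<theta>2 (x - y) = \<theta>2 x - \<theta>2 y] (mod int n)"
proof -
  have "[\<theta>2 (x - y + y) = \<theta>2 (x - y) + \<theta>2 y] (mod int n)" by (rule add2[OF diff[OF assms] assms(2)])
  then have "[\<theta>2 x - \<theta>2 y = \<theta>2 (x - y) + \<theta>2 y - \<theta>2 y] (mod int n)" by (intro cong_diff) auto
  then show ?thesis by (simp add: cong_sym)
qed

lemma diff_kernel:
  assumes "x \<in> L2" "y \<in> L2"
  shows "x - y \<in> L1 \<longleftrightarrow> [\<theta>1 x = \<theta>1 y] (mod int m) \<and> [\<theta>2 x = \<theta>2 y] (mod int n)"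
proof -
  have "[\<theta>1 (x - y) = 0] (mod int m) \<longleftrightarrow> [\<theta>1 x - \<theta>1 y = 0] (mod int m)"
    "[\<theta>2 (x - y) = 0] (mod int n) \<longleftrightarrow> [\<theta>2 x - \<theta>2 y = 0] (mod int n)"
    using diff1[OF assms] diff2[OF assms] by (simp_all add: cong_def)
  then show ?thesis unfolding kernel[OF diff[OF assms]] cong_diff_iff_cong_0 by simp
qed

text \<open>One vector of \<open>L2\<close> is chosen for each pair of residues in
  \<open>{0..<int m}\<close> and \<open>{0..<int n}\<close>; hence \<open>m * n\<close>
  representatives.\<close>

lemma transversal_exists:
  obtains R where "finite R" "R \<subseteq> L2" "card R = m * n" "\<And>l. l \<in> L2 \<Longrightarrow> \<exists>!r. r \<in> R \<and> l - r \<in> L1"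
proof -
  define g where "g a = (SOME l. l \<in> L2 \<and> [\<theta>1 l = fst a] (mod int m) \<and> [\<theta>2 l = snd a] (mod int n))" for a
  have g: "g a \<in> L2" "[\<theta>1 (g a) = fst a] (mod int m)" "[\<theta>2 (g a) = snd a] (mod int n)" for a
  proof -
    have "\<exists>l. l \<in> L2 \<and> [\<theta>1 l = fst a] (mod int m) \<and> [\<theta>2 l = snd a] (mod int n)" using onto by blast
    from someI_ex[OF this]
    show "g a \<in> L2" "[\<theta>1 (g a) = fst a] (mod int m)" "[\<theta>2 (g a) = snd a] (mod int n)"
      unfolding g_def by blast+
  qed
  define Z where "Z = {0..<int m} \<times> {0..<int n}"
  have eq: "a = b" if "a \<in> Z" "b \<in> Z" "[fst a = fst b] (mod int m)" "[snd a = snd b] (mod int n)" for a b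
    using that by (auto simp: Z_def cong_def prod_eq_iff)
  have Zcong: "a = b" if "a \<in> Z" "b \<in> Z" "g a - g b \<in> L1" for a b
  proof (rule eq[OF that(1,2)])
    have *: "[\<theta>1 (g a) = \<theta>1 (g b)] (mod int m)" "[\<theta>2 (g a) = \<theta>2 (g b)] (mod int n)"
      using that(3) diff_kernel[OF g(1) g(1)] by auto
    show "[fst a = fst b] (mod int m)" by (rule cong_trans[OF cong_sym[OF g(2)] cong_trans[OF *(1) g(2)]])
    show "[snd a = snd b] (mod int n)" by (rule cong_trans[OF cong_sym[OF g(3)] cong_trans[OF *(2) g(3)]])
  qed
  have "g 0 - g 0 \<in> L1" unfolding diff_kernel[OF g(1) g(1)] by simp
  then have z: "0 \<in> L1" by simp
  show thesis
  proof (rule that[of "g ` Z"])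
    have "inj_on g Z" using Zcong z by (intro inj_onI) auto
    then show "card (g ` Z) = m * n" by (simp add: card_image Z_def)
    show "finite (g ` Z)" by (simp add: Z_def)
    show "g ` Z \<subseteq> L2" using g by auto
    fix l assume l: "l \<in> L2"
    define a where "a = (\<theta>1 l mod int m, \<theta>2 l mod int n)"
    have a: "a \<in> Z" using m n by (simp add: a_def Z_def)
    have la: "l - g b \<in> L1 \<longleftrightarrow> [fst a = fst b] (mod int m) \<and> [snd a = snd b] (mod int n)" for b
      unfolding diff_kernel[OF l g(1)] using g(2,3)[of b] by (auto simp: a_def cong_def)
    show "\<exists>!r. r \<in> g ` Z \<and> l - r \<in> L1"
    proof (rule ex1I[of _ "g a"])
      show "g a \<in> g ` Z \<and> l - g a \<in> L1" using a la by auto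
      fix r assume "r \<in> g ` Z \<and> l - r \<in> L1"
      then obtain b where "b \<in> Z" "r = g b" "l - g b \<in> L1" by auto
      then have "a = b" using la[of b] by (intro eq[OF a]) auto
      then show "r = g a" using \<open>r = g b\<close> by simp
    qed
  qed
qed

end

text \<open>The coordinates are the components of the isomorphism after the coset projection. As
  \<open>m\<close> and \<open>n\<close> are positive, the values are residues in
  \<open>{0..<int m}\<close> and \<open>{0..<int n}\<close>, where congruence to 0 means equality to
  0.\<close>

lemma lattice_coordinates_exist:
  assumes sub: "L1 \<subseteq> L2" and m: "m > 0" and n: "n > 0"
    and diff1: "\<And>x y. x \<in> L1 \<Longrightarrow> y \<in> L1 \<Longrightarrow> x - y \<in> L1" and zero: "0 \<in> L1"
    and diff2: "\<And>x y. x \<in> L2 \<Longrightarrow> y \<in> L2 \<Longrightarrow> x - y \<in> L2"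
    and iso: "(lattice_group L2 Mod L1) \<cong> (integer_mod_group m \<times>\<times> integer_mod_group n)"
  obtains \<theta>1 \<theta>2 where "lattice_coordinates L1 L2 \<theta>1 \<theta>2 m n"
proof -
  let ?G = "lattice_group L2"
  have add2: "x + y \<in> L2" if "x \<in> L2" "y \<in> L2" for x y
    using diff2[OF that(1) diff2[OF _ that(2), of 0]] sub zero by auto
  have add1: "x + y \<in> L1" if "x \<in> L1" "y \<in> L1" for x y
    using diff1[OF that(1) diff1[OF zero that(2)]] by simp
  have z2: "0 \<in> L2" using sub zero by blast
  have "comm_group ?G"
  proof (rule comm_groupI)
    fix x assume "x \<in> carrier ?G"
    then show "\<exists>y\<in>carrier ?G. y \<otimes>\<^bsub>?G\<^esub> x = \<one>\<^bsub>?G\<^esub>"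
      using diff2[OF z2] by (intro bexI[of _ "- x"]) (auto simp: lattice_group_def)
  qed (use add2 z2 in \<open>auto simp: lattice_group_def algebra_simps\<close>)
  then interpret G: comm_group ?G .
  have "subgroup L1 ?G"
  proof (rule G.subgroupI)
    fix a assume a: "a \<in> L1"
    have "inv\<^bsub>?G\<^esub> a = - a"
      by (rule G.inv_equality) (use a sub diff2[OF z2, of a] in \<open>auto simp: lattice_group_def\<close>)
    then show "inv\<^bsub>?G\<^esub> a \<in> L1" using diff1[OF zero a] by simp
  qed (use sub zero add1 in \<open>auto simp: lattice_group_def\<close>)
  then have "L1 \<lhd> ?G" by (rule G.subgroup_imp_normal)
  then interpret N: normal L1 ?G .
  obtain h where h: "h \<in> iso (?G Mod L1) (integer_mod_group m \<times>\<times> integer_mod_group n)"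
    using iso unfolding is_iso_def by blast
  define \<theta> where "\<theta> l = h (L1 #>\<^bsub>?G\<^esub> l)" for l
  have cos: "L1 #>\<^bsub>?G\<^esub> l \<in> carrier (?G Mod L1)" if "l \<in> L2" for l
    using that by (auto simp: FactGroup_def RCOSETS_def lattice_group_def)
  have hom: "\<theta> (x + y) = \<theta> x \<otimes>\<^bsub>integer_mod_group m \<times>\<times> integer_mod_group n\<^esub> \<theta> y" if "x \<in> L2" "y \<in> L2" for x y
  proof -
    have "(L1 #>\<^bsub>?G\<^esub> x) \<otimes>\<^bsub>?G Mod L1\<^esub> (L1 #>\<^bsub>?G\<^esub> y) = L1 #>\<^bsub>?G\<^esub> (x + y)"
      using N.rcos_sum[of x y] that by (simp add: FactGroup_def lattice_group_def)
    then show ?thesis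
      unfolding \<theta>_def using h hom_mult[OF iso_imp_homomorphism[OF h] cos[OF that(1)] cos[OF that(2)]] by simp
  qed
  have inj: "\<theta> x = \<theta> y \<longleftrightarrow> L1 #>\<^bsub>?G\<^esub> x = L1 #>\<^bsub>?G\<^esub> y" if "x \<in> L2" "y \<in> L2" for x y
    unfolding \<theta>_def using h cos[OF that(1)] cos[OF that(2)]
    by (auto simp: iso_def bij_betw_def dest: inj_onD)
  have surj: "\<exists>l \<in> L2. \<theta> l = z" if z: "z \<in> carrier (integer_mod_group m \<times>\<times> integer_mod_group n)" for z
  proof -
    have "z \<in> h ` carrier (?G Mod L1)" using h z by (auto simp: iso_def bij_betw_def)
    then obtain K where "K \<in> carrier (?G Mod L1)" "z = h K" by blast
    then show ?thesis by (auto simp: FactGroup_def RCOSETS_def lattice_group_def \<theta>_def)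
  qed
  have coset0: "L1 #>\<^bsub>?G\<^esub> l = L1 \<longleftrightarrow> l \<in> L1" if "l \<in> L2" for l
    using G.rcos_self[of l L1] G.coset_join2[of l L1] \<open>subgroup L1 ?G\<close> that by (auto simp: lattice_group_def)
  have \<theta>0: "\<theta> 0 = (0, 0)"
  proof -
    have "\<theta> 0 = h \<one>\<^bsub>?G Mod L1\<^esub>"
      unfolding \<theta>_def using coset0[OF z2] zero by (simp add: FactGroup_def)
    also have "\<dots> = \<one>\<^bsub>integer_mod_group m \<times>\<times> integer_mod_group n\<^esub>"
      by (rule hom_one[OF iso_imp_homomorphism[OF h] N.factorgroup_is_group])
         (auto intro!: DirProd_group)
    finally show ?thesis by (simp add: one_DirProd)
  qed
  have carr: "\<theta> l \<in> {0..<int m} \<times> {0..<int n}" if "l \<in> L2" for l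
  proof -
    have "\<theta> l \<in> carrier (integer_mod_group m \<times>\<times> integer_mod_group n)"
      unfolding \<theta>_def using h cos[OF that] by (auto simp: iso_def bij_betw_def)
    then show ?thesis using m n by (simp add: carrier_integer_mod_group)
  qed
  show thesis
  proof (rule that[of "\<lambda>l. fst (\<theta> l)" "\<lambda>l. snd (\<theta> l)"], unfold_locales)
    fix x y assume xy: "x \<in> L2" "y \<in> L2"
    show "[fst (\<theta> (x + y)) = fst (\<theta> x) + fst (\<theta> y)] (mod int m)"
      "[snd (\<theta> (x + y)) = snd (\<theta> x) + snd (\<theta> y)] (mod int n)"
      unfolding hom[OF xy] by (simp_all add: mult_DirProd' integer_mod_group_def m n cong_def)
  next
    fix a b
    have "(a mod int m, b mod int n) \<in> carrier (integer_mod_group m \<times>\<times> integer_mod_group n)"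
      using m n by (simp add: carrier_integer_mod_group)
    from surj[OF this] obtain l where "l \<in> L2" "\<theta> l = (a mod int m, b mod int n)" by blast
    then show "\<exists>l \<in> L2. [fst (\<theta> l) = a] (mod int m) \<and> [snd (\<theta> l) = b] (mod int n)"
      by (intro bexI[of _ l]) (simp_all add: cong_def)
  next
    fix l assume l: "l \<in> L2"
    have "l \<in> L1 \<longleftrightarrow> \<theta> l = \<theta> 0"
      unfolding inj[OF l z2] using coset0[OF l] coset0[OF z2] zero by simp
    also have "\<dots> \<longleftrightarrow> fst (\<theta> l) = 0 \<and> snd (\<theta> l) = 0" unfolding \<theta>0 by (simp add: prod_eq_iff)
    also have "\<dots> \<longleftrightarrow> [fst (\<theta> l) = 0] (mod int m) \<and> [snd (\<theta> l) = 0] (mod int n)"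
      using carr[OF l] by (auto simp: cong_def mem_Times_iff)
    finally show "l \<in> L1 \<longleftrightarrow> [fst (\<theta> l) = 0] (mod int m) \<and> [snd (\<theta> l) = 0] (mod int n)" .
  qed (use m n diff2 in auto)
qed

section \<open>Transport of the combinatorial data along an isomorphism of portraits\<close>

context NET_portrait begin

text \<open>In \<open>portrait f\<close> the tail map is the identity, so the arc part of an
  isomorphism is determined by its vertex part \<open>\<eta>\<close>. Weights identify the critical
  points; iterates show that \<open>\<eta>\<close> maps \<open>P\<close> into the postcritical set,
  and both have four elements.\<close>

lemma portrait_transport:
  assumes NET: "NET_map f" and iso: "weighted_iso G w (portrait f) (sphere_degree f)"
  obtains \<eta> where "inj_on \<eta> (verts G)" "\<eta> ` C = critical_set f" "\<eta> ` P = postcritical_set f"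
    "\<And>v. v \<in> verts G \<Longrightarrow> \<eta> (target v) = f (\<eta> v)"
proof -
  obtain h where h: "pre_digraph.digraph_isomorphism G h" "portrait f = app_iso h G"
    "\<And>e. e \<in> arcs G \<Longrightarrow> sphere_degree f (iso_arcs h e) = w e"
    using iso unfolding weighted_iso_def by blast
  define \<eta> where "\<eta> = iso_verts h"
  have inj: "inj_on \<eta> (verts G)"
    using h(1) unfolding pre_digraph.digraph_isomorphism_def \<eta>_def by blast
  have ends: "iso_verts h (tail G a) = iso_tail h (iso_arcs h a) \<and> iso_verts h (head G a) = iso_head h (iso_arcs h a)"
    if "a \<in> arcs G" for a
    using h(1) that unfolding pre_digraph.digraph_isomorphism_def by blast
  have P1: "critical_set f \<union> postcritical_set f = \<eta> ` verts G" "(\<lambda>x. x) = iso_tail h" "f = iso_head h"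
    using arg_cong[OF h(2), of verts] arg_cong[OF h(2), of tail] arg_cong[OF h(2), of head]
    by (simp_all only: portrait_def app_iso_def \<eta>_def pre_digraph.select_convs)
  have arc: "iso_arcs h (out v) = \<eta> v" "\<eta> (target v) = f (\<eta> v)" if v: "v \<in> verts G" for v
  proof -
    note e = ends[OF out(1)[OF v], folded \<eta>_def, unfolded out(2)[OF v] P1(2,3)[symmetric]]
    show "iso_arcs h (out v) = \<eta> v" using e by simp
    show "\<eta> (target v) = f (\<eta> v)" using e unfolding target_def by simp
  qed
  have deg: "sphere_degree f (\<eta> v) = w (out v)" if "v \<in> verts G" for v
    using h(3)[OF out(1)[OF that]] unfolding arc(1)[OF that] .
  have "f ` S2 = S2"
    using NET unfolding NET_map_def thurston_map_def branched_covering_def points_two_sphere by blast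
  then have iter: "(f ^^ k) z \<in> S2" if "z \<in> S2" for k z
    using that by (induction k) auto
  have crit: "\<eta> ` C = critical_set f"
  proof (intro subset_antisym subsetI)
    fix z assume "z \<in> \<eta> ` C"
    then obtain v where v: "v \<in> C" "z = \<eta> v" by blast
    then have vV: "v \<in> verts G" "w (out v) = 2" using critical_iff by auto
    have "z \<in> critical_set f \<union> postcritical_set f" unfolding P1(1) v(2) using vV(1) by (rule imageI)
    then have "z \<in> S2"
      unfolding postcritical_set_def critical_set_def using iter by auto
    then show "z \<in> critical_set f" unfolding critical_set_def using deg[OF vV(1)] vV(2) v(2) by simp
  next
    fix z assume z: "z \<in> critical_set f"
    then have "z \<in> \<eta> ` verts G" unfolding P1(1)[symmetric] by blast
    then obtain v where v: "v \<in> verts G" "z = \<eta> v" by blast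
    have "sphere_degree f z = 2" using NET z unfolding NET_map_def by blast
    then have "v \<in> C" using critical_iff deg[OF v(1)] v by simp
    then show "z \<in> \<eta> ` C" using v(2) by blast
  qed
  have post: "\<eta> ` P = postcritical_set f"
  proof (rule card_subset_eq)
    have four: "card (postcritical_set f) = 4" using NET unfolding NET_map_def by blast
    then show "finite (postcritical_set f)" by (metis card.infinite zero_neq_numeral)
    have "inj_on \<eta> P" by (rule inj_on_subset[OF inj]) (use verts_eq in blast)
    then show "card (\<eta> ` P) = card (postcritical_set f)" by (simp add: card_image card_P four)
    show "\<eta> ` P \<subseteq> postcritical_set f"
    proof
      fix z assume "z \<in> \<eta> ` P"
      then obtain u k where u: "u \<in> C" "z = \<eta> ((target ^^ Suc k) u)" using postcritical_iff by auto
      have uV: "u \<in> verts G" using u(1) critical_iff by blast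
      have "(target ^^ k) u \<in> verts G \<and> \<eta> ((target ^^ k) u) = (f ^^ k) (\<eta> u)" for k
      proof (induction k)
        case (Suc k)
        then show ?case using target_verts arc(2) by simp
      qed (use uV in simp)
      then have "z = (f ^^ Suc k) (\<eta> u)" using u(2) by blast
      moreover have "\<eta> u \<in> critical_set f" using u(1) crit by blast
      ultimately show "z \<in> postcritical_set f"
        unfolding postcritical_set_def by (intro UN_I[of "Suc k"]) auto
    qed
  qed
  show thesis using that[OF inj crit post arc(2)] .
qed

lemma card_full_portrait:
  assumes "NET_map f" "weighted_iso G w (portrait f) (sphere_degree f)"
  shows "card full = card {y \<in> postcritical_set f. 2 * card {z \<in> critical_set f. f z = y} = d}"
proof -
  obtain \<eta> where \<eta>: "inj_on \<eta> (verts G)" "\<eta> ` C = critical_set f" "\<eta> ` P = postcritical_set f"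
    "\<And>v. v \<in> verts G \<Longrightarrow> \<eta> (target v) = f (\<eta> v)"
    using portrait_transport[OF assms] by metis
  have CV: "v \<in> verts G" if "v \<in> C" for v using that verts_eq by blast
  have PV: "v \<in> verts G" if "v \<in> P" for v using that verts_eq by blast
  have count: "card {z \<in> critical_set f. f z = \<eta> x} = crit_count x" if x: "x \<in> P" for x
  proof -
    have "{z \<in> critical_set f. f z = \<eta> x} = \<eta> ` {v \<in> C. target v = x}"
    proof (intro subset_antisym subsetI)
      fix z assume z: "z \<in> {z \<in> critical_set f. f z = \<eta> x}"
      then obtain v where v: "v \<in> C" "z = \<eta> v" unfolding \<eta>(2)[symmetric] by blast
      then have "\<eta> (target v) = \<eta> x" using z \<eta>(4)[OF CV] by simp
      then have "target v = x" by (rule inj_onD[OF \<eta>(1)]) (use v x CV PV target_verts in auto)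
      then show "z \<in> \<eta> ` {v \<in> C. target v = x}" using v by blast
    next
      fix z assume "z \<in> \<eta> ` {v \<in> C. target v = x}"
      then obtain v where v: "v \<in> C" "target v = x" "z = \<eta> v" by blast
      then show "z \<in> {z \<in> critical_set f. f z = \<eta> x}" using \<eta>(2) \<eta>(4)[OF CV[OF v(1)]] by auto
    qed
    moreover have "inj_on \<eta> {v \<in> C. target v = x}" by (rule inj_on_subset[OF \<eta>(1)]) (use CV in blast)
    ultimately show ?thesis by (simp add: card_image crit_count_def)
  qed
  have "{y \<in> postcritical_set f. 2 * card {z \<in> critical_set f. f z = y} = d} = \<eta> ` full"
    unfolding full_def \<eta>(3)[symmetric] using count by auto
  moreover have "inj_on \<eta> full" by (rule inj_on_subset[OF \<eta>(1)]) (use PV in \<open>auto simp: full_def\<close>)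
  ultimately show ?thesis by (simp add: card_image)
qed

lemma mod2_elementary_divisors_eq:
  "mod2_elementary_divisors G w d =
    (if card full = 0 then (1, 1) else if card full = 2 then (0, 1) else (0, 0))"
proof -
  have "card full = 0 \<or> card full = 2 \<or> card full = 3"
    using full_odd defect_even by (cases "odd d") auto
  then show ?thesis
    unfolding mod2_elementary_divisors_def full_critical_values_eq full_def[symmetric] Let_def by auto
qed

end

text \<open>By the weighted count, the critical points account for all of \<open>card R\<close>
  exactly if no point of the image of \<open>L1\<close> lies over \<open>F2 p\<close>.\<close>

lemma (in fibre_pair) fully_ramified_iff:
  assumes p: "p \<in> L2"
  shows "2 * card {z \<in> F1 ` (L2 - L1). f z = F2 p} = card R \<longleftrightarrow> F2 p \<notin> F2 ` L1"
proof -
  let ?N = "{z \<in> F1 ` L1. f z = F2 p}"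
  have "finite ?N" by (rule finite_subset[OF _ finite_fibre[of p]]) auto
  then have "card ?N = 0 \<longleftrightarrow> ?N = {}" by simp
  also have "\<dots> \<longleftrightarrow> F2 p \<notin> F2 ` L1"
  proof -
    have "?N = F1 ` {q \<in> L1. F2 q = F2 p}" using f_F1 by auto
    then show ?thesis by (auto simp: image_iff)
  qed
  finally show ?thesis using critical_fibre_count[OF p] by auto
qed

text \<open>Normality makes the deck group transitive on fibres, so its explicit form describes
  them.\<close>

lemma lattice_fibres_of_covering:
  assumes L: "plane_lattice L" and cov: "lattice_covering L \<pi>"
  shows "lattice_fibres L \<pi>"
proof -
  obtain u v where L': "L = {of_int a *\<^sub>R u + of_int b *\<^sub>R v | a b. True}"
    using L unfolding plane_lattice_def by blast
  have nc: "normal_covering \<pi>" and dg: "deck_group \<pi> = (\<Union>l \<in> L. {\<lambda>x. 2 *\<^sub>R l + x, \<lambda>x. 2 *\<^sub>R l - x})"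
    using cov unfolding lattice_covering_def by auto
  show ?thesis
  proof
    have "(0 :: real^2) = of_int 0 *\<^sub>R u + of_int 0 *\<^sub>R v" by simp
    then show "0 \<in> L" unfolding L' by blast
  next
    fix x y assume "x \<in> L" "y \<in> L"
    then obtain a b a' b' where "x = of_int a *\<^sub>R u + of_int b *\<^sub>R v" "y = of_int a' *\<^sub>R u + of_int b' *\<^sub>R v"
      unfolding L' by blast
    then have "x - y = of_int (a - a') *\<^sub>R u + of_int (b - b') *\<^sub>R v" by (simp add: algebra_simps)
    then show "x - y \<in> L" unfolding L' by blast
  next
    fix x y
    show "\<pi> x = \<pi> y \<longleftrightarrow> (\<exists>l \<in> L. y = 2 *\<^sub>R l + x \<or> y = 2 *\<^sub>R l - x)"
    proof
      assume "\<pi> x = \<pi> y"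
      then obtain g where "g \<in> deck_group \<pi>" "g x = y" using nc unfolding normal_covering_def by blast
      then show "\<exists>l \<in> L. y = 2 *\<^sub>R l + x \<or> y = 2 *\<^sub>R l - x" unfolding dg by auto
    next
      assume "\<exists>l \<in> L. y = 2 *\<^sub>R l + x \<or> y = 2 *\<^sub>R l - x"
      then obtain g where "g \<in> deck_group \<pi>" "g x = y" unfolding dg by auto
      then show "\<pi> x = \<pi> y" unfolding deck_group_def by (metis (mono_tags, lifting) comp_apply mem_Collect_eq)
    qed
  qed
qed

section \<open>The image of the smaller lattice and the parities of the elementary divisors\<close>

lemma even_cong_iff:
  assumes "even k" "[a = b] (mod int k)" shows "even a \<longleftrightarrow> even b"
proof -
  have "[a = b] (mod 2)" by (rule cong_dvd_modulus[OF assms(2)]) (use assms(1) in simp)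
  then show ?thesis by (rule cong_dvd_iff)
qed

locale coordinate_pair = fibre_pair L1 F1 L2 F2 f R + lattice_coordinates L1 L2 \<theta>1 \<theta>2 m n
  for L1 F1 L2 F2 f R \<theta>1 \<theta>2 m n
begin

text \<open>Two points of one fibre have difference or sum of the form \<open>2 l\<close>, so their
  coordinates agree modulo 2. Parity is meaningful because the coordinate is defined modulo the even
  number \<open>m\<close>.\<close>

lemma parity1:
  assumes "even m" "p \<in> L2" "q \<in> L2" "F2 p = F2 q" shows "even (\<theta>1 p) \<longleftrightarrow> even (\<theta>1 q)"
proof -
  have add: "even (\<theta>1 (x + y)) \<longleftrightarrow> even (\<theta>1 x + \<theta>1 y)" if "x \<in> L2" "y \<in> L2" for x y
    by (rule even_cong_iff[OF assms(1) add1[OF that]])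
  from assms(4) show ?thesis
  proof (cases rule: A2.fibreE)
    fix l assume l: "l \<in> L2" "q = 2 *\<^sub>R l + p"
    then show ?thesis using add[OF A2.double_mem[OF l(1)] assms(2)] add[OF l(1) l(1)] by (simp add: scaleR_2)
  next
    fix l assume l: "l \<in> L2" "q = 2 *\<^sub>R l - p"
    then have "q + p = l + l" by (simp add: scaleR_2)
    then show ?thesis using add[OF assms(3,2)] add[OF l(1) l(1)] by simp
  qed
qed

lemma parity2:
  assumes "even n" "p \<in> L2" "q \<in> L2" "F2 p = F2 q" shows "even (\<theta>2 p) \<longleftrightarrow> even (\<theta>2 q)"
proof -
  have add: "even (\<theta>2 (x + y)) \<longleftrightarrow> even (\<theta>2 x + \<theta>2 y)" if "x \<in> L2" "y \<in> L2" for x y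
    by (rule even_cong_iff[OF assms(1) add2[OF that]])
  from assms(4) show ?thesis
  proof (cases rule: A2.fibreE)
    fix l assume l: "l \<in> L2" "q = 2 *\<^sub>R l + p"
    then show ?thesis using add[OF A2.double_mem[OF l(1)] assms(2)] add[OF l(1) l(1)] by (simp add: scaleR_2)
  next
    fix l assume l: "l \<in> L2" "q = 2 *\<^sub>R l - p"
    then have "q + p = l + l" by (simp add: scaleR_2)
    then show ?thesis using add[OF assms(3,2)] add[OF l(1) l(1)] by simp
  qed
qed

text \<open>Choose \<open>k\<close> whose coordinates are half those of \<open>l - p\<close>. Then
  \<open>q = l - p - 2 k\<close> lies in \<open>L1\<close>, and translation by \<open>2 k\<close>
  does not change \<open>F2\<close>.\<close>

lemma F2_eq_of_half:
  assumes l: "l \<in> L2" "p \<in> L2" and half: "\<exists>a. [\<theta>1 l - \<theta>1 p = 2 * a] (mod int m)" "\<exists>b. [\<theta>2 l - \<theta>2 p = 2 * b] (mod int n)"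
  obtains q where "q \<in> L1" "F2 l = F2 (q + p)"
proof -
  obtain a b where ab: "[\<theta>1 l - \<theta>1 p = 2 * a] (mod int m)" "[\<theta>2 l - \<theta>2 p = 2 * b] (mod int n)" using half by blast
  obtain k where k: "k \<in> L2" "[\<theta>1 k = a] (mod int m)" "[\<theta>2 k = b] (mod int n)" using onto by blast
  have kk: "2 *\<^sub>R k \<in> L2" "l - p \<in> L2" using A2.double_mem k diff l by auto
  have "[\<theta>1 (2 *\<^sub>R k) = \<theta>1 k + \<theta>1 k] (mod int m)" unfolding scaleR_2 by (rule add1[OF k(1) k(1)])
  then have "[\<theta>1 (2 *\<^sub>R k) = a + a] (mod int m)" using cong_add[OF k(2) k(2)] cong_trans by blast
  then have 1: "[\<theta>1 (l - p) = \<theta>1 (2 *\<^sub>R k)] (mod int m)"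
    using diff1[OF l] ab(1) by (simp add: cong_def)
  have "[\<theta>2 (2 *\<^sub>R k) = \<theta>2 k + \<theta>2 k] (mod int n)" unfolding scaleR_2 by (rule add2[OF k(1) k(1)])
  then have "[\<theta>2 (2 *\<^sub>R k) = b + b] (mod int n)" using cong_add[OF k(3) k(3)] cong_trans by blast
  then have 2: "[\<theta>2 (l - p) = \<theta>2 (2 *\<^sub>R k)] (mod int n)"
    using diff2[OF l] ab(2) by (simp add: cong_def)
  have "l - p - 2 *\<^sub>R k \<in> L1" using diff_kernel[OF kk(2,1)] 1 2 by blast
  moreover have "F2 (2 *\<^sub>R k + (l - p - 2 *\<^sub>R k + p)) = F2 (l - p - 2 *\<^sub>R k + p)" by (rule A2.fibre_plus[OF k(1)])
  then have "F2 l = F2 (l - p - 2 *\<^sub>R k + p)" by (simp add: algebra_simps)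
  ultimately show thesis by (rule that)
qed

text \<open>2 is invertible modulo an odd \<open>k\<close>, with inverse
  \<open>(k + 1) div 2\<close>.\<close>

lemma half_odd: assumes "odd k" shows "\<exists>a. [x = 2 * a] (mod int k)"
proof -
  have "2 * (x * ((int k + 1) div 2)) = x + x * int k"
    using assms by (simp add: algebra_simps)
  then have "[x = 2 * (x * ((int k + 1) div 2))] (mod int k)" by (simp add: cong_def)
  then show ?thesis by blast
qed

lemma half_even: assumes "even x" shows "\<exists>a. [x = 2 * a] (mod int k)"
  using assms by (metis cong_refl dvdE)

lemma image_odd:
  assumes "odd m" "odd n" shows "F2 ` L1 = F2 ` L2"
proof (intro subset_antisym subsetI)
  fix y assume "y \<in> F2 ` L2"
  then obtain l where l: "l \<in> L2" "y = F2 l" by blast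
  obtain q where "q \<in> L1" "F2 l = F2 (q + 0)"
    using F2_eq_of_half[OF l(1) A2.zero_mem half_odd[OF assms(1)] half_odd[OF assms(2)]] by blast
  then show "y \<in> F2 ` L1" using l(2) by auto
qed (use sub in blast)

text \<open>If \<open>L1\<close> had one image point, every vector of \<open>L1\<close> would be
  twice a vector of \<open>L2\<close>. Since \<open>n\<close> is odd, vectors of \<open>L2\<close>
  with equal parity of \<open>\<theta>1\<close> would then have the same image, leaving at most two
  points instead of four.\<close>

lemma image_even_odd:
  assumes "even m" "odd n" "card (F2 ` L2) = 4" shows "card (F2 ` L1) \<noteq> 1"
proof
  assume "card (F2 ` L1) = 1"
  then obtain y where y: "F2 ` L1 = {y}" by (rule card_1_singletonE)
  have triv: "F2 q = F2 0" if "q \<in> L1" for q using y that A1.zero_mem by (metis image_eqI singletonD)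
  have eq: "F2 l = F2 p" if lp: "l \<in> L2" "p \<in> L2" "even (\<theta>1 l) \<longleftrightarrow> even (\<theta>1 p)" for l p
  proof -
    have "even (\<theta>1 l - \<theta>1 p)" using lp(3) by simp
    then obtain q where q: "q \<in> L1" "F2 l = F2 (q + p)"
      using F2_eq_of_half[OF lp(1,2) half_even half_odd[OF assms(2)]] by blast
    from triv[OF q(1)] have "F2 0 = F2 q" by simp
    then obtain k where k: "k \<in> L2" "q = 2 *\<^sub>R k" by (cases rule: A2.fibreE) auto
    show ?thesis using q(2) A2.fibre_plus[OF k(1), of p] unfolding k(2) by simp
  qed
  obtain l0 where l0: "l0 \<in> L2" "[\<theta>1 l0 = 1] (mod int m)" using onto[of 1 0] by blast
  have "odd (\<theta>1 l0)" using even_cong_iff[OF assms(1) l0(2)] by simp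
  obtain l1 where l1: "l1 \<in> L2" "[\<theta>1 l1 = 0] (mod int m)" using onto[of 0 0] by blast
  have "even (\<theta>1 l1)" using even_cong_iff[OF assms(1) l1(2)] by simp
  have "F2 ` L2 \<subseteq> {F2 l0, F2 l1}"
  proof
    fix y assume "y \<in> F2 ` L2"
    then obtain l where l: "l \<in> L2" "y = F2 l" by blast
    show "y \<in> {F2 l0, F2 l1}"
    proof (cases "even (\<theta>1 l)")
      case True
      then have "F2 l = F2 l1" using \<open>even (\<theta>1 l1)\<close> by (intro eq[OF l(1) l1(1)]) simp
      then show ?thesis using l(2) by simp
    next
      case False
      then have "F2 l = F2 l0" using \<open>odd (\<theta>1 l0)\<close> by (intro eq[OF l(1) l0(1)]) simp
      then show ?thesis using l(2) by simp
    qed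
  qed
  then have "card (F2 ` L2) \<le> card {F2 l0, F2 l1}" by (intro card_mono) auto
  also have "\<dots> \<le> 2" by (simp add: card_insert_if)
  finally show False using assms(3) by simp
qed

text \<open>The pair of parities is constant on fibres and takes four values, so it separates the
  four image points of \<open>L2\<close>. On \<open>L1\<close> the parities are those of 0.\<close>

lemma image_even:
  assumes "even m" "even n" "card (F2 ` L2) = 4" shows "F2 ` L1 = {F2 0}"
proof -
  define par where "par l = (even (\<theta>1 l), even (\<theta>2 l))" for l
  define g where "g y = par (SOME l. l \<in> L2 \<and> F2 l = y)" for y
  have g: "g (F2 l) = par l" if "l \<in> L2" for l
  proof -
    have "(SOME k. k \<in> L2 \<and> F2 k = F2 l) \<in> L2 \<and> F2 (SOME k. k \<in> L2 \<and> F2 k = F2 l) = F2 l"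
      by (rule someI[of _ l]) (use that in simp)
    then show ?thesis
      unfolding g_def par_def using parity1[OF assms(1) _ that] parity2[OF assms(2) _ that] by simp
  qed
  note m2 = even_cong_iff[OF assms(1)] and n2 = even_cong_iff[OF assms(2)]
  have "g ` F2 ` L2 = UNIV"
  proof (intro subset_antisym subsetI)
    fix z :: "bool \<times> bool"
    obtain l where l: "l \<in> L2" "[\<theta>1 l = (if fst z then 0 else 1)] (mod int m)"
      "[\<theta>2 l = (if snd z then 0 else 1)] (mod int n)" using onto by blast
    have "par l = z" using m2[OF l(2)] n2[OF l(3)] by (simp add: par_def prod_eq_iff)
    then show "z \<in> g ` F2 ` L2" using g[OF l(1)] l(1) by (metis imageI)
  qed simp
  moreover have "card (UNIV :: (bool \<times> bool) set) = 4" by (simp add: card_UNIV_bool)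
  ultimately have "card (g ` F2 ` L2) = card (F2 ` L2)" using assms(3) by simp
  moreover have "finite (F2 ` L2)" using assms(3) by (metis card.infinite zero_neq_numeral)
  ultimately have inj: "inj_on g (F2 ` L2)" by (metis eq_card_imp_inj_on)
  have triv: "F2 q = F2 0" if q: "q \<in> L1" for q
  proof (rule inj_onD[OF inj])
    have "[\<theta>1 q = 0] (mod int m)" "[\<theta>2 q = 0] (mod int n)" using kernel[of q] q sub by auto
    moreover have "[\<theta>1 0 = 0] (mod int m)" "[\<theta>2 0 = 0] (mod int n)"
      using kernel[OF A2.zero_mem] A1.zero_mem by auto
    ultimately have "par q = par 0" using m2[of _ 0] n2[of _ 0] by (simp add: par_def)
    then show "g (F2 q) = g (F2 0)" using g[OF subsetD[OF sub q]] g[OF A2.zero_mem] by simp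
  qed (rule imageI[OF subsetD[OF sub q]], rule imageI[OF A2.zero_mem])
  show ?thesis
  proof (intro subset_antisym image_subsetI)
    fix q assume "q \<in> L1"
    then show "F2 q \<in> {F2 0}" unfolding singleton_iff by (rule triv)
  next
    show "{F2 0} \<subseteq> F2 ` L1" using A1.zero_mem by blast
  qed
qed

end

lemma mod2_elementary_divisors_necessary:
  assumes G: "weighted_digraph G w" "obvious_NET G w d"
    and mn: "n dvd m" "m * n = d"
    and f: "NET_map f" "weighted_iso G w (portrait f) (sphere_degree f)" "elementary_divisors f m n"
  shows "[m = fst (mod2_elementary_divisors G w d)] (mod 2) \<and>
    [n = snd (mod2_elementary_divisors G w d)] (mod 2)"
proof -
  interpret NET_portrait G w d using G by unfold_locales
  obtain L1 L2 \<pi>1 \<pi>2 where pos: "m > 0" "n > 0" and lat: "plane_lattice L1" "plane_lattice L2" "L1 \<subseteq> L2"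
      and cov: "lattice_covering L1 \<pi>1" "lattice_covering L2 \<pi>2" and comp: "f \<circ> \<pi>1 = \<pi>2"
      and im: "\<pi>1 ` L1 = noncritical_preimages f" "\<pi>2 ` L2 = postcritical_set f"
      and iso: "(lattice_group L2 Mod L1) \<cong> (integer_mod_group m \<times>\<times> integer_mod_group n)"
    using f(3) unfolding elementary_divisors_def by blast
  interpret A1: lattice_fibres L1 \<pi>1 by (rule lattice_fibres_of_covering[OF lat(1) cov(1)])
  interpret A2: lattice_fibres L2 \<pi>2 by (rule lattice_fibres_of_covering[OF lat(2) cov(2)])
  obtain \<theta>1 \<theta>2 where "lattice_coordinates L1 L2 \<theta>1 \<theta>2 m n"
    by (rule lattice_coordinates_exist[OF lat(3) pos A1.diff_mem A1.zero_mem A2.diff_mem iso])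
  then interpret T: lattice_coordinates L1 L2 \<theta>1 \<theta>2 m n .
  obtain R where R: "finite R" "R \<subseteq> L2" "card R = m * n" "\<And>l. l \<in> L2 \<Longrightarrow> \<exists>!r. r \<in> R \<and> l - r \<in> L1"
    using T.transversal_exists by blast
  interpret coordinate_pair L1 \<pi>1 L2 \<pi>2 f R \<theta>1 \<theta>2 m n
    by unfold_locales (use lat(3) comp R in auto)
  have rng: "range \<pi>1 = S2"
    using cov(1) unfolding lattice_covering_def branched_covering_def points_plane points_two_sphere by blast
  \<comment> \<open>The prescribed image of \<open>L1\<close> in the definition of elementary
    divisors identifies the critical points, so no local degree of \<open>f\<close> has to be
    computed here.\<close>
  have crit: "critical_set f = \<pi>1 ` (L2 - L1)"
  proof (intro subset_antisym subsetI)
    fix z assume z: "z \<in> critical_set f"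
    then have "z \<in> range \<pi>1" unfolding rng critical_set_def by blast
    then obtain q where q: "z = \<pi>1 q" by blast
    have "f z \<in> postcritical_set f"
      unfolding postcritical_set_def using z by (intro UN_I[of 1]) auto
    then have "\<pi>2 q \<in> \<pi>2 ` L2" unfolding im(2) q f_F1 .
    then have "q \<in> L2" using A2.fibre_mem_iff by blast
    moreover have "q \<notin> L1" using z q im(1) unfolding noncritical_preimages_def by blast
    ultimately show "z \<in> \<pi>1 ` (L2 - L1)" using q by blast
  next
    fix z assume "z \<in> \<pi>1 ` (L2 - L1)"
    then obtain q where q: "z = \<pi>1 q" "q \<in> L2" "q \<notin> L1" by blast
    have "f z \<in> postcritical_set f" unfolding im(2)[symmetric] q(1) f_F1 using q(2) by (rule imageI)
    moreover have "z \<in> S2" unfolding rng[symmetric] q(1) by simp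
    moreover have "z \<notin> \<pi>1 ` L1" unfolding q(1) F1_mem_noncritical by (rule q(3))
    ultimately show "z \<in> critical_set f" unfolding im(1) noncritical_preimages_def by blast
  qed
  have four: "card (\<pi>2 ` L2) = 4" using f(1) im(2) unfolding NET_map_def by simp
  have fin: "finite (\<pi>2 ` L2)" using four by (metis card.infinite zero_neq_numeral)
  have "{y \<in> postcritical_set f. 2 * card {z \<in> critical_set f. f z = y} = d} = \<pi>2 ` L2 - \<pi>2 ` L1"
    unfolding im(2)[symmetric] crit using fully_ramified_iff R(3) mn(2) by auto
  then have full: "card full = 4 - card (\<pi>2 ` L1)"
    unfolding card_full_portrait[OF f(1,2)] four[symmetric]
    using card_Diff_subset[OF finite_subset[OF image_mono[OF lat(3)] fin] image_mono[OF lat(3)]] by simp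
  \<comment> \<open>Odd \<open>m\<close> with even \<open>n\<close> is excluded by
    \<open>n dvd m\<close>.\<close>
  consider "odd m" "odd n" | "even m" "odd n" | "even m" "even n"
    using dvd_trans[OF _ mn(1), of 2] by blast
  then show ?thesis
  proof cases
    case 1
    then have "card full = 0" using full four image_odd by simp
    then show ?thesis using 1 unfolding mod2_elementary_divisors_eq by (simp add: cong_def odd_iff_mod_2_eq_one)
  next
    case 2
    then have "even d" using mn(2) by auto
    \<comment> \<open>For even \<open>d\<close> the portrait allows only 2 or 3 full vertices, so
      excluding 3 gives 2 without determining the image of \<open>L1\<close>.\<close>
    moreover have "card full \<noteq> 3" using full image_even_odd[OF 2 four] by auto
    ultimately have "card full = 2" using defect_even by blast
    then show ?thesis using 2 unfolding mod2_elementary_divisors_eq by (simp add: cong_def odd_iff_mod_2_eq_one)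
  next
    case 3
    then have "card full = 3" using full image_even[OF 3 four] by simp
    then show ?thesis using 3 unfolding mod2_elementary_divisors_eq by (simp add: cong_def)
  qed
qed

section \<open>The pillowcase\<close>

text \<open>All three coordinates are invariant under \<open>x |-> - x\<close> and under
  translations by \<open>(2 m, 0)\<close> and \<open>(0, 2 n)\<close>. The cosines fold the plane
  onto a square, and the product of sines tells the two faces of the pillow apart.\<close>

definition pillow :: "real \<Rightarrow> real \<Rightarrow> real^2 \<Rightarrow> real^3" where
  "pillow m n x = vector [cos (pi * (x $ 1 / m)), cos (pi * (x $ 2 / n)), sin (pi * (x $ 1 / m)) * sin (pi * (x $ 2 / n))]"

definition pillow_map :: "real \<Rightarrow> real \<Rightarrow> real^2 \<Rightarrow> real^3" where
  "pillow_map m n x = (1 / norm (pillow m n x)) *\<^sub>R pillow m n x"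

definition rect_lattice :: "real \<Rightarrow> real \<Rightarrow> (real^2) set" where
  "rect_lattice m n = {x. x $ 1 / m \<in> \<int> \<and> x $ 2 / n \<in> \<int>}"

text \<open>
  The surface \<open>z\<^sup>2 = (1 - a\<^sup>2) (1 - b\<^sup>2)\<close> over the square is a topological sphere that is star-shaped
  with respect to the origin, because the left side increases and the right side decreases along rays.
\<close>

lemma pillow_equation:
  "(pillow m n x $ 3)\<^sup>2 = (1 - (pillow m n x $ 1)\<^sup>2) * (1 - (pillow m n x $ 2)\<^sup>2)"
  by (simp add: pillow_def sin_squared_eq power_mult_distrib)

lemma pillow_bounds: "(pillow m n x $ 1)\<^sup>2 \<le> 1" "(pillow m n x $ 2)\<^sup>2 \<le> 1"
  by (simp_all add: pillow_def abs_square_le_1)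

lemma pillow_nonzero: "pillow m n x \<noteq> 0"
proof
  assume "pillow m n x = 0"
  then show False using pillow_equation[of m n x] by simp
qed

lemma star_shaped:
  fixes a b c :: real
  assumes "a\<^sup>2 \<le> 1" "b\<^sup>2 \<le> 1" "0 < c" "c < 1"
  shows "c\<^sup>2 * ((1 - a\<^sup>2) * (1 - b\<^sup>2)) < (1 - (c * a)\<^sup>2) * (1 - (c * b)\<^sup>2)"
proof -
  have c2: "c\<^sup>2 < 1" using assms by (simp add: power_less_one_iff)
  have "c\<^sup>2 * a\<^sup>2 \<le> c\<^sup>2 * 1" "c\<^sup>2 * b\<^sup>2 \<le> c\<^sup>2 * 1" using assms by (auto intro: mult_left_mono)
  then have pos: "0 < 1 - (c * a)\<^sup>2" "0 < 1 - (c * b)\<^sup>2" using c2 by (auto simp: power_mult_distrib)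
  have le: "1 - a\<^sup>2 \<le> 1 - (c * a)\<^sup>2" "1 - b\<^sup>2 \<le> 1 - (c * b)\<^sup>2"
    using c2 by (auto simp: power_mult_distrib mult_left_le_one_le)
  have "(1 - a\<^sup>2) * (1 - b\<^sup>2) \<le> (1 - (c * a)\<^sup>2) * (1 - (c * b)\<^sup>2)"
    using assms le pos by (intro mult_mono) auto
  moreover have "0 \<le> (1 - a\<^sup>2) * (1 - b\<^sup>2)" using assms by simp
  moreover have "0 < (1 - (c * a)\<^sup>2) * (1 - (c * b)\<^sup>2)" using pos by simp
  ultimately show ?thesis
  \<comment> \<open>Strictness has two sources: \<open>c^2 < 1\<close> if the product is positive,
    and positivity of the right-hand side if the point lies over the boundary of the square.\<close>
  proof (cases "(1 - a\<^sup>2) * (1 - b\<^sup>2) = 0")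
    case False
    then have "0 < (1 - a\<^sup>2) * (1 - b\<^sup>2)" using \<open>0 \<le> (1 - a\<^sup>2) * (1 - b\<^sup>2)\<close> by (simp only: less_le) simp
    with c2 have "c\<^sup>2 * ((1 - a\<^sup>2) * (1 - b\<^sup>2)) < 1 * ((1 - a\<^sup>2) * (1 - b\<^sup>2))"
      by (rule mult_strict_right_mono)
    then show ?thesis using \<open>(1 - a\<^sup>2) * (1 - b\<^sup>2) \<le> (1 - (c * a)\<^sup>2) * (1 - (c * b)\<^sup>2)\<close> by simp
  next
    case True
    show ?thesis unfolding True using \<open>0 < (1 - (c * a)\<^sup>2) * (1 - (c * b)\<^sup>2)\<close> by simp
  qed
qed

lemma pillow_ray:
  assumes "pillow m n x = c *\<^sub>R pillow m n y" "0 < c"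
  shows "\<not> c < 1"
proof
  assume "c < 1"
  have "pillow m n x $ i = c * pillow m n y $ i" for i using assms(1) by simp
  then show False
    using star_shaped[OF pillow_bounds(1)[of m n y] pillow_bounds(2)[of m n y] assms(2) \<open>c < 1\<close>] pillow_equation[of m n x] pillow_equation[of m n y]
    by (simp add: power_mult_distrib)
qed

text \<open>Two surface points on one ray differ by a factor \<open>c\<close>; exchanging them
  replaces \<open>c\<close> by \<open>1 / c\<close>, so \<open>pillow_ray\<close> excludes both
  \<open>c < 1\<close> and \<open>c > 1\<close>.\<close>

lemma pillow_map_eq_iff: "pillow_map m n x = pillow_map m n y \<longleftrightarrow> pillow m n x = pillow m n y"
proof
  assume eq: "pillow_map m n x = pillow_map m n y"
  define c where "c = norm (pillow m n x) / norm (pillow m n y)"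
  have pos: "0 < norm (pillow m n x)" "0 < norm (pillow m n y)" using pillow_nonzero by auto
  have c: "0 < c" using pos by (simp add: c_def)
  have "norm (pillow m n x) *\<^sub>R pillow_map m n x = norm (pillow m n x) *\<^sub>R pillow_map m n y" using eq by simp
  then have 1: "pillow m n x = c *\<^sub>R pillow m n y"
    using pos by (simp add: pillow_map_def c_def)
  then have "pillow m n y = (1 / c) *\<^sub>R pillow m n x" using c by simp
  then have "\<not> 1 / c < 1" by (rule pillow_ray) (use c in simp)
  moreover have "\<not> c < 1" using pillow_ray[OF 1 c] .
  ultimately have "c = 1" using c by (simp add: divide_less_eq)
  then show "pillow m n x = pillow m n y" using 1 by simp
qed (simp add: pillow_map_def)

lemma cos_pi_shift: "cos (pi * (a + 2 * of_int k)) = cos (pi * a)"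
  and sin_pi_shift: "sin (pi * (a + 2 * of_int k)) = sin (pi * a)"
proof -
  have "pi * (a + 2 * of_int k) = pi * a + 2 * pi * of_int k" by (simp add: algebra_simps)
  then show "cos (pi * (a + 2 * of_int k)) = cos (pi * a)" "sin (pi * (a + 2 * of_int k)) = sin (pi * a)"
    by (simp_all only: cos_add sin_add cos_int_2pin sin_int_2pin mult_1_right mult_zero_right diff_0_right add_0_right)
qed

lemma pillow_eq_imp:
  assumes mn: "m > 0" "n > 0" and eq: "pillow m n x = pillow m n y"
  shows "\<exists>l \<in> rect_lattice m n. y = 2 *\<^sub>R l + x \<or> y = 2 *\<^sub>R l - x"
proof -
  define s t s' t' where st: "s = x $ 1 / m" "t = x $ 2 / n" "s' = y $ 1 / m" "t' = y $ 2 / n"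
  have c: "cos (pi * s') = cos (pi * s)" "cos (pi * t') = cos (pi * t)"
    "sin (pi * s') * sin (pi * t') = sin (pi * s) * sin (pi * t)"
    using eq unfolding pillow_def st by (simp_all add: vec_eq_iff forall_3)
  have cosD: "\<exists>k \<in> \<int>. b = a + 2 * k \<or> b = - a + 2 * k" if ab: "cos (pi * b) = cos (pi * a)" for a b :: real
  proof -
    obtain k where "k \<in> \<int>" "pi * b = pi * a + 2 * k * pi \<or> pi * b = - (pi * a) + 2 * k * pi"
      using ab unfolding cos_eq by blast
    moreover have "pi * a + 2 * k * pi = pi * (a + 2 * k)" "- (pi * a) + 2 * k * pi = pi * (- a + 2 * k)"
      by (simp_all add: algebra_simps)
    ultimately have "pi * b = pi * (a + 2 * k) \<or> pi * b = pi * (- a + 2 * k)" by (simp only:)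
    then have "b = a + 2 * k \<or> b = - a + 2 * k" unfolding mult_cancel_left by simp
    then show ?thesis using \<open>k \<in> \<int>\<close> by (rule bexI)
  qed
  obtain k where k: "k \<in> \<int>" "s' = s + 2 * k \<or> s' = - s + 2 * k" using cosD[OF c(1)] by blast
  obtain j where j: "j \<in> \<int>" "t' = t + 2 * j \<or> t' = - t + 2 * j" using cosD[OF c(2)] by blast
  have sinp: "sin (pi * (a + 2 * k)) = sin (pi * a)" if "k \<in> \<int>" for a k :: real
    using that by (elim Ints_cases) (simp only: sin_pi_shift)
  have int: "a \<in> \<int>" if a: "sin (pi * a) = 0" for a :: real
  proof -
    obtain i where "pi * a = of_int i * pi" using a unfolding sin_zero_iff_int2 by blast
    then have "a = of_int i" by simp
    then show ?thesis by simp
  qed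
  have "\<exists>k j. k \<in> \<int> \<and> j \<in> \<int> \<and> (s' = s + 2 * k \<and> t' = t + 2 * j \<or> s' = - s + 2 * k \<and> t' = - t + 2 * j)"
  proof -
    \<comment> \<open>Equal cosines give \<open>s' = +- s\<close> and \<open>t' = +- t\<close> up to
      even integers. With opposite signs, the product of the sines changes sign and so vanishes;
      then \<open>s\<close> or \<open>t\<close> is an integer and its sign can be absorbed into the
      even integer.\<close>
    consider "s' = s + 2 * k" "t' = t + 2 * j" | "s' = - s + 2 * k" "t' = - t + 2 * j"
      | "s' = s + 2 * k" "t' = - t + 2 * j" | "s' = - s + 2 * k" "t' = t + 2 * j"
      using k(2) j(2) by blast
    then show ?thesis
    proof cases
      case 3
      then have "sin (pi * s') = sin (pi * s)" "sin (pi * t') = - sin (pi * t)"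
        using sinp[OF k(1), of s] sinp[OF j(1), of "- t"] by simp_all
      then have "sin (pi * s) = 0 \<or> sin (pi * t) = 0" using c(3) by simp
      then consider "s \<in> \<int>" | "t \<in> \<int>" using int by blast
      then show ?thesis
      proof cases
        case 1
        have "s' = - s + 2 * (k + s)" using 3(1) by simp
        moreover have "k + s \<in> \<int>" using 1 k(1) by (rule Ints_add[rotated])
        ultimately show ?thesis using 3(2) j(1) by blast
      next
        case 2
        have "t' = t + 2 * (j - t)" using 3(2) by simp
        moreover have "j - t \<in> \<int>" using j(1) 2 by (rule Ints_diff)
        ultimately show ?thesis using 3(1) k(1) by blast
      qed
    next
      case 4
      then have "sin (pi * t') = sin (pi * t)" "sin (pi * s') = - sin (pi * s)"
        using sinp[OF j(1), of t] sinp[OF k(1), of "- s"] by simp_all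
      then have "sin (pi * s) = 0 \<or> sin (pi * t) = 0" using c(3) by simp
      then consider "s \<in> \<int>" | "t \<in> \<int>" using int by blast
      then show ?thesis
      proof cases
        case 1
        have "s' = s + 2 * (k - s)" using 4(1) by simp
        moreover have "k - s \<in> \<int>" using k(1) 1 by (rule Ints_diff)
        ultimately show ?thesis using 4(2) j(1) by blast
      next
        case 2
        have "t' = - t + 2 * (j + t)" using 4(2) by simp
        moreover have "j + t \<in> \<int>" using j(1) 2 by (rule Ints_add)
        ultimately show ?thesis using 4(1) k(1) by blast
      qed
    qed (use k(1) j(1) in blast)+
  qed
  then obtain k j where kj: "k \<in> \<int>" "j \<in> \<int>"
    "s' = s + 2 * k \<and> t' = t + 2 * j \<or> s' = - s + 2 * k \<and> t' = - t + 2 * j" by blast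
  define l :: "real^2" where "l = vector [m * k, n * j]"
  have x: "x $ 1 = m * s" "x $ 2 = n * t" "y $ 1 = m * s'" "y $ 2 = n * t'" using mn by (simp_all add: st)
  have "l \<in> rect_lattice m n" using mn kj by (simp add: rect_lattice_def l_def)
  moreover have "y = 2 *\<^sub>R l + x \<or> y = 2 *\<^sub>R l - x"
  proof (rule disj_forward[OF kj(3)])
    assume "s' = s + 2 * k \<and> t' = t + 2 * j"
    then show "y = 2 *\<^sub>R l + x" by (simp add: vec_eq_iff forall_2 x l_def distrib_left)
  next
    assume "s' = - s + 2 * k \<and> t' = - t + 2 * j"
    then show "y = 2 *\<^sub>R l - x" by (simp add: vec_eq_iff forall_2 x l_def right_diff_distrib)
  qed
  ultimately show ?thesis by blast
qed

lemma pillow_symmetric: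
  assumes l: "l \<in> rect_lattice m n" and y: "y = 2 *\<^sub>R l + x \<or> y = 2 *\<^sub>R l - x"
  shows "pillow m n y = pillow m n x"
proof -
  obtain k j where kj: "l $ 1 / m = of_int k" "l $ 2 / n = of_int j"
    using l unfolding rect_lattice_def by (auto elim!: Ints_cases)
  from y show ?thesis
  proof
    assume "y = 2 *\<^sub>R l + x"
    then have "y $ 1 / m = x $ 1 / m + 2 * of_int k" "y $ 2 / n = x $ 2 / n + 2 * of_int j"
      by (simp_all add: kj[symmetric] add_divide_distrib)
    then show ?thesis unfolding pillow_def by (simp only: cos_pi_shift sin_pi_shift)
  next
    assume "y = 2 *\<^sub>R l - x"
    then have *: "y $ 1 / m = - (x $ 1 / m) + 2 * of_int k" "y $ 2 / n = - (x $ 2 / n) + 2 * of_int j"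
      by (simp_all add: kj[symmetric] diff_divide_distrib)
    show ?thesis unfolding pillow_def * cos_pi_shift sin_pi_shift by simp
  qed
qed

lemma lattice_fibres_pillow:
  assumes mn: "m > 0" "n > 0" shows "lattice_fibres (rect_lattice m n) (pillow_map m n)"
proof
  show "pillow_map m n x = pillow_map m n y \<longleftrightarrow>
      (\<exists>l \<in> rect_lattice m n. y = 2 *\<^sub>R l + x \<or> y = 2 *\<^sub>R l - x)" for x y
    unfolding pillow_map_eq_iff
  proof
    assume "\<exists>l \<in> rect_lattice m n. y = 2 *\<^sub>R l + x \<or> y = 2 *\<^sub>R l - x"
    then obtain l where "l \<in> rect_lattice m n" "y = 2 *\<^sub>R l + x \<or> y = 2 *\<^sub>R l - x" by (rule bexE)
    from pillow_symmetric[OF this] show "pillow m n x = pillow m n y" by (rule sym)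
  qed (rule pillow_eq_imp[OF mn])
qed (auto simp: rect_lattice_def diff_divide_distrib)

text \<open>The ray through \<open>y\<close> meets the surface by the intermediate value theorem,
  and arccosines give the plane coordinates of the point hit.\<close>

lemma pillow_map_onto:
  assumes mn: "m > 0" "n > 0" and y: "y \<in> S2"
  obtains x where "0 \<le> x $ 1" "x $ 1 \<le> m" "- n \<le> x $ 2" "x $ 2 \<le> n" "pillow_map m n x = y"
proof -
  have ny: "norm y = 1" using y by simp
  obtain c where c: "0 < c" "(c * y $ 1)\<^sup>2 \<le> 1" "(c * y $ 2)\<^sup>2 \<le> 1"
    "(c * y $ 3)\<^sup>2 = (1 - (c * y $ 1)\<^sup>2) * (1 - (c * y $ 2)\<^sup>2)"
  proof (cases "y $ 1 = 0 \<and> y $ 2 = 0")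
    case True
    then have "(y $ 3)\<^sup>2 = 1" using ny by (simp add: norm_vec_def L2_set_def sum_3 real_sqrt_eq_1_iff abs_square_eq_1)
    then show thesis using that[of 1] True by simp
  next
    case False
    \<comment> \<open>The ray leaves the square at the parameter \<open>1 / M\<close>. There one
      factor of the product vanishes, so \<open>h\<close> is nonnegative, while it is negative at
      0.\<close>
    define M where "M = max \<bar>y $ 1\<bar> \<bar>y $ 2\<bar>"
    have M: "0 < M" using False by (auto simp: M_def less_max_iff_disj)
    define h where "h c = (c * y $ 3)\<^sup>2 - (1 - (c * y $ 1)\<^sup>2) * (1 - (c * y $ 2)\<^sup>2)" for c
    have bd: "(c * y $ i)\<^sup>2 \<le> 1" if "0 \<le> c" "c \<le> 1 / M" "i = 1 \<or> i = 2" for c and i :: 3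
    proof -
      have "\<bar>c * y $ i\<bar> \<le> (1 / M) * M"
        unfolding abs_mult using that M by (intro mult_mono) (auto simp: M_def)
      then show ?thesis using M by (simp add: abs_square_le_1)
    qed
    have "h 0 \<le> 0" by (simp add: h_def)
    moreover have "0 \<le> h (1 / M)"
    proof -
      have sq: "(1 / M * a)\<^sup>2 = (\<bar>a\<bar> / M)\<^sup>2" for a by (simp add: power_divide)
      have "\<bar>y $ 1\<bar> = M \<or> \<bar>y $ 2\<bar> = M" by (simp add: M_def max_def)
      then show ?thesis unfolding h_def sq using M by (elim disjE) simp_all
    qed
    moreover have "continuous_on {0..1 / M} h" unfolding h_def by (intro continuous_intros)
    ultimately obtain c where c: "0 \<le> c" "c \<le> 1 / M" "h c = 0"
      using IVT'[of h 0 0 "1 / M"] M by auto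
    have "c \<noteq> 0" using c(3) by (auto simp: h_def)
    then show thesis using that[of c] c bd[OF c(1,2)] by (auto simp: h_def)
  qed
  define a b where ab: "a = c * y $ 1" "b = c * y $ 2"
  have ab1: "\<bar>a\<bar> \<le> 1" "\<bar>b\<bar> \<le> 1" using c(2,3) by (simp_all add: ab abs_square_le_1)
  define s t where st: "s = arccos a / pi" "t = arccos b / pi"
  have s: "0 \<le> s" "s \<le> 1" "cos (pi * s) = a" "sin (pi * s) = sqrt (1 - a\<^sup>2)"
    using ab1(1) arccos_lbound[of a] arccos_ubound[of a] by (auto simp: st abs_le_iff sin_arccos_abs cos_arccos_abs)
  have t: "0 \<le> t" "t \<le> 1" "cos (pi * t) = b" "sin (pi * t) = sqrt (1 - b\<^sup>2)"
    using ab1(2) arccos_lbound[of b] arccos_ubound[of b] by (auto simp: st abs_le_iff sin_arccos_abs cos_arccos_abs)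
  have "(c * y $ 3)\<^sup>2 = (sin (pi * s))\<^sup>2 * (sin (pi * t))\<^sup>2"
    unfolding c(4) s(4) t(4) using ab1 by (simp add: ab[symmetric] abs_square_le_1)
  then have "(c * y $ 3)\<^sup>2 = (sin (pi * s) * sin (pi * t))\<^sup>2"
    unfolding power_mult_distrib[of "sin (pi * s)"] .
  then have "c * y $ 3 = 1 * (sin (pi * s) * sin (pi * t)) \<or> c * y $ 3 = - 1 * (sin (pi * s) * sin (pi * t))"
    unfolding power2_eq_iff by simp
  moreover have "\<bar>1 :: real\<bar> = 1" "\<bar>- 1 :: real\<bar> = 1" by simp_all
  \<comment> \<open>The surface equation fixes the third coordinate up to sign. Replacing
    \<open>t\<close> by \<open>e * t\<close> keeps the cosine and multiplies the sine by
    \<open>e\<close>, which selects the correct face.\<close>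
  ultimately obtain e :: real where e: "\<bar>e\<bar> = 1" "c * y $ 3 = e * (sin (pi * s) * sin (pi * t))" by blast
  have eab: "cos (pi * (e * t)) = b" "sin (pi * (e * t)) = e * sin (pi * t)"
    using e(1) t(3) by (auto simp: abs_if split: if_splits)
  define x :: "real^2" where "x = vector [m * s, n * (e * t)]"
  have "pillow m n x = c *\<^sub>R y"
    unfolding vec_eq_iff forall_3 pillow_def
    using mn s(3) eab e(2) by (simp add: x_def ab)
  then have "pillow_map m n x = y" using c(1) ny by (simp add: pillow_map_def)
  moreover have "\<bar>e * t\<bar> \<le> 1" using e(1) t by (simp add: abs_mult)
  then have "\<bar>n * (e * t)\<bar> \<le> n" using mn by (simp add: abs_mult mult_left_le)
  moreover have "0 \<le> m * s" "m * s \<le> m" using mn s by (auto simp: mult_left_le)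
  ultimately show thesis by (intro that[of x]) (auto simp: x_def abs_le_iff)
qed

lemma continuous_on_pillow_map:
  assumes mn: "m > 0" "n > 0" shows "continuous_on S (pillow_map m n)"
proof -
  have "continuous_on S (pillow m n)"
    unfolding pillow_def using mn by (intro continuous_on_vec3) (auto intro!: continuous_intros)
  then show ?thesis
    unfolding pillow_map_def using pillow_nonzero by (intro continuous_intros) auto
qed

lemma pillow_map_S2: "pillow_map m n x \<in> S2"
  using pillow_nonzero[of m n x] by (simp add: pillow_map_def)

text \<open>Used twice: for a disc on which the quotient map is injective, where the orientation is
  tested, and for the lower bound on lattice vectors.\<close>

lemma isolating_centre:
  assumes mn: "m > 0" "n > 0"
  shows "isolating (rect_lattice m n) (vector [m / 2, n / 2]) (min m n / 2)"
  unfolding isolating_def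
proof (intro conjI ballI impI)
  show "0 < min m n / 2" using mn by simp
  fix l assume l: "l \<in> rect_lattice m n"
  then obtain k j where kj: "l $ 1 = m * of_int k" "l $ 2 = n * of_int j"
    using mn unfolding rect_lattice_def by (auto elim!: Ints_cases simp: field_simps)
  {
    assume "norm l < min m n / 2"
    then have "\<bar>l $ 1\<bar> < m" "\<bar>l $ 2\<bar> < n" using mn component_le_norm_cart[of l 1] component_le_norm_cart[of l 2] by auto
    then have "m * \<bar>of_int k\<bar> < m * 1" "n * \<bar>of_int j\<bar> < n * 1" using mn by (simp_all add: kj abs_mult)
    then have "\<bar>real_of_int k\<bar> < 1" "\<bar>real_of_int j\<bar> < 1" using mn by (simp_all only: mult_less_cancel_left_pos)
    then have "k = 0" "j = 0" by linarith+
    then show "l = 0" by (simp add: vec_eq_iff forall_2 kj)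
  next
    assume "dist (vector [m / 2, n / 2]) l < min m n / 2"
    then have "\<bar>m / 2 - l $ 1\<bar> < m / 2"
      using component_le_norm_cart[of "vector [m / 2, n / 2] - l" 1] by (simp add: dist_norm)
    then have "m * 0 < m * of_int k" "m * of_int k < m * 1" unfolding kj by linarith+
    then have "(0::real) < of_int k" "real_of_int k < 1" using mn by (simp_all only: mult_less_cancel_left_pos)
    then have "0 < k" "k < 1" by simp_all
    then have False by linarith
    then show "l = vector [m / 2, n / 2]" ..
  }
qed

lemma stereo_pillow:
  assumes "0 < pillow m n x $ 3"
  shows "stereo_south (pillow_map m n x) =
    Complex (pillow m n x $ 1) (pillow m n x $ 2) / of_real (norm (pillow m n x) + pillow m n x $ 3)"
proof -
  define N where "N = norm (pillow m n x)"
  have N: "0 < N" using pillow_nonzero[of m n x] by (simp add: N_def)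
  have "1 + pillow m n x $ 3 / N = (N + pillow m n x $ 3) / N" using N by (simp add: field_simps)
  then show ?thesis
    unfolding stereo_south_def pillow_map_def N_def[symmetric]
    using N assms by (simp add: complex_eq_iff Re_divide_of_real Im_divide_of_real)
qed

text \<open>Near the centre the third coordinate is positive, so the chart from the south pole
  applies and the map reads \<open>- (sin (pi * Re w / m), sin (pi * Im w / n)) / N\<close> with
  \<open>N > 0\<close>. Its inner product with \<open>- w\<close> is positive since
  \<open>u * sin (pi * u / k) > 0\<close> for small nonzero \<open>u\<close>; hence the multiplier
  \<open>- 1\<close>.\<close>

lemma positive_sphere_pillow:
  assumes mn: "m > 0" "n > 0"
  shows "positive_sphere (pillow_map m n \<circ> vx) (cx (vector [m / 2, n / 2]))"
proof -
  interpret lattice_fibres "rect_lattice m n" "pillow_map m n" by (rule lattice_fibres_pillow[OF mn])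
  define p :: "real^2" where "p = vector [m / 2, n / 2]"
  define \<delta> where "\<delta> = min m n / 2"
  have \<delta>: "0 < \<delta>" "\<delta> \<le> m / 2" "\<delta> \<le> n / 2" using mn by (auto simp: \<delta>_def)
  have iso: "isolating (rect_lattice m n) p \<delta>" unfolding p_def \<delta>_def by (rule isolating_centre[OF mn])
  have "p \<notin> rect_lattice m n"
  proof
    assume "p \<in> rect_lattice m n"
    then have "(1 / 2 :: real) \<in> \<int>" using mn by (simp add: rect_lattice_def p_def)
    then obtain k where "(1 / 2 :: real) = of_int k" by (rule Ints_cases)
    then have "1 = 2 * k" by linarith
    then show False by presburger
  qed
  then have inj: "inj_on (pillow_map m n) (ball p \<delta>)" using isolating_inj_on[OF iso] by blast
  have Gcont: "continuous_on S (pillow_map m n \<circ> vx)" for S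
    by (intro continuous_on_compose continuous_on_pillow_map[OF mn] continuous_on_vx continuous_on_id)
  have coord: "pillow m n (vx (cx p + w)) $ 1 = - sin (pi * (Re w / m))"
      "pillow m n (vx (cx p + w)) $ 2 = - sin (pi * (Im w / n))"
      "pillow m n (vx (cx p + w)) $ 3 = cos (pi * (Re w / m)) * cos (pi * (Im w / n))" for w
  proof -
    have 1: "vx (cx p + w) $ 1 = m / 2 + Re w" "vx (cx p + w) $ 2 = n / 2 + Im w"
      by (simp_all add: vx_def cx_def p_def)
    have 2: "pi * ((m / 2 + Re w) / m) = pi * (Re w / m) + pi / 2" "pi * ((n / 2 + Im w) / n) = pi * (Im w / n) + pi / 2"
      using mn by (simp_all add: field_simps)
    have 3: "cos (a + pi / 2) = - sin a" "sin (a + pi / 2) = cos a" for a :: real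
      by (simp_all add: cos_add sin_add)
    show "pillow m n (vx (cx p + w)) $ 1 = - sin (pi * (Re w / m))"
      "pillow m n (vx (cx p + w)) $ 2 = - sin (pi * (Im w / n))"
      "pillow m n (vx (cx p + w)) $ 3 = cos (pi * (Re w / m)) * cos (pi * (Im w / n))"
      unfolding pillow_def 1 2 3 by simp_all
  qed
  have small: "\<bar>pi * (Re w / m)\<bar> < pi / 2 \<and> \<bar>pi * (Im w / n)\<bar> < pi / 2" if "norm w < \<delta>" for w
  proof -
    have "\<bar>Re w\<bar> < m / 2" "\<bar>Im w\<bar> < n / 2"
      using that \<delta> abs_Re_le_cmod[of w] abs_Im_le_cmod[of w] by auto
    then show ?thesis using mn by (simp add: abs_mult abs_divide field_simps)
  qed
  have pos3: "0 < pillow m n (vx (cx p + w)) $ 3" if "norm w < \<delta>" for w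
    unfolding coord using small[OF that] by (intro mult_pos_pos cos_gt_zero_pi) linarith+
  have D: "(S2 - {- axis 3 1}, stereo_south) \<in> two_sphere" by (simp add: two_sphere_def)
  have inD: "(pillow_map m n \<circ> vx) z \<in> S2 - {- axis 3 1}" if "z \<in> ball (cx p) \<delta>" for z
  proof -
    have "norm (z - cx p) < \<delta>" using that by (simp add: dist_norm norm_minus_commute)
    from pos3[OF this] have "0 < pillow m n (vx z) $ 3" by simp
    then have "0 < pillow_map m n (vx z) $ 3" using pillow_nonzero[of m n "vx z"] by (simp add: pillow_map_def)
    then have "pillow_map m n (vx z) \<noteq> - axis 3 1" by (auto simp: axis_def)
    then show ?thesis using pillow_map_S2 by simp
  qed
  have im: "(pillow_map m n \<circ> vx) ` ball (cx p) \<delta> \<subseteq> S2" using inD by blast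
  have pos: "positive_at (stereo_south \<circ> (pillow_map m n \<circ> vx)) (cx p)"
    proof (rule positive_at_inner[OF \<delta>(1), of _ _ "- 1"])
      have "(pillow_map m n \<circ> vx) ` ball (cx p) \<delta> \<subseteq> S2 - {- axis 3 1}" by (rule image_subsetI) (rule inD)
      from continuous_on_subset[OF homeomorphism_cont1[OF homeomorphism_stereo_south] this]
      show "continuous_on (ball (cx p) \<delta>) (stereo_south \<circ> (pillow_map m n \<circ> vx))"
        by (rule continuous_on_compose[OF Gcont])
      fix w :: complex assume w: "0 < norm w" "norm w < \<delta>"
      let ?q = "pillow m n (vx (cx p + w))"
      define N where "N = norm ?q + ?q $ 3"
      have N: "0 < N" using pos3[OF w(2)] norm_ge_zero[of ?q] unfolding N_def by linarith
      have g: "stereo_south (pillow_map m n (vx (cx p + w))) =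
          Complex (- sin (pi * (Re w / m))) (- sin (pi * (Im w / n))) / of_real N"
        unfolding stereo_pillow[OF pos3[OF w(2)]] N_def coord ..
      have "norm (0 :: complex) < \<delta>" using \<delta> by simp
      then have g0: "stereo_south (pillow_map m n (vx (cx p))) = 0"
        using stereo_pillow[OF pos3[of 0]] coord[of 0] by (simp add: complex_eq_iff)
      have odd: "0 \<le> u * sin (pi * (u / k)) \<and> (u \<noteq> 0 \<longrightarrow> 0 < u * sin (pi * (u / k)))"
        if "k > 0" "\<bar>pi * (u / k)\<bar> < pi / 2" for u k :: real
      proof (cases u "0 :: real" rule: linorder_cases)
        case less
        then have "0 < - (pi * (u / k))" using \<open>k > 0\<close> by (simp add: divide_neg_pos mult_pos_neg)
        then have "0 < sin (- (pi * (u / k)))" by (rule sin_gt_zero) (use that(2) pi_gt_zero in linarith)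
        then show ?thesis using less by (intro conjI impI less_imp_le mult_neg_neg) simp_all
      next
        case greater
        then have "0 < pi * (u / k)" using \<open>k > 0\<close> by simp
        then have "0 < sin (pi * (u / k))" by (rule sin_gt_zero) (use that(2) pi_gt_zero in linarith)
        then show ?thesis using greater by simp
      qed simp
      have "0 < Re w * sin (pi * (Re w / m)) + Im w * sin (pi * (Im w / n))"
        using odd[OF mn(1), of "Re w"] odd[OF mn(2), of "Im w"] small[OF w(2)] w(1)
        by (cases "Re w = 0") (simp_all add: complex_eq_iff add_pos_nonneg)
      then have "0 < (Re w * sin (pi * (Re w / m)) + Im w * sin (pi * (Im w / n))) / N" using N by simp
      also have "\<dots> = Re (Complex (- sin (pi * (Re w / m))) (- sin (pi * (Im w / n))) / of_real N * cnj (- 1 * w))"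
        by (simp add: Re_divide_of_real Im_divide_of_real add_divide_distrib diff_divide_distrib mult.commute)
      also have "\<dots> = Re (((stereo_south \<circ> (pillow_map m n \<circ> vx)) (cx p + w) - (stereo_south \<circ> (pillow_map m n \<circ> vx)) (cx p)) * cnj (- 1 * w))"
        unfolding comp_apply g g0 diff_zero ..
      finally show "0 < Re (((stereo_south \<circ> (pillow_map m n \<circ> vx)) (cx p + w) - (stereo_south \<circ> (pillow_map m n \<circ> vx)) (cx p)) * cnj (- 1 * w))" .
    qed simp
  have "inj_on vx (ball (cx p) \<delta>)" by (rule inj_on_inverseI[of _ cx]) simp
  moreover have "inj_on (pillow_map m n) (vx ` ball (cx p) \<delta>)"
    using inj by (simp only: vx_image_ball vx_cx)
  ultimately have injG: "inj_on (pillow_map m n \<circ> vx) (ball (cx p) \<delta>)" by (rule comp_inj_on)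
  have c: "cx p \<in> ball (cx p) \<delta>" using \<delta> by simp
  show ?thesis
    unfolding p_def[symmetric] by (rule positive_sphereI[OF open_ball c Gcont injG im D inD[OF c] pos])
qed

lemma lattice_quotient_pillow:
  assumes mn: "m > 0" "n > 0" shows "lattice_quotient (rect_lattice m n) (pillow_map m n)"
proof -
  interpret lattice_fibres "rect_lattice m n" "pillow_map m n" by (rule lattice_fibres_pillow[OF mn])
  have onto: "y \<in> pillow_map m n ` cbox (vector [0, - n]) (vector [m, n])" if "y \<in> S2" for y
  proof -
    obtain x where "0 \<le> x $ 1" "x $ 1 \<le> m" "- n \<le> x $ 2" "x $ 2 \<le> n" "pillow_map m n x = y"
      using pillow_map_onto[OF mn \<open>y \<in> S2\<close>] by blast
    then show ?thesis by (intro image_eqI[of _ _ x]) (auto simp: mem_box_cart forall_2)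
  qed
  show ?thesis
  proof
    show "\<exists>\<delta>>0. \<forall>l \<in> rect_lattice m n. l \<noteq> 0 \<longrightarrow> \<delta> \<le> norm l"
      using isolating_centre[OF mn] unfolding isolating_def by (meson not_le)
    have "rect_lattice m n \<subseteq> (\<lambda>(k, j). vector [m * of_int k, n * of_int j]) ` (UNIV :: (int \<times> int) set)"
    proof
      fix l assume "l \<in> rect_lattice m n"
      then obtain k j where "l $ 1 / m = of_int k" "l $ 2 / n = of_int j"
        unfolding rect_lattice_def by (auto elim!: Ints_cases)
      then have "l = vector [m * of_int k, n * of_int j]" using mn by (simp add: vec_eq_iff forall_2 field_simps)
      then show "l \<in> (\<lambda>(k, j). vector [m * of_int k, n * of_int j]) ` (UNIV :: (int \<times> int) set)" by auto
    qed
    then show "countable (rect_lattice m n)" by (rule countable_subset) simp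
    show "continuous_on UNIV (pillow_map m n)" by (rule continuous_on_pillow_map[OF mn])
    show "\<exists>K. compact K \<and> pillow_map m n ` K = S2"
      using onto pillow_map_S2 by (intro exI[of _ "cbox (vector [0, - n]) (vector [m, n])"]) auto
    show "range (pillow_map m n) = S2" using onto pillow_map_S2 by blast
    have c: "vector [m / 2, n / 2] \<notin> rect_lattice m n"
    proof
      assume "vector [m / 2, n / 2] \<in> rect_lattice m n"
      then have "(1 / 2 :: real) \<in> \<int>" using mn by (simp add: rect_lattice_def)
      then obtain k where "(1 / 2 :: real) = of_int k" by (rule Ints_cases)
      then have "1 = 2 * k" by linarith
      then show False by presburger
    qed
    show "\<exists>p. p \<notin> rect_lattice m n \<and> positive_sphere (pillow_map m n \<circ> vx) (cx p)"
      using c positive_sphere_pillow[OF mn] by blast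
  qed
qed

section \<open>Realization of portraits\<close>

text \<open>Removing a point \<open>c\<close> away from all the given ones leaves a copy of the
  plane, where finitely many points can be moved by a homeomorphism with bounded support. It extends
  over \<open>c\<close> by the identity, which gives the fixed open set.\<close>

lemma S2_homeomorphism_moving_points:
  fixes x y :: "'i \<Rightarrow> real^3"
  assumes K: "finite K" and S: "x ` K \<subseteq> S2" "y ` K \<subseteq> S2" and inj: "inj_on x K" "inj_on y K"
  obtains H H' N where "homeomorphism S2 S2 H H'" "\<And>i. i \<in> K \<Longrightarrow> H (x i) = y i"
    "openin (top_of_set S2) N" "N \<noteq> {}" "\<And>z. z \<in> N \<Longrightarrow> H z = z"
proof -
  have "connected S2" by (rule connected_sphere) simp
  moreover have "axis 3 1 \<in> S2" "- axis 3 1 \<in> S2" by simp_all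
  moreover have "axis 3 1 \<noteq> (- axis 3 1 :: real^3)" by (simp add: vec_eq_iff axis_def)
  ultimately have "uncountable S2" by (rule connected_uncountable)
  moreover have "countable (x ` K \<union> y ` K)" using K by (simp add: countable_finite)
  ultimately have "\<not> S2 \<subseteq> x ` K \<union> y ` K" using countable_subset by blast
  then obtain c where c: "c \<in> S2" "c \<notin> x ` K" "c \<notin> y ` K" by blast
  define D where "D = S2 - {c}"
  have "D homeomorphic (UNIV :: complex set)"
    unfolding D_def by (rule homeomorphic_punctured_sphere_affine) (use c(1) in \<open>simp_all add: aff_dim_UNIV\<close>)
  then obtain k k' where kk: "homeomorphism D (UNIV :: complex set) k k'" unfolding homeomorphic_def by blast
  have kD: "k' w \<in> D" for w using homeomorphism_image2[OF kk] by blast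
  have k'k: "k' (k z) = z" if "z \<in> D" for z using homeomorphism_apply1[OF kk that] .
  have kk': "k (k' w) = w" for w using homeomorphism_apply2[OF kk] by simp
  have kcont: "continuous_on D k" "continuous_on UNIV k'"
    using homeomorphism_cont1[OF kk] homeomorphism_cont2[OF kk] by auto
  have xD: "x i \<in> D" "y i \<in> D" if "i \<in> K" for i using that S c unfolding D_def by auto
  have pw: "pairwise (\<lambda>i j. k (x i) \<noteq> k (x j) \<and> k (y i) \<noteq> k (y j)) K"
  proof (rule pairwiseI)
    fix i j assume ij: "i \<in> K" "j \<in> K" "i \<noteq> j"
    have "x i \<noteq> x j" "y i \<noteq> y j" using inj_onD[OF inj(1) _ ij(1,2)] inj_onD[OF inj(2) _ ij(1,2)] ij(3) by auto
    then show "k (x i) \<noteq> k (x j) \<and> k (y i) \<noteq> k (y j)"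
      using k'k[OF xD(1)[OF ij(1)]] k'k[OF xD(1)[OF ij(2)]] k'k[OF xD(2)[OF ij(1)]] k'k[OF xD(2)[OF ij(2)]] by metis
  qed
  obtain f g where fg: "homeomorphism (UNIV :: complex set) UNIV f g" "\<And>i. i \<in> K \<Longrightarrow> f (k (x i)) = k (y i)"
      "bounded {w. \<not> (f w = w \<and> g w = w)}"
    by (rule homeomorphism_moving_points_exists[of "UNIV :: complex set" UNIV K "\<lambda>i. k (x i)" "\<lambda>i. k (y i)"])
       (use K pw in auto)
  have fgcont: "continuous_on UNIV f" "continuous_on UNIV g"
    using homeomorphism_cont1[OF fg(1)] homeomorphism_cont2[OF fg(1)] by auto
  have fgi: "g (f w) = w" "f (g w) = w" for w
    using homeomorphism_apply1[OF fg(1)] homeomorphism_apply2[OF fg(1)] by auto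
  obtain b where b: "{w. \<not> (f w = w \<and> g w = w)} \<subseteq> cball 0 b"
    using bounded_subset_ballD[OF fg(3), of 0] ball_subset_cball by (meson subset_trans)
  \<comment> \<open>A neighbourhood of \<open>c\<close>: the complement of the compact image of a
    disc outside which both \<open>f\<close> and \<open>g\<close> are the identity.\<close>
  define N where "N = S2 - k' ` cball 0 b"
  have "compact (k' ` cball 0 b)"
    by (rule compact_continuous_image[OF continuous_on_subset[OF kcont(2)] compact_cball]) simp
  then have "closed (k' ` cball 0 b)" by (rule compact_imp_closed)
  then have "open (- (k' ` cball 0 b))" by (rule open_Compl)
  then have N: "openin (top_of_set S2) N" unfolding N_def Diff_eq by (rule openin_open_Int)
  have cN: "c \<in> N" using c(1) kD unfolding N_def D_def by blast
  have DN: "S2 = D \<union> N" unfolding D_def using cN openin_imp_subset[OF N] c(1) by blast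
  have Dopen: "openin (top_of_set S2) D" unfolding D_def by (rule openin_delete) simp
  \<comment> \<open>The planar map \<open>u\<close> transported to the sphere, fixing
    \<open>c\<close>. It is continuous on the two open sets \<open>D\<close> and \<open>N\<close>
    that cover the sphere, on \<open>N\<close> because it is the identity there.\<close>
  define E where "E u z = (if z = c then c else k' (u (k z)))" for u :: "complex \<Rightarrow> complex" and z
  have ED: "E u z = k' (u (k z))" if "z \<in> D" for u z using that unfolding E_def D_def by auto
  have EN: "E u z = z" if u: "u = f \<or> u = g" and z: "z \<in> N" for u z
  proof (cases "z = c")
    case False
    then have zD: "z \<in> D" using z openin_imp_subset[OF N] unfolding D_def by blast
    have "k z \<notin> cball 0 b" using z k'k[OF zD] unfolding N_def by (metis DiffD2 imageI)
    then have "f (k z) = k z \<and> g (k z) = k z" using b by blast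
    then show ?thesis using ED[OF zD] k'k[OF zD] u by auto
  qed (simp add: E_def)
  have Econt: "continuous_on S2 (E u)" if u: "u = f \<or> u = g" for u
  proof -
    have "continuous_on D (\<lambda>z. k' (u (k z)))"
    proof (rule continuous_on_compose2[OF kcont(2)])
      show "continuous_on D (\<lambda>z. u (k z))"
        by (rule continuous_on_compose2[of UNIV u, OF _ kcont(1)]) (use u fgcont in auto)
    qed simp
    then have 1: "continuous_on D (E u)" by (rule continuous_on_eq) (simp only: ED)
    have 2: "continuous_on N (E u)" by (rule continuous_on_eq[OF continuous_on_id]) (simp only: EN[OF u])
    show ?thesis
      unfolding DN by (rule continuous_on_Un_local_open[OF Dopen[unfolded DN] N[unfolded DN] 1 2])
  qed
  have Einto: "E u z \<in> S2" if "z \<in> S2" for u z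
    using c(1) kD[of "u (k z)"] unfolding E_def D_def by auto
  have EE: "E g (E f z) = z" "E f (E g z) = z" if z: "z \<in> S2" for z
  proof -
    have "E g (E f z) = z \<and> E f (E g z) = z"
    proof (cases "z = c")
      case False
      then have zD: "z \<in> D" using z unfolding D_def by simp
      show ?thesis unfolding ED[OF zD] ED[OF kD] kk' fgi k'k[OF zD] by simp
    qed (simp add: E_def)
    then show "E g (E f z) = z" "E f (E g z) = z" by auto
  qed
  have "homeomorphism S2 S2 (E f) (E g)"
    by (rule homeomorphismI[OF Econt Econt image_subsetI image_subsetI])
       (simp_all only: EE Einto simp_thms)
  moreover have "E f (x i) = y i" if "i \<in> K" for i
    unfolding ED[OF xD(1)[OF that]] fg(2)[OF that] by (rule k'k[OF xD(2)[OF that]])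
  moreover have "E f z = z" if "z \<in> N" for z using EN[of f z] that by simp
  moreover have "N \<noteq> {}" using cN by blast
  ultimately show thesis using N by (intro that[of "E f" "E g" N])
qed

text \<open>Fibres, openness data and range are unaffected by \<open>H\<close>. Orientation is
  needed at one point only, and it is taken over \<open>N\<close>, where \<open>H o F\<close> agrees
  with \<open>F\<close>.\<close>

lemma (in lattice_quotient) lattice_quotient_homeomorphism:
  assumes H: "homeomorphism S2 S2 H H'" and N: "openin (top_of_set S2) N" "N \<noteq> {}"
    and id: "\<And>z. z \<in> N \<Longrightarrow> H z = z"
  shows "lattice_quotient L (H \<circ> F)"
proof -
  have FS: "F x \<in> S2" for x unfolding range[symmetric] by simp
  have inv: "H' (H z) = z" if "z \<in> S2" for z using homeomorphism_apply1[OF H that] .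
  have "(H \<circ> F) x = (H \<circ> F) y \<longleftrightarrow> F x = F y" for x y
    using inv[OF FS[of x]] inv[OF FS[of y]] by (metis comp_apply)
  then have fib: "(H \<circ> F) x = (H \<circ> F) y \<longleftrightarrow> (\<exists>l \<in> L. y = 2 *\<^sub>R l + x \<or> y = 2 *\<^sub>R l - x)" for x y
    unfolding fibre .
  have HS: "H ` S2 = S2" by (rule homeomorphism_image1[OF H])
  obtain T where T: "open T" "N = S2 \<inter> T" using N(1) by (auto simp: openin_open)
  have FN: "F -` N = F -` T" unfolding T(2) using FS by auto
  have oN: "open (F -` N)" unfolding FN using T(1) cont by (rule open_vimage)
  obtain z where z: "z \<in> N" using N(2) by blast
  then have "z \<in> range F" unfolding range using openin_imp_subset[OF N(1)] by blast
  then obtain x0 where x0: "x0 \<in> F -` N" using z by blast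
  obtain e where e: "e > 0" "ball x0 e \<subseteq> F -` N" using oN x0 open_contains_ball by blast
  \<comment> \<open>A ball is uncountable, so the open set over \<open>N\<close> contains a point
    off the lattice.\<close>
  have "\<not> ball x0 e \<subseteq> L" using uncountable_ball[OF e(1), of x0] countable countable_subset by blast
  then obtain p where p: "p \<notin> L" "p \<in> F -` N" using e(2) by blast
  have oU: "open (vx -` (F -` N))"
    by (rule open_vimage[OF oN]) (rule continuous_on_vx[OF continuous_on_id])
  have eq: "H (F (vx w)) = F (vx w)" if "w \<in> vx -` (F -` N)" for w using id that by simp
  have "positive_sphere (H \<circ> F \<circ> vx) (cx p)"
    unfolding positive_sphere_def
  proof (clarify)
    fix D \<kappa> assume D: "(D, \<kappa>) \<in> two_sphere" "(H \<circ> F \<circ> vx) (cx p) \<in> D"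
    have Fp: "H (F p) = F p" using id p(2) by simp
    have "positive_at (\<kappa> \<circ> (F \<circ> vx)) (cx p)"
      using positive_off_lattice[OF p(1)] D Fp unfolding positive_sphere_def by auto
    moreover have "positive_at (\<kappa> \<circ> (H \<circ> F \<circ> vx)) (cx p) \<longleftrightarrow> positive_at (\<kappa> \<circ> (F \<circ> vx)) (cx p)"
      by (rule positive_at_cong[OF oU]) (use p(2) eq in auto)
    ultimately show "positive_at (\<kappa> \<circ> (H \<circ> F \<circ> vx)) (cx p)" by simp
  qed
  then have pos: "\<exists>p. p \<notin> L \<and> positive_sphere (H \<circ> F \<circ> vx) (cx p)" using p(1) by blast
  have rng: "range (H \<circ> F) = S2" by (simp only: image_comp[symmetric] range HS)
  obtain K where "compact K" "F ` K = S2" using compact_fundamental by blast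
  then have "compact K \<and> (H \<circ> F) ` K = S2" by (simp only: image_comp[symmetric] HS simp_thms)
  then have cpt: "\<exists>K. compact K \<and> (H \<circ> F) ` K = S2" by blast
  have "continuous_on (range F) H" unfolding range by (rule homeomorphism_cont1[OF H])
  then have ct: "continuous_on UNIV (H \<circ> F)" by (rule continuous_on_compose[OF cont])
  have "lattice_fibres L (H \<circ> F)" by (rule lattice_fibres.intro[OF zero_mem diff_mem fib])
  then show ?thesis
    by (rule lattice_quotient.intro) (rule lattice_quotient_axioms.intro[OF discrete countable ct cpt rng pos])
qed

lemma fibrewise_injection:
  fixes T :: "'a \<Rightarrow> 'c" and \<tau> :: "'b \<Rightarrow> 'c"
  assumes fin: "finite A" "finite B"
    and le: "\<And>t. t \<in> T ` A \<Longrightarrow> card {a \<in> A. T a = t} \<le> card {b \<in> B. \<tau> b = t}"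
  obtains \<iota> where "inj_on \<iota> A" "\<iota> ` A \<subseteq> B" "\<And>a. a \<in> A \<Longrightarrow> \<tau> (\<iota> a) = T a"
proof -
  have "\<exists>e. e ` {a \<in> A. T a = t} \<subseteq> {b \<in> B. \<tau> b = t} \<and> inj_on e {a \<in> A. T a = t}" if "t \<in> T ` A" for t
    by (rule card_le_inj[OF _ _ le[OF that]]) (use fin in auto)
  then have "\<exists>e. \<forall>t \<in> T ` A. e t ` {a \<in> A. T a = t} \<subseteq> {b \<in> B. \<tau> b = t} \<and> inj_on (e t) {a \<in> A. T a = t}"
    by (intro bchoice) blast
  then obtain e where e: "\<And>t. t \<in> T ` A \<Longrightarrow> e t ` {a \<in> A. T a = t} \<subseteq> {b \<in> B. \<tau> b = t}"
    "\<And>t. t \<in> T ` A \<Longrightarrow> inj_on (e t) {a \<in> A. T a = t}" by blast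
  define \<iota> where "\<iota> a = e (T a) a" for a
  have \<iota>: "\<iota> a \<in> B" "\<tau> (\<iota> a) = T a" if "a \<in> A" for a
  proof -
    have "e (T a) a \<in> {b \<in> B. \<tau> b = T a}" by (rule subsetD[OF e(1)]) (use that in simp_all)
    then show "\<iota> a \<in> B" "\<tau> (\<iota> a) = T a" unfolding \<iota>_def by simp_all
  qed
  have "inj_on \<iota> A"
  proof (rule inj_onI)
    fix a a' assume a: "a \<in> A" "a' \<in> A" "\<iota> a = \<iota> a'"
    then have "T a = T a'" using \<iota>(2)[OF a(1)] \<iota>(2)[OF a(2)] by simp
    have inj: "inj_on (e (T a)) {b \<in> A. T b = T a}" by (rule e(2)) (use a in simp)
    show "a = a'"
      by (rule inj_onD[OF inj]) (use a \<open>T a = T a'\<close> in \<open>simp_all add: \<iota>_def\<close>)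
  qed
  moreover have "\<iota> ` A \<subseteq> B" using \<iota>(1) by (rule image_subsetI)
  ultimately show thesis using \<iota>(2) by (rule that)
qed

text \<open>The residues of the coordinates form a surjective homomorphism with kernel
  \<open>L1\<close>, so the first isomorphism theorem applies.\<close>

lemma (in lattice_coordinates) factor_group_iso:
  assumes zero: "0 \<in> L2" and sub: "L1 \<subseteq> L2"
  shows "(lattice_group L2 Mod L1) \<cong> (integer_mod_group m \<times>\<times> integer_mod_group n)"
proof -
  let ?G = "lattice_group L2" and ?Q = "integer_mod_group m \<times>\<times> integer_mod_group n"
  have add: "x + y \<in> L2" if "x \<in> L2" "y \<in> L2" for x y
    using diff[OF that(1) diff[OF zero that(2)]] by simp
  have "comm_group ?G"
  proof (rule comm_groupI)
    fix x assume "x \<in> carrier ?G"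
    then show "\<exists>y\<in>carrier ?G. y \<otimes>\<^bsub>?G\<^esub> x = \<one>\<^bsub>?G\<^esub>"
      using diff[OF zero] by (intro bexI[of _ "- x"]) (auto simp: lattice_group_def)
  qed (use add zero in \<open>auto simp: lattice_group_def algebra_simps\<close>)
  then interpret G: comm_group ?G .
  have grpQ: "group ?Q" by (intro DirProd_group) auto
  define \<theta> where "\<theta> l = (\<theta>1 l mod int m, \<theta>2 l mod int n)" for l
  have "\<theta> \<in> hom ?G ?Q"
  proof (rule homI)
    fix x y assume "x \<in> carrier ?G" "y \<in> carrier ?G"
    then have xy: "x \<in> L2" "y \<in> L2" by (auto simp: lattice_group_def)
    show "\<theta> (x \<otimes>\<^bsub>?G\<^esub> y) = \<theta> x \<otimes>\<^bsub>?Q\<^esub> \<theta> y"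
      using add1[OF xy] add2[OF xy] m n
      by (simp add: \<theta>_def lattice_group_def mult_DirProd' integer_mod_group_def cong_def mod_add_eq)
  qed (use m n in \<open>simp add: \<theta>_def carrier_integer_mod_group\<close>)
  then interpret group_hom ?G ?Q \<theta>
    using grpQ G.group_axioms by (simp add: group_hom_def group_hom_axioms_def)
  have "kernel ?G ?Q \<theta> = L1"
    using kernel sub by (auto simp: kernel_def lattice_group_def \<theta>_def one_DirProd cong_def)
  moreover have "\<theta> ` carrier ?G = carrier ?Q"
  proof (intro subset_antisym subsetI)
    fix z assume "z \<in> carrier ?Q"
    then have z: "fst z mod int m = fst z" "snd z mod int n = snd z"
      using m n by (auto simp: carrier_integer_mod_group)
    obtain l where l: "l \<in> L2" "[\<theta>1 l = fst z] (mod int m)" "[\<theta>2 l = snd z] (mod int n)" using onto by blast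
    have "\<theta> l = z" using l(2,3) z by (simp add: \<theta>_def cong_def prod_eq_iff)
    then show "z \<in> \<theta> ` carrier ?G" using l(1) by (auto simp: lattice_group_def)
  next
    fix z assume "z \<in> \<theta> ` carrier ?G"
    then show "z \<in> carrier ?Q" by (elim imageE) (simp only: hom_closed)
  qed
  ultimately show ?thesis using FactGroup_iso by simp
qed

section \<open>Corners of the pillowcase and the model pair of lattices\<close>

lemma pillow_at_lattice:
  assumes "x $ 1 / m = of_int k" "x $ 2 / n = of_int j"
  shows "pillow m n x = vector [if even k then 1 else - 1, if even j then 1 else - 1, 0]"
  unfolding pillow_def assms cos_npi_int sin_npi_int by simp

text \<open>The images of the lattice points, indexed by the parities of the two integer
  coordinates; \<open>True\<close> stands for odd.\<close>

definition corner :: "real \<Rightarrow> real \<Rightarrow> bool \<times> bool \<Rightarrow> real^3" where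
  "corner m n c = pillow_map m n (vector [m * of_bool (fst c), n * of_bool (snd c)])"

lemma pillow_map_at_lattice:
  assumes mn: "m > 0" "n > 0" and x: "x $ 1 / m = of_int k" "x $ 2 / n = of_int j"
  shows "pillow_map m n x = corner m n (odd k, odd j)"
proof -
  have "pillow m n (vector [m * of_bool (odd k), n * of_bool (odd j)]) =
      vector [if even (of_bool (odd k) :: int) then 1 else - 1, if even (of_bool (odd j) :: int) then 1 else - 1, 0]"
    by (rule pillow_at_lattice) (use mn in simp_all)
  then have "pillow m n (vector [m * of_bool (odd k), n * of_bool (odd j)]) = pillow m n x"
    unfolding pillow_at_lattice[OF x] by simp
  then show ?thesis unfolding corner_def fst_conv snd_conv pillow_map_eq_iff by simp
qed

lemma inj_corner:
  assumes mn: "m > 0" "n > 0" shows "inj (corner m n)"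
proof (rule injI)
  fix c c' assume "corner m n c = corner m n c'"
  then have eq: "pillow m n (vector [m * of_bool (fst c), n * of_bool (snd c)]) =
      pillow m n (vector [m * of_bool (fst c'), n * of_bool (snd c')])"
    unfolding corner_def pillow_map_eq_iff .
  have p: "pillow m n (vector [m * of_bool (fst c), n * of_bool (snd c)]) =
      vector [if even (of_bool (fst c) :: int) then 1 else - 1, if even (of_bool (snd c) :: int) then 1 else - 1, 0]" for c
    by (rule pillow_at_lattice) (use mn in simp_all)
  have ev: "even (of_bool b :: int) \<longleftrightarrow> \<not> b" for b by (cases b) simp_all
  from eq have "(if \<not> fst c then 1 else - 1 :: real) = (if \<not> fst c' then 1 else - 1)"
    "(if \<not> snd c then 1 else - 1 :: real) = (if \<not> snd c' then 1 else - 1)"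
    unfolding p ev by (simp_all add: vec_eq_iff forall_3)
  then show "c = c'" by (simp add: prod_eq_iff split: if_splits)
qed

lemma corner_image:
  assumes mn: "m > 0" "n > 0" shows "pillow_map m n ` rect_lattice m n = range (corner m n)"
proof (intro subset_antisym subsetI)
  fix y assume "y \<in> pillow_map m n ` rect_lattice m n"
  then obtain x where x: "x \<in> rect_lattice m n" "y = pillow_map m n x" by blast
  then obtain k j where "x $ 1 / m = of_int k" "x $ 2 / n = of_int j"
    unfolding rect_lattice_def by (auto elim!: Ints_cases)
  then show "y \<in> range (corner m n)" unfolding x(2) by (simp only: pillow_map_at_lattice[OF mn] rangeI)
next
  fix y assume "y \<in> range (corner m n)"
  then obtain c where c: "y = corner m n c" by blast
  have "vector [m * of_bool (fst c), n * of_bool (snd c)] \<in> rect_lattice m n"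
    using mn by (simp add: rect_lattice_def)
  then show "y \<in> pillow_map m n ` rect_lattice m n" unfolding c corner_def by (rule imageI)
qed

lemma plane_lattice_rect:
  assumes mn: "m > 0" "n > 0" shows "plane_lattice (rect_lattice m n)"
proof -
  define u v :: "real^2" where "u = vector [m, 0]" and "v = vector [0, n]"
  have ne: "u \<noteq> v" using mn by (simp add: u_def v_def vec_eq_iff forall_2)
  have "v \<noteq> 0" using mn by (simp add: v_def vec_eq_iff forall_2)
  moreover have "u \<notin> span {v}"
  proof
    assume "u \<in> span {v}"
    then obtain r where "u = r *\<^sub>R v" unfolding span_singleton by blast
    then have "u $ 1 = r * v $ 1" by simp
    then show False using mn by (simp add: u_def v_def)
  qed
  ultimately have ind: "independent {u, v}" using ne by (simp add: independent_insert)
  have "rect_lattice m n = {of_int a *\<^sub>R u + of_int b *\<^sub>R v | a b. True}"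
  proof (intro subset_antisym subsetI)
    fix x assume "x \<in> rect_lattice m n"
    then obtain k j where "x $ 1 / m = of_int k" "x $ 2 / n = of_int j"
      unfolding rect_lattice_def by (auto elim!: Ints_cases)
    then have "x = of_int k *\<^sub>R u + of_int j *\<^sub>R v"
      using mn by (simp add: vec_eq_iff forall_2 u_def v_def field_simps)
    then show "x \<in> {of_int a *\<^sub>R u + of_int b *\<^sub>R v | a b. True}" by blast
  next
    fix x assume "x \<in> {of_int a *\<^sub>R u + of_int b *\<^sub>R v | a b. True}"
    then obtain a b where "x = of_int a *\<^sub>R u + of_int b *\<^sub>R v" by blast
    then show "x \<in> rect_lattice m n" using mn by (simp add: rect_lattice_def u_def v_def)
  qed
  then show ?thesis unfolding plane_lattice_def using ne ind by blast
qed

lemma lattice_coordinates_rect: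
  assumes mn: "m > 0" "n > 0"
  shows "lattice_coordinates (rect_lattice (real m) (real n)) (rect_lattice 1 1) (\<lambda>x. \<lfloor>x $ 1\<rfloor>) (\<lambda>x. \<lfloor>x $ 2\<rfloor>) m n"
proof
  show "m > 0" "n > 0" by (rule mn)+
  have ex: "\<exists>k j. x $ 1 = of_int k \<and> x $ 2 = of_int j" if "x \<in> rect_lattice 1 1" for x
    using that unfolding rect_lattice_def by (auto elim!: Ints_cases)
  fix x y :: "real^2" assume xy: "x \<in> rect_lattice 1 1" "y \<in> rect_lattice 1 1"
  obtain k j k' j' where kj: "x $ 1 = of_int k" "x $ 2 = of_int j" "y $ 1 = of_int k'" "y $ 2 = of_int j'"
    using ex[OF xy(1)] ex[OF xy(2)] by blast
  show "[\<lfloor>(x + y) $ 1\<rfloor> = \<lfloor>x $ 1\<rfloor> + \<lfloor>y $ 1\<rfloor>] (mod int m)" "[\<lfloor>(x + y) $ 2\<rfloor> = \<lfloor>x $ 2\<rfloor> + \<lfloor>y $ 2\<rfloor>] (mod int n)"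
    by (simp_all add: kj)
  show "x - y \<in> rect_lattice 1 1" by (simp add: rect_lattice_def kj)
next
  fix a b :: int
  show "\<exists>l \<in> rect_lattice 1 1. [\<lfloor>l $ 1\<rfloor> = a] (mod int m) \<and> [\<lfloor>l $ 2\<rfloor> = b] (mod int n)"
    by (intro bexI[of _ "vector [of_int a, of_int b]"]) (simp_all add: rect_lattice_def)
next
  fix l :: "real^2" assume "l \<in> rect_lattice 1 1"
  then obtain k j where kj: "l $ 1 = of_int k" "l $ 2 = of_int j"
    unfolding rect_lattice_def by (auto elim!: Ints_cases)
  have int_iff: "(of_int k :: real) / real m \<in> \<int> \<longleftrightarrow> [k = 0] (mod int m)" if m: "m > 0" for k m
  proof
    assume "(of_int k :: real) / real m \<in> \<int>"
    then obtain i where "(of_int k :: real) / real m = of_int i" by (rule Ints_cases)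
    then have "(of_int k :: real) = of_int (i * int m)" using m by (simp add: field_simps)
    then have "k = i * int m" by (simp only: of_int_eq_iff)
    then show "[k = 0] (mod int m)" by (simp add: cong_0_iff)
  next
    assume "[k = 0] (mod int m)"
    then obtain i where "k = int m * i" unfolding cong_0_iff by (rule dvdE)
    then show "(of_int k :: real) / real m \<in> \<int>" using m by simp
  qed
  show "l \<in> rect_lattice (real m) (real n) \<longleftrightarrow> [\<lfloor>l $ 1\<rfloor> = 0] (mod int m) \<and> [\<lfloor>l $ 2\<rfloor> = 0] (mod int n)"
    using int_iff[OF mn(1), of k] int_iff[OF mn(2), of j] by (simp add: rect_lattice_def kj)
qed

lemma rect_lattice_subset:
  assumes "m > 0" "n > 0" shows "rect_lattice (real m) (real n) \<subseteq> rect_lattice 1 1"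
proof
  fix x assume "x \<in> rect_lattice (real m) (real n)"
  then obtain k j where "x $ 1 / real m = of_int k" "x $ 2 / real n = of_int j"
    unfolding rect_lattice_def by (auto elim!: Ints_cases)
  then have "x $ 1 = of_int (k * int m)" "x $ 2 = of_int (j * int n)" using assms by (simp_all add: field_simps)
  then show "x \<in> rect_lattice 1 1" by (simp only: rect_lattice_def mem_Collect_eq div_by_1 Ints_of_int simp_thms)
qed

text \<open>Each factor counts the solutions modulo 2 of \<open>m * a = c\<close>: one if
  \<open>m\<close> is odd, and for even \<open>m\<close> none or two according to whether
  \<open>c\<close> is odd or even.\<close>

definition corner_defect :: "nat \<Rightarrow> nat \<Rightarrow> bool \<times> bool \<Rightarrow> nat" where
  "corner_defect m n c = (if odd m then 1 else if fst c then 0 else 2) * (if odd n then 1 else if snd c then 0 else 2)"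

text \<open>On parities \<open>f\<close> acts as multiplication by \<open>(m, n)\<close>: the corner
  \<open>a\<close> goes to the corner with entries \<open>odd m \<and> fst a\<close> and
  \<open>odd n \<and> snd a\<close>. The preimages of a corner therefore form a product set.\<close>

lemma corner_defect_eq:
  assumes mn: "m > 0" "n > 0" and comp: "f \<circ> pillow_map (real m) (real n) = pillow_map 1 1"
  shows "card {z \<in> pillow_map (real m) (real n) ` rect_lattice (real m) (real n). f z = corner 1 1 c} = corner_defect m n c"
proof -
  have mn': "real m > 0" "real n > 0" using mn by simp_all
  have f: "f (corner m n a) = corner 1 1 (odd m \<and> fst a, odd n \<and> snd a)" for a
  proof -
    have "f (corner m n a) = pillow_map 1 1 (vector [real m * of_bool (fst a), real n * of_bool (snd a)])"
      unfolding corner_def using comp by (metis comp_apply)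
    also have "\<dots> = corner 1 1 (odd (int m * of_bool (fst a)), odd (int n * of_bool (snd a)))"
      by (rule pillow_map_at_lattice) simp_all
    also have "odd (int m * of_bool (fst a)) \<longleftrightarrow> odd m \<and> fst a" by simp
    also have "odd (int n * of_bool (snd a)) \<longleftrightarrow> odd n \<and> snd a" by simp
    finally show ?thesis .
  qed
  have inj: "corner 1 1 a = corner 1 1 b \<longleftrightarrow> a = b" for a b
    by (rule inj_eq[OF inj_corner]) simp_all
  have one: "card {a. (o1 \<and> a) = b} = (if o1 then 1 else if b then 0 else 2)" for o1 b :: bool
  proof -
    have "{a. a = b} = {b}" by blast
    moreover have "{a::bool. True} = {True, False}" by auto
    ultimately show ?thesis by (cases o1; cases b) simp_all
  qed
  have "{z \<in> range (corner m n). f z = corner 1 1 c} =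
      corner m n ` ({a. (odd m \<and> a) = fst c} \<times> {a. (odd n \<and> a) = snd c})"
  proof (intro subset_antisym subsetI)
    fix z assume "z \<in> {z \<in> range (corner m n). f z = corner 1 1 c}"
    then obtain a where a: "z = corner m n a" "f (corner m n a) = corner 1 1 c" by blast
    have eq: "(odd m \<and> fst a, odd n \<and> snd a) = c" using a(2) unfolding f inj .
    have "fst c = (odd m \<and> fst a)" "snd c = (odd n \<and> snd a)" unfolding eq[symmetric] by simp_all
    then have "fst a \<in> {a. (odd m \<and> a) = fst c}" "snd a \<in> {a. (odd n \<and> a) = snd c}"
      by (simp_all only: mem_Collect_eq)
    then have "a \<in> {a. (odd m \<and> a) = fst c} \<times> {a. (odd n \<and> a) = snd c}"
      unfolding mem_Times_iff by (rule conjI)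
    with a(1) show "z \<in> corner m n ` ({a. (odd m \<and> a) = fst c} \<times> {a. (odd n \<and> a) = snd c})"
      by (rule image_eqI)
  next
    fix z assume "z \<in> corner m n ` ({a. (odd m \<and> a) = fst c} \<times> {a. (odd n \<and> a) = snd c})"
    then obtain a where a0: "z = corner m n a" "a \<in> {a. (odd m \<and> a) = fst c} \<times> {a. (odd n \<and> a) = snd c}"
      by (rule imageE)
    from a0(2) have a: "(odd m \<and> fst a) = fst c" "(odd n \<and> snd a) = snd c"
      unfolding mem_Times_iff mem_Collect_eq by (rule conjunct1, rule conjunct2)
    have "(odd m \<and> fst a, odd n \<and> snd a) = c" unfolding a by simp
    then have "f z = corner 1 1 c" unfolding a0(1) f by (simp only:)
    moreover have "z \<in> range (corner m n)" unfolding a0(1) by (rule rangeI)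
    ultimately show "z \<in> {z \<in> range (corner m n). f z = corner 1 1 c}" by simp
  qed
  moreover have "inj_on (corner m n) S" for S using inj_corner[OF mn'] by (rule inj_on_subset) simp
  ultimately show ?thesis
    unfolding corner_image[OF mn'] by (simp only: card_image card_cartesian_product one corner_defect_def)
qed

section \<open>Matching postcritical vertices with corners\<close>

context NET_portrait begin

text \<open>In each parity case the vertices and the corners have the same multiset of defects: four
  times 1, or 0, 0, 2, 2, or 0, 0, 0, 4. Each value is thus taken by at least as many corners as
  vertices, which is what \<open>fibrewise_injection\<close> asks.\<close>

lemma corner_assignment:
  assumes mn: "n dvd m" "m * n = d"
    and cong: "[m = fst (mod2_elementary_divisors G w d)] (mod 2)" "[n = snd (mod2_elementary_divisors G w d)] (mod 2)"
  obtains j where "inj_on j P" "\<And>x. x \<in> P \<Longrightarrow> corner_defect m n (j x) = d - 2 * crit_count x"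
proof -
  have D0: "d - 2 * crit_count x = 0 \<longleftrightarrow> x \<in> full" if "x \<in> P" for x
    using incoming_le[OF that] that unfolding full_def by auto
  have "finite full" using finite_P by (simp add: full_def)
  have sub: "full \<subseteq> P" by (auto simp: full_def)
  have diff: "card (P - full) = 4 - card full"
    using card_Diff_subset[OF \<open>finite full\<close> sub] card_P by simp
  have par: "even m \<longleftrightarrow> even (fst (mod2_elementary_divisors G w d))" "even n \<longleftrightarrow> even (snd (mod2_elementary_divisors G w d))"
    using cong_dvd_iff[OF cong(1)] cong_dvd_iff[OF cong(2)] by simp_all
  have le: "card {x \<in> P. d - 2 * crit_count x = t} \<le> card {c \<in> UNIV. corner_defect m n c = t}"
    if t: "t \<in> (\<lambda>x. d - 2 * crit_count x) ` P" for t
  proof (cases "odd d")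
    case True
    then have "odd m" "odd n" using mn(2) by auto
    then have "{c \<in> UNIV. corner_defect m n c = 1} = UNIV" by (simp add: corner_defect_def)
    then have "card {c \<in> UNIV. corner_defect m n c = 1} = 4" by (simp add: card_UNIV_bool)
    moreover have "t = 1" using t defect_odd[OF True] by auto
    moreover have "card {x \<in> P. d - 2 * crit_count x = t} \<le> 4"
      using card_mono[OF finite_P, of "{x \<in> P. d - 2 * crit_count x = t}"] card_P by auto
    ultimately show ?thesis by simp
  next
    case False
    have zero: "{x \<in> P. d - 2 * crit_count x = 0} = full" using D0 sub by blast
    from defect_even[of, OF False[unfolded not_not]] consider
        (two) "card full = 2" "\<And>x. x \<in> P - full \<Longrightarrow> d - 2 * crit_count x = 2"
      | (three) "card full = 3" "\<And>x. x \<in> P - full \<Longrightarrow> d - 2 * crit_count x = 4" by blast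
    then show ?thesis
    proof cases
      case two
      have "even m" "odd n" using par two(1) unfolding mod2_elementary_divisors_eq by simp_all
      then have cd: "corner_defect m n c = (if fst c then 0 else 2)" for c by (simp add: corner_defect_def)
      have "{c \<in> UNIV. corner_defect m n c = 0} = {(True, True), (True, False)}"
        "{c \<in> UNIV. corner_defect m n c = 2} = {(False, True), (False, False)}" unfolding cd by auto
      then have cc: "card {c \<in> UNIV. corner_defect m n c = 0} = 2" "card {c \<in> UNIV. corner_defect m n c = 2} = 2" by simp_all
      have le: "card {x \<in> P. d - 2 * crit_count x = 2} \<le> card (P - full)"
        by (rule card_mono) (use finite_P D0 in auto)
      consider "t = 0" | "t = 2" using t two(2) D0 by fastforce
      then show ?thesis using zero two(1) cc le diff by cases simp_all
    next
      case three
      have "even m" "even n" using par three(1) unfolding mod2_elementary_divisors_eq by simp_all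
      then have cd: "corner_defect m n c = (if fst c then 0 else 2) * (if snd c then 0 else 2)" for c
        by (simp add: corner_defect_def)
      have "{c \<in> UNIV. corner_defect m n c = 0} = {(True, True), (True, False), (False, True)}"
        "{c \<in> UNIV. corner_defect m n c = 4} = {(False, False)}" unfolding cd by (auto split: if_splits)
      then have cc: "card {c \<in> UNIV. corner_defect m n c = 0} = 3" "card {c \<in> UNIV. corner_defect m n c = 4} = 1" by simp_all
      have le: "card {x \<in> P. d - 2 * crit_count x = 4} \<le> card (P - full)"
        by (rule card_mono) (use finite_P D0 in auto)
      consider "t = 0" | "t = 4" using t three(2) D0 by fastforce
      then show ?thesis using zero three(1) cc le diff by cases simp_all
    qed
  qed
  show thesis
  proof (rule fibrewise_injection[OF finite_P finite_class.finite_UNIV le])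
    fix j assume "inj_on j P" "\<And>x. x \<in> P \<Longrightarrow> corner_defect m n (j x) = d - 2 * crit_count x"
    then show thesis by (rule that)
  qed
qed

end

text \<open>Each fibre of \<open>F1\<close> lies in a fibre of \<open>F2\<close>, so any
  representative gives the same value; off the range of \<open>F1\<close> the value is
  arbitrary.\<close>

lemma factor_through:
  assumes f1: "lattice_fibres L1 F1" and f2: "lattice_fibres L2 F2" and sub: "L1 \<subseteq> L2"
  obtains f where "f \<circ> F1 = F2"
proof -
  interpret A1: lattice_fibres L1 F1 by (rule f1)
  interpret A2: lattice_fibres L2 F2 by (rule f2)
  have cong: "F2 x = F2 y" if eq: "F1 x = F1 y" for x y
    using eq
  proof (cases rule: A1.fibreE)
    fix l assume l: "l \<in> L1" "y = 2 *\<^sub>R l + x"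
    show ?thesis unfolding l(2) by (rule sym[OF A2.fibre_plus[OF subsetD[OF sub l(1)]]])
  next
    fix l assume l: "l \<in> L1" "y = 2 *\<^sub>R l - x"
    show ?thesis unfolding l(2) by (rule sym[OF A2.fibre_minus[OF subsetD[OF sub l(1)]]])
  qed
  define f where "f z = F2 (SOME x. F1 x = z)" for z
  have "(f \<circ> F1) x = F2 x" for x
  proof -
    have "F1 (SOME y. F1 y = F1 x) = F1 x" by (rule someI[of _ x]) (rule refl)
    then show ?thesis unfolding f_def comp_apply by (rule cong)
  qed
  then have "f \<circ> F1 = F2" by (rule ext)
  then show thesis by (rule that)
qed

section \<open>Critical points and noncritical preimages of the induced map\<close>

context lattice_pair begin

lemma F1_S2: "F1 q \<in> S2"
  unfolding Q1.range[symmetric] by (rule rangeI)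

lemma sphere_degree_cases: "sphere_degree f (F1 q) = (if q \<in> L2 - L1 then 2 else 1)"
  unfolding sphere_degree_F1 using sub by (auto simp: ramification_def)

lemma critical_set_eq: "critical_set f = F1 ` (L2 - L1)"
proof (intro subset_antisym subsetI)
  fix z assume z: "z \<in> critical_set f"
  then have "z \<in> range F1" unfolding Q1.range critical_set_def by simp
  then obtain q where q: "z = F1 q" by (rule rangeE)
  have "sphere_degree f (F1 q) > 1" using z unfolding critical_set_def q by simp
  then have "q \<in> L2 - L1" unfolding sphere_degree_cases by (simp split: if_splits)
  then show "z \<in> F1 ` (L2 - L1)" unfolding q by (rule imageI)
next
  fix z assume "z \<in> F1 ` (L2 - L1)"
  then obtain q where q: "z = F1 q" "q \<in> L2 - L1" by (rule imageE)
  then show "z \<in> critical_set f"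
    unfolding critical_set_def q(1) using F1_S2[of q] by (simp only: mem_Collect_eq sphere_degree_cases) simp
qed

lemma noncritical_preimages_eq:
  assumes "postcritical_set f = F2 ` L2" shows "noncritical_preimages f = F1 ` L1"
proof (intro subset_antisym subsetI)
  fix z assume "z \<in> noncritical_preimages f"
  then have z: "z \<in> S2" "f z \<in> F2 ` L2" "z \<notin> F1 ` (L2 - L1)"
    unfolding noncritical_preimages_def assms critical_set_eq by simp_all
  from z(1) obtain q where q: "z = F1 q" unfolding Q1.range[symmetric] by (rule rangeE)
  from z(2) obtain l where l: "F2 q = F2 l" "l \<in> L2" unfolding q f_F1 by (rule imageE)
  have "q \<in> L2" using A2.fibre_mem_iff[OF l(1)] l(2) by simp
  moreover have "q \<notin> L2 - L1" using z(3) unfolding q F1_mem_critical .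
  ultimately have "q \<in> L1" by simp
  then show "z \<in> F1 ` L1" unfolding q by (rule imageI)
next
  fix z assume "z \<in> F1 ` L1"
  then obtain q where q: "z = F1 q" "q \<in> L1" by (rule imageE)
  have "f z \<in> F2 ` L2" unfolding q(1) f_F1 by (rule imageI[OF subsetD[OF sub q(2)]])
  moreover have "z \<notin> F1 ` (L2 - L1)" unfolding q(1) F1_mem_critical using q(2) by simp
  ultimately show "z \<in> noncritical_preimages f"
    unfolding noncritical_preimages_def assms critical_set_eq using F1_S2[of q] q(1) by simp
qed

end

section \<open>Lifting the vertices and assembling the map\<close>

context NET_portrait begin

lemma tail_image: "tail G ` arcs G = verts G"
proof (intro subset_antisym subsetI)
  fix v assume "v \<in> verts G"
  from out[OF this] show "v \<in> tail G ` arcs G" by (intro image_eqI[of _ _ "out v"]) simp_all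
qed (use tail_verts in blast)

text \<open>Arcs of a portrait are represented by their tails, so an arc \<open>e\<close> must go to
  the image of \<open>tail G e\<close>.\<close>

lemma weighted_isoI:
  assumes inj: "inj_on \<eta> (verts G)" and crit: "\<eta> ` C = critical_set f" and post: "\<eta> ` P = postcritical_set f"
    and f: "\<And>v. v \<in> verts G \<Longrightarrow> f (\<eta> v) = \<eta> (target v)"
    and deg: "\<And>v. v \<in> verts G \<Longrightarrow> sphere_degree f (\<eta> v) = w (out v)"
  shows "weighted_iso G w (portrait f) (sphere_degree f)"
proof -
  define h where "h = \<lparr>iso_verts = \<eta>, iso_arcs = \<lambda>e. \<eta> (tail G e), iso_head = f, iso_tail = \<lambda>x. x\<rparr>"
  have h: "iso_verts h = \<eta>" "iso_arcs h = (\<lambda>e. \<eta> (tail G e))" "iso_head h = f" "iso_tail h = (\<lambda>x. x)"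
    unfolding h_def by simp_all
  have "inj_on (\<lambda>e. \<eta> (tail G e)) (arcs G)"
  proof (rule inj_onI)
    fix e e' assume e: "e \<in> arcs G" "e' \<in> arcs G" "\<eta> (tail G e) = \<eta> (tail G e')"
    have "tail G e = tail G e'" by (rule inj_onD[OF inj e(3) tail_verts[OF e(1)] tail_verts[OF e(2)]])
    then have "out (tail G e) = out (tail G e')" by simp
    then show "e = e'" unfolding out_tail[OF e(1)] out_tail[OF e(2)] .
  qed
  moreover have "\<eta> (head G e) = f (\<eta> (tail G e))" if "e \<in> arcs G" for e
    unfolding f[OF tail_verts[OF that]] target_def out_tail[OF that] ..
  ultimately have "pre_digraph.digraph_isomorphism G h"
    unfolding pre_digraph.digraph_isomorphism_def h using wf inj by simp
  moreover have "portrait f = app_iso h G"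
  proof -
    have "\<eta> ` verts G = critical_set f \<union> postcritical_set f" unfolding verts_eq image_Un crit post ..
    moreover have "(\<lambda>e. \<eta> (tail G e)) ` arcs G = \<eta> ` verts G" unfolding tail_image[symmetric] image_image ..
    ultimately show ?thesis unfolding portrait_def app_iso_def h by simp
  qed
  moreover have "sphere_degree f (iso_arcs h e) = w e" if "e \<in> arcs G" for e
    unfolding h deg[OF tail_verts[OF that]] out_tail[OF that] ..
  ultimately show ?thesis unfolding weighted_iso_def by blast
qed

text \<open>Over \<open>j x\<close> lie \<open>d - 2 * crit_count x\<close> noncritical points by
  assumption, hence \<open>crit_count x\<close> critical ones by the weighted count. The former are
  at least \<open>noncrit_count x\<close> in number by \<open>incoming_le\<close>, so both kinds of
  vertices can be placed injectively.\<close>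

lemma lift_vertices:
  fixes L1 L2 F1 F2 f R
  assumes pair: "fibre_pair L1 F1 L2 F2 f R" and R: "card R = d"
    and fin: "finite (F1 ` L1)" "finite (F1 ` (L2 - L1))"
    and j: "inj_on j P" "j ` P = F2 ` L2"
    and defect: "\<And>x. x \<in> P \<Longrightarrow> card {z \<in> F1 ` L1. f z = j x} = d - 2 * crit_count x"
  obtains \<iota> where "inj_on \<iota> (verts G)" "\<iota> ` C = F1 ` (L2 - L1)" "\<And>v. v \<in> verts G \<Longrightarrow> v \<notin> C \<Longrightarrow> \<iota> v \<in> F1 ` L1"
    "\<And>v. v \<in> verts G \<Longrightarrow> f (\<iota> v) = j (target v)"
proof -
  interpret fibre_pair L1 F1 L2 F2 f R by (rule pair)
  have CV: "v \<in> verts G" if "v \<in> C" for v using that unfolding verts_eq by simp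
  have jinj: "j (target v) = j x \<longleftrightarrow> target v = x" if "v \<in> verts G" "x \<in> P" for v x
    using inj_on_eq_iff[OF j(1) target_P[OF that(1)] that(2)] .
  have count: "card {z \<in> F1 ` (L2 - L1). f z = j x} = crit_count x" if x: "x \<in> P" for x
  proof -
    have "j x \<in> F2 ` L2" unfolding j(2)[symmetric] using x by (rule imageI)
    then obtain p where p: "j x = F2 p" "p \<in> L2" by (rule imageE)
    show ?thesis
      using critical_fibre_count[OF p(2)] defect[OF x] incoming_le[OF x] unfolding p(1) R by linarith
  qed
  have le1: "card {v \<in> C. j (target v) = y} \<le> card {z \<in> F1 ` (L2 - L1). f z = y}"
    if y: "y \<in> (\<lambda>v. j (target v)) ` C" for y
  proof -
    from y obtain u where u: "y = j (target u)" "u \<in> C" by (rule imageE)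
    define x where "x = target u"
    have x: "x \<in> P" unfolding x_def by (rule target_P[OF CV[OF u(2)]])
    have "{v \<in> C. j (target v) = y} = {v \<in> C. target v = x}"
      unfolding u(1) x_def[symmetric] using jinj[OF CV x] by blast
    then show ?thesis using count[OF x] unfolding u(1) x_def[symmetric] crit_count_def by simp
  qed
  obtain \<iota>1 where \<iota>1: "inj_on \<iota>1 C" "\<iota>1 ` C \<subseteq> F1 ` (L2 - L1)" "\<And>v. v \<in> C \<Longrightarrow> f (\<iota>1 v) = j (target v)"
  proof (rule fibrewise_injection[where T = "\<lambda>v. j (target v)" and \<tau> = f, OF finite_C fin(2)])
    fix y assume "y \<in> (\<lambda>v. j (target v)) ` C"
    then show "card {v \<in> C. j (target v) = y} \<le> card {z \<in> F1 ` (L2 - L1). f z = y}" by (rule le1)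
  next
    fix e assume "inj_on e C" "e ` C \<subseteq> F1 ` (L2 - L1)" "\<And>v. v \<in> C \<Longrightarrow> f (e v) = j (target v)"
    then show thesis by (rule that)
  qed
  have le2: "card {v \<in> P - C. j (target v) = y} \<le> card {z \<in> F1 ` L1. f z = y}"
    if y: "y \<in> (\<lambda>v. j (target v)) ` (P - C)" for y
  proof -
    from y obtain u where u: "y = j (target u)" "u \<in> P - C" by (rule imageE)
    define x where "x = target u"
    have PV: "v \<in> verts G" if "v \<in> P - C" for v using that unfolding verts_eq by simp
    have x: "x \<in> P" unfolding x_def by (rule target_P[OF PV[OF u(2)]])
    have "{v \<in> P - C. j (target v) = y} = {v \<in> P - C. target v = x}"
      unfolding u(1) x_def[symmetric] using jinj[OF PV x] by blast
    then have "card {v \<in> P - C. j (target v) = y} = noncrit_count x" unfolding noncrit_count_def by simp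
    then show ?thesis using incoming_le[OF x] unfolding u(1) x_def[symmetric] defect[OF x] by linarith
  qed
  have finPC: "finite (P - C)" using finite_P by (rule finite_Diff)
  obtain \<iota>2 where \<iota>2: "inj_on \<iota>2 (P - C)" "\<iota>2 ` (P - C) \<subseteq> F1 ` L1" "\<And>v. v \<in> P - C \<Longrightarrow> f (\<iota>2 v) = j (target v)"
  proof (rule fibrewise_injection[where T = "\<lambda>v. j (target v)" and \<tau> = f, OF finPC fin(1)])
    fix y assume "y \<in> (\<lambda>v. j (target v)) ` (P - C)"
    then show "card {v \<in> P - C. j (target v) = y} \<le> card {z \<in> F1 ` L1. f z = y}" by (rule le2)
  next
    fix e assume "inj_on e (P - C)" "e ` (P - C) \<subseteq> F1 ` L1" "\<And>v. v \<in> P - C \<Longrightarrow> f (e v) = j (target v)"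
    then show thesis by (rule that)
  qed
  \<comment> \<open>The lift of the critical vertices must hit every critical point, not just be
    injective. Summing the fibre counts over \<open>P\<close> shows that the two sets have equal
    size.\<close>
  have card_crit: "card (F1 ` (L2 - L1)) = card C"
  proof -
    have "f ` F1 ` (L2 - L1) \<subseteq> F2 ` L2" unfolding image_image f_F1 by (rule image_mono) simp
    then have "f ` F1 ` (L2 - L1) \<subseteq> j ` P" unfolding j(2) .
    then have "card (F1 ` (L2 - L1)) = (\<Sum>y \<in> j ` P. card {z \<in> F1 ` (L2 - L1). f z = y})"
      unfolding card_eq_sum by (intro sum.group[OF fin(2) finite_imageI[OF finite_P], symmetric])
    also have "\<dots> = (\<Sum>x \<in> P. card {z \<in> F1 ` (L2 - L1). f z = j x})"
      by (rule sum.reindex[OF j(1), unfolded comp_def])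
    also have "\<dots> = (\<Sum>x \<in> P. crit_count x)" by (rule sum.cong[OF refl]) (rule count)
    finally show ?thesis unfolding sum_crit_count card_C .
  qed
  have onto: "\<iota>1 ` C = F1 ` (L2 - L1)"
    by (rule card_subset_eq[OF fin(2) \<iota>1(2)]) (simp only: card_image[OF \<iota>1(1)] card_crit)
  define \<iota> where "\<iota> v = (if v \<in> C then \<iota>1 v else \<iota>2 v)" for v
  have \<iota>C: "\<iota> v = \<iota>1 v" if "v \<in> C" for v using that by (simp add: \<iota>_def)
  have \<iota>P: "\<iota> v = \<iota>2 v \<and> v \<in> P - C" if "v \<in> verts G" "v \<notin> C" for v
    using that unfolding verts_eq \<iota>_def by simp
  have mem1: "\<iota> v \<in> F1 ` (L2 - L1)" if "v \<in> C" for v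
    unfolding \<iota>C[OF that] onto[symmetric] using that by (rule imageI)
  have mem2: "\<iota> v \<in> F1 ` L1" if "v \<in> verts G" "v \<notin> C" for v
  proof -
    have "\<iota>2 v \<in> F1 ` L1" by (rule subsetD[OF \<iota>2(2) imageI[OF conjunct2[OF \<iota>P[OF that]]]])
    then show ?thesis unfolding conjunct1[OF \<iota>P[OF that]] .
  qed
  have disj: "z \<notin> F1 ` L1" if z: "z \<in> F1 ` (L2 - L1)" for z
  proof -
    from z obtain q where q: "z = F1 q" "q \<in> L2 - L1" by (rule imageE)
    show ?thesis unfolding q(1) F1_mem_noncritical using q(2) by simp
  qed
  have "inj_on \<iota> (verts G)"
  proof (rule inj_onI)
    fix v u assume v: "v \<in> verts G" and u: "u \<in> verts G" and eq: "\<iota> v = \<iota> u"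
    consider "v \<in> C" "u \<in> C" | "v \<notin> C" "u \<notin> C" | "v \<in> C" "u \<notin> C" | "v \<notin> C" "u \<in> C" by blast
    then show "v = u"
    proof cases
      case 1
      show ?thesis by (rule inj_onD[OF \<iota>1(1) eq[unfolded \<iota>C[OF 1(1)] \<iota>C[OF 1(2)]] 1])
    next
      case 2
      have "\<iota>2 v = \<iota>2 u" using eq \<iota>P[OF v 2(1)] \<iota>P[OF u 2(2)] by simp
      then show ?thesis by (rule inj_onD[OF \<iota>2(1)]) (use \<iota>P[OF v 2(1)] \<iota>P[OF u 2(2)] in simp_all)
    next
      case 3
      then show ?thesis using disj[OF mem1[OF 3(1)]] mem2[OF u 3(2)] eq by simp
    next
      case 4
      then show ?thesis using disj[OF mem1[OF 4(2)]] mem2[OF v 4(1)] eq by simp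
    qed
  qed
  moreover have "\<iota> ` C = F1 ` (L2 - L1)" unfolding onto[symmetric] by (rule image_cong[OF refl \<iota>C])
  moreover have "f (\<iota> v) = j (target v)" if v: "v \<in> verts G" for v
  proof (cases "v \<in> C")
    case True
    show ?thesis unfolding \<iota>C[OF True] by (rule \<iota>1(3)[OF True])
  next
    case False
    then show ?thesis using \<iota>P[OF v False] \<iota>2(3)[of v] by simp
  qed
  ultimately show thesis using mem2 by (intro that[of \<iota>])
qed

lemma realize:
  assumes mn: "m > 0" "n > 0" "n dvd m" "m * n = d"
    and cong: "[m = fst (mod2_elementary_divisors G w d)] (mod 2)" "[n = snd (mod2_elementary_divisors G w d)] (mod 2)"
  shows "\<exists>f. NET_map f \<and> weighted_iso G w (portrait f) (sphere_degree f) \<and> elementary_divisors f m n"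
proof -
  define L1 L2 F1 F2 where "L1 = rect_lattice (real m) (real n)" and "L2 = rect_lattice 1 1"
    and "F1 = pillow_map (real m) (real n)" and "F2 = pillow_map 1 1"
  have mn': "real m > 0" "real n > 0" using mn by simp_all
  have sub: "L1 \<subseteq> L2" unfolding L1_def L2_def by (rule rect_lattice_subset[OF mn(1,2)])
  have q1: "lattice_quotient L1 F1" unfolding L1_def F1_def by (rule lattice_quotient_pillow[OF mn'])
  have q2: "lattice_quotient L2 F2" unfolding L2_def F2_def by (rule lattice_quotient_pillow) simp_all
  interpret q1: lattice_quotient L1 F1 by (rule q1)
  interpret q2: lattice_quotient L2 F2 by (rule q2)
  interpret T: lattice_coordinates L1 L2 "\<lambda>x. \<lfloor>x $ 1\<rfloor>" "\<lambda>x. \<lfloor>x $ 2\<rfloor>" m n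
    unfolding L1_def L2_def by (rule lattice_coordinates_rect[OF mn(1,2)])
  obtain R where R: "finite R" "R \<subseteq> L2" "card R = m * n" "\<And>l. l \<in> L2 \<Longrightarrow> \<exists>!r. r \<in> R \<and> l - r \<in> L1"
    using T.transversal_exists by blast
  obtain f0 where f0: "f0 \<circ> F1 = F2"
    by (rule factor_through[OF q1.lattice_fibres_axioms q2.lattice_fibres_axioms sub])
  have pair: "fibre_pair L1 F1 L2 F2 f0 R"
    by (rule fibre_pair.intro[OF q1.lattice_fibres_axioms q2.lattice_fibres_axioms fibre_pair_axioms.intro[OF sub f0 R(1,2,4)]])
  interpret p0: fibre_pair L1 F1 L2 F2 f0 R by (rule pair)
  obtain c where c: "inj_on c P" "\<And>x. x \<in> P \<Longrightarrow> corner_defect m n (c x) = d - 2 * crit_count x"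
  proof (rule corner_assignment[OF mn(3,4) cong])
    fix c assume "inj_on c P" "\<And>x. x \<in> P \<Longrightarrow> corner_defect m n (c x) = d - 2 * crit_count x"
    then show thesis by (rule that)
  qed
  define j where "j x = corner 1 1 (c x)" for x
  have injc: "inj (corner 1 1)" by (rule inj_corner) simp_all
  have jinj: "inj_on j P"
    unfolding j_def using comp_inj_on[OF c(1) inj_on_subset[OF injc subset_UNIV]] by (simp only: comp_def)
  have F2L2: "F2 ` L2 = range (corner 1 1)" unfolding F2_def L2_def by (rule corner_image) simp_all
  have card4: "card (F2 ` L2) = 4"
  proof -
    have "card (UNIV :: (bool \<times> bool) set) = 4" by (simp add: card_UNIV_bool)
    then show ?thesis unfolding F2L2 card_image[OF injc] .
  qed
  have finF2: "finite (F2 ` L2)" unfolding F2L2 by simp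
  have jP: "j ` P = F2 ` L2"
  proof (rule card_subset_eq[OF finF2])
    show "j ` P \<subseteq> F2 ` L2" unfolding F2L2 j_def by (rule image_subsetI) (rule rangeI)
    show "card (j ` P) = card (F2 ` L2)" unfolding card_image[OF jinj] card_P card4 ..
  qed
  have defect: "card {z \<in> F1 ` L1. f0 z = j x} = d - 2 * crit_count x" if "x \<in> P" for x
    using corner_defect_eq[OF mn(1,2) f0[unfolded F1_def F2_def], of "c x"] c(2)[OF that]
    unfolding F1_def[symmetric] L1_def[symmetric] j_def by simp
  have finL1: "finite (F1 ` L1)" unfolding F1_def L1_def corner_image[OF mn'] by simp
  have finC: "finite (F1 ` (L2 - L1))"
  proof (rule finite_subset)
    show "F1 ` (L2 - L1) \<subseteq> (\<Union>y \<in> F2 ` L2. {z \<in> range F1. f0 z = y})"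
    proof (rule image_subsetI)
      fix q assume "q \<in> L2 - L1"
      then have "F2 q \<in> F2 ` L2" by (intro imageI) simp
      then show "F1 q \<in> (\<Union>y \<in> F2 ` L2. {z \<in> range F1. f0 z = y})" using p0.f_F1[of q] by (intro UN_I) simp_all
    qed
    show "finite (\<Union>y \<in> F2 ` L2. {z \<in> range F1. f0 z = y})"
      using finF2 p0.finite_fibre by (intro finite_UN_I) auto
  qed
  have cR: "card R = d" using R(3) mn(4) by simp
  obtain \<iota> where \<iota>: "inj_on \<iota> (verts G)" "\<iota> ` C = F1 ` (L2 - L1)" "\<And>v. v \<in> verts G \<Longrightarrow> v \<notin> C \<Longrightarrow> \<iota> v \<in> F1 ` L1"
    "\<And>v. v \<in> verts G \<Longrightarrow> f0 (\<iota> v) = j (target v)"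
  proof (rule lift_vertices[OF pair cR finL1 finC jinj jP])
    fix x assume "x \<in> P"
    then show "card {z \<in> F1 ` L1. f0 z = j x} = d - 2 * crit_count x" by (rule defect)
  next
    fix e assume "inj_on e (verts G)" "e ` C = F1 ` (L2 - L1)" "\<And>v. v \<in> verts G \<Longrightarrow> v \<notin> C \<Longrightarrow> e v \<in> F1 ` L1"
      "\<And>v. v \<in> verts G \<Longrightarrow> f0 (e v) = j (target v)"
    then show thesis by (rule that)
  qed
  have F1S: "F1 q \<in> S2" for q unfolding q1.range[symmetric] by (rule rangeI)
  have \<iota>S: "\<iota> v \<in> S2" if v: "v \<in> verts G" for v
  proof (cases "v \<in> C")
    case True
    then have "\<iota> v \<in> F1 ` (L2 - L1)" unfolding \<iota>(2)[symmetric] by (rule imageI)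
    then show ?thesis by (elim imageE) (simp only: F1S)
  next
    case False
    from \<iota>(3)[OF v False] show ?thesis by (elim imageE) (simp only: F1S)
  qed
  have PV: "v \<in> verts G" if "v \<in> P" for v using that unfolding verts_eq by simp
  have CV: "v \<in> verts G" if "v \<in> C" for v using that unfolding verts_eq by simp
  have "F2 q \<in> S2" for q unfolding q2.range[symmetric] by (rule rangeI)
  then have jS: "j ` P \<subseteq> S2" unfolding jP by (rule image_subsetI)
  have \<iota>PS: "\<iota> ` P \<subseteq> S2" by (rule image_subsetI) (rule \<iota>S[OF PV])
  have \<iota>inj: "inj_on \<iota> P" by (rule inj_on_subset[OF \<iota>(1)]) (rule subsetI, rule PV)
  \<comment> \<open>\<open>f0\<close> sends \<open>\<iota> v\<close> to \<open>j (target v)\<close>,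
    which is in general not \<open>\<iota> (target v)\<close>, so the orbits do not close up before
    this correction.\<close>
  obtain H H' N where H: "homeomorphism S2 S2 H H'" "\<And>v. v \<in> P \<Longrightarrow> H (\<iota> v) = j v"
      "openin (top_of_set S2) N" "N \<noteq> {}" "\<And>z. z \<in> N \<Longrightarrow> H z = z"
  proof (rule S2_homeomorphism_moving_points[OF finite_P \<iota>PS jS \<iota>inj jinj])
    fix H H' N assume "homeomorphism S2 S2 H H'" "\<And>v. v \<in> P \<Longrightarrow> H (\<iota> v) = j v"
      "openin (top_of_set S2) N" "N \<noteq> {}" "\<And>z. z \<in> N \<Longrightarrow> H z = z"
    then show thesis by (rule that)
  qed
  have H'H: "H' (H z) = z" if "z \<in> S2" for z by (rule homeomorphism_apply1[OF H(1) that])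
  define f where "f = f0 \<circ> H'"
  define F1' where "F1' = H \<circ> F1"
  have fH: "f (H z) = f0 z" if "z \<in> S2" for z unfolding f_def comp_apply H'H[OF that] ..
  have comp: "f \<circ> F1' = F2"
  proof
    fix x
    show "(f \<circ> F1') x = F2 x" unfolding F1'_def comp_apply fH[OF F1S] p0.f_F1 ..
  qed
  have q1': "lattice_quotient L1 F1'"
    unfolding F1'_def by (rule q1.lattice_quotient_homeomorphism[OF H(1,3,4,5)])
  interpret q1': lattice_quotient L1 F1' by (rule q1')
  have pair': "fibre_pair L1 F1' L2 F2 f R"
    by (rule fibre_pair.intro[OF q1'.lattice_fibres_axioms q2.lattice_fibres_axioms fibre_pair_axioms.intro[OF sub comp R(1,2,4)]])
  interpret p: lattice_pair L1 F1' L2 F2 f R by (rule lattice_pair.intro[OF pair' q1' q2])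
  define \<eta> where "\<eta> v = H (\<iota> v)" for v
  have \<eta>inj: "inj_on \<eta> (verts G)"
  proof (rule inj_onI)
    fix u v assume uv: "u \<in> verts G" "v \<in> verts G" "\<eta> u = \<eta> v"
    have "H' (\<eta> u) = H' (\<eta> v)" using uv(3) by simp
    then have "\<iota> u = \<iota> v" unfolding \<eta>_def H'H[OF \<iota>S[OF uv(1)]] H'H[OF \<iota>S[OF uv(2)]] .
    then show "u = v" by (rule inj_onD[OF \<iota>(1) _ uv(1,2)])
  qed
  have F1'_image: "F1' ` S = H ` F1 ` S" for S unfolding F1'_def by (simp only: image_comp)
  have crit: "\<eta> ` C = critical_set f"
    unfolding p.critical_set_eq F1'_image \<iota>(2)[symmetric] image_image \<eta>_def ..
  have \<eta>P: "\<eta> v = j v" if "v \<in> P" for v unfolding \<eta>_def by (rule H(2)[OF that])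
  \<comment> \<open>\<open>target v\<close> is postcritical, so
    \<open>\<eta> (target v) = j (target v)\<close>. Prescribing \<open>H\<close> on
    \<open>P\<close> alone therefore makes \<open>f\<close> follow the graph from every
    vertex.\<close>
  have f\<eta>: "f (\<eta> v) = \<eta> (target v)" if v: "v \<in> verts G" for v
    unfolding \<eta>P[OF target_P[OF v]] unfolding \<eta>_def fH[OF \<iota>S[OF v]] by (rule \<iota>(4)[OF v])
  have iter: "(target ^^ k) v \<in> verts G \<and> (f ^^ k) (\<eta> v) = \<eta> ((target ^^ k) v)" if v: "v \<in> verts G" for v k
  proof (induction k)
    case 0
    show ?case unfolding funpow_0 using v by (intro conjI) (assumption, rule refl)
  next
    case (Suc k)
    show ?case
      unfolding funpow.simps comp_apply conjunct2[OF Suc.IH] f\<eta>[OF conjunct1[OF Suc.IH]]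
      by (rule conjI[OF target_verts[OF conjunct1[OF Suc.IH]] refl])
  qed
  have post_\<eta>: "postcritical_set f = \<eta> ` P"
  proof (intro subset_antisym subsetI)
    fix z assume "z \<in> postcritical_set f"
    then obtain k y where k: "k \<in> {1..}" "y \<in> critical_set f" "z = (f ^^ k) y" unfolding postcritical_set_def by blast
    from k(2) obtain u where u: "y = \<eta> u" "u \<in> C" unfolding crit[symmetric] by (rule imageE)
    obtain i where i: "k = Suc i" using k(1) by (cases k) simp_all
    have "z = \<eta> ((target ^^ Suc i) u)" unfolding k(3) u(1) i by (rule conjunct2[OF iter[OF CV[OF u(2)]]])
    moreover have "(target ^^ Suc i) u \<in> P" unfolding postcritical_iff using u(2) by blast
    ultimately show "z \<in> \<eta> ` P" by (rule image_eqI)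
  next
    fix z assume "z \<in> \<eta> ` P"
    then obtain x where x: "z = \<eta> x" "x \<in> P" by (rule imageE)
    from x(2) obtain u i where u: "u \<in> C" "x = (target ^^ Suc i) u" unfolding postcritical_iff by blast
    have "z = (f ^^ Suc i) (\<eta> u)" unfolding x(1) u(2) by (rule conjunct2[OF iter[OF CV[OF u(1)]], symmetric])
    moreover have "\<eta> u \<in> critical_set f" unfolding crit[symmetric] using u(1) by (rule imageI)
    ultimately have "z \<in> (f ^^ Suc i) ` critical_set f" by (rule image_eqI)
    moreover have "Suc i \<in> {1..}" by simp
    ultimately show "z \<in> postcritical_set f" unfolding postcritical_set_def by (rule UN_I[rotated])
  qed
  have post: "postcritical_set f = F2 ` L2"
    unfolding post_\<eta> jP[symmetric] by (rule image_cong[OF refl \<eta>P])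
  have deg: "sphere_degree f (\<eta> v) = w (out v)" if v: "v \<in> verts G" for v
  proof (cases "v \<in> C")
    case True
    then have "\<iota> v \<in> F1 ` (L2 - L1)" unfolding \<iota>(2)[symmetric] by (rule imageI)
    then obtain q where q: "\<iota> v = F1 q" "q \<in> L2 - L1" by (rule imageE)
    have "\<eta> v = F1' q" unfolding \<eta>_def q(1) F1'_def comp_apply ..
    then show ?thesis using q(2) True unfolding critical_iff by (simp only: p.sphere_degree_cases if_True)
  next
    case False
    from \<iota>(3)[OF v False] obtain q where q: "\<iota> v = F1 q" "q \<in> L1" by (rule imageE)
    have "\<eta> v = F1' q" unfolding \<eta>_def q(1) F1'_def comp_apply ..
    then have "sphere_degree f (\<eta> v) = 1" using q(2) by (simp only: p.sphere_degree_cases) simp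
    then show ?thesis using weight_cases[OF v] False v unfolding critical_iff by simp
  qed
  have iso: "weighted_iso G w (portrait f) (sphere_degree f)"
    by (rule weighted_isoI[OF \<eta>inj crit post_\<eta>[symmetric] f\<eta> deg])
  have NET: "NET_map f"
    unfolding NET_map_def thurston_map_def
  proof (intro conjI ballI)
    show "branched_covering two_sphere two_sphere f" by (rule p.branched_covering)
    show "2 \<le> covering_degree two_sphere two_sphere f" unfolding p.covering_degree cR by (rule d_ge_2)
    show "finite (postcritical_set f)" unfolding post by (rule finF2)
    show "card (postcritical_set f) = 4" unfolding post by (rule card4)
    fix z assume "z \<in> critical_set f"
    then obtain q where "z = F1' q" "q \<in> L2 - L1" unfolding p.critical_set_eq by (rule imageE)
    then show "sphere_degree f z = 2" by (simp only: p.sphere_degree_cases if_True)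
  qed
  have "elementary_divisors f m n"
    unfolding elementary_divisors_def
  proof (intro conjI exI)
    show "plane_lattice L1" unfolding L1_def by (rule plane_lattice_rect[OF mn'])
    show "plane_lattice L2" unfolding L2_def by (rule plane_lattice_rect) simp_all
    show "L1 \<subseteq> L2" by (rule sub)
    show "lattice_covering L1 F1'" by (rule q1'.lattice_covering)
    show "lattice_covering L2 F2" by (rule q2.lattice_covering)
    show "f \<circ> F1' = F2" by (rule comp)
    show "F1' ` L1 = noncritical_preimages f" by (rule p.noncritical_preimages_eq[OF post, symmetric])
    show "F2 ` L2 = postcritical_set f" by (rule post[symmetric])
    show "(lattice_group L2 Mod L1) \<cong> (integer_mod_group m \<times>\<times> integer_mod_group n)"
      by (rule T.factor_group_iso[OF q2.zero_mem sub])
  qed (use mn in simp_all)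
  then show ?thesis using NET iso by blast
qed

end

theorem theorem9p2:
  fixes G :: "('v, 'e) pre_digraph" and w :: "'e \<Rightarrow> nat" and d m n :: nat
  assumes "weighted_digraph G w"
    and "obvious_NET G w d"
    and "m > 0" and "n > 0" and "n dvd m" and "m * n = d"
  shows "(\<exists>f. NET_map f \<and> weighted_iso G w (portrait f) (sphere_degree f) \<and>
            elementary_divisors f m n)
     \<longleftrightarrow> [m = fst (mod2_elementary_divisors G w d)] (mod 2) \<and>
         [n = snd (mod2_elementary_divisors G w d)] (mod 2)"
proof
  assume "\<exists>f. NET_map f \<and> weighted_iso G w (portrait f) (sphere_degree f) \<and> elementary_divisors f m n"
  then show "[m = fst (mod2_elementary_divisors G w d)] (mod 2) \<and> [n = snd (mod2_elementary_divisors G w d)] (mod 2)"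
    using mod2_elementary_divisors_necessary[OF assms(1,2,5,6)] by blast
next
  interpret NET_portrait G w d using assms(1,2) by (rule NET_portrait.intro)
  assume "[m = fst (mod2_elementary_divisors G w d)] (mod 2) \<and> [n = snd (mod2_elementary_divisors G w d)] (mod 2)"
  then show "\<exists>f. NET_map f \<and> weighted_iso G w (portrait f) (sphere_degree f) \<and> elementary_divisors f m n"
    using realize[OF assms(3-6)] by blast
qed

end
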